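(* For any $\alpha\in(0,1/4)$ and each of the location models below, there exists a constant $c>0$ depending only on $\alpha$ and the shape of the distribution such that whenever $\frac1n+\epsilon_{\max}\le c$ (with $\epsilon_{\max}>0$), the following hold for any $\epsilon\in[0,\epsilon_{\max}]$. 1. ($t$ distribution with $\nu>0$ degrees of freedom, $f(t)\propto(1+t^2/\nu)^{-\frac{\nu+1}{2}}$): $r_\alpha(\epsilon,[0,\epsilon_{\max}])\asymp 1$. 2. (Generalized Gaussian with $\beta>0$, $f(t)\propto\exp(-|t|^\beta)$): $r_\alpha(\epsilon,[0,\epsilon_{\max}])\asymp\left(\frac{1}{\log n}+\frac{1}{\log(1/\epsilon)}\right)^{\frac{(\beta-1)_+}{\beta}}$, where $(a)_+=\max(a,0)$. 3. (Mollifier with $\beta>0$, $f(t)\propto\exp\left(-\frac{1}{(1-t^2)^\beta}\right)\mathbf{1}\{|t|<1\}$): $r_\alpha(\epsilon,[0,\epsilon_{\max}])\asymp\left(\frac{1}{\log n}+\frac{1}{\log(1/\epsilon)}\right)^{\frac{\beta+1}{\beta}}$. 4. (Bates with order $k\in\mathbb{N}$, $k\ge1$; $f$ is the density of $\frac1k\sum_{j=1}^kU_j$ with $U_j\overset{iid}{\sim}\mathrm{Uniform}[-1/2,1/2]$): $r_\alpha(\epsilon,[0,\epsilon_{\max}])\asymp\left(\frac1n+\epsilon\right)^{\frac1k}$. Here $A\asymp B$ means $c_1B\le A\le c_2B$ with constants $c_1,c_2>0$ that may depend on $\epsilon_{\max}$, $\alpha$ and the shape parameter ($\nu$, $\beta$,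 $\beta$, $k$ respectively), but not on $n$ or $\epsilon$.
   Context: Location model: $X\sim P_\theta$ iff $X-\theta\sim P_0$, where $P_0$ has the indicated density $f$ on $\mathbb{R}$. For $\epsilon\in[0,1]$, $\theta\in\mathbb{R}$ and an arbitrary distribution $Q$ on $\mathbb{R}$, $P_{\epsilon,\theta,Q}=(1-\epsilon)P_\theta+\epsilon Q$; the data are $X_1,\ldots,X_n\overset{iid}{\sim}P_{\epsilon,\theta,Q}$ and $P_{\epsilon,\theta,Q}(\cdot)$ of an event about the data is its probability under this sampling. For $\mathcal{E}\subset[0,1]$, $\mathcal{I}_\alpha(\mathcal{E})$ is the set of data-dependent intervals $\widehat{\mathrm{CI}}=[l(X_1,\ldots,X_n),u(X_1,\ldots,X_n)]$ (empty if $u<l$) with $\inf_{\epsilon\in\mathcal{E}}\inf_{\theta,Q}P_{\epsilon,\theta,Q}(\theta\in\widehat{\mathrm{CI}})\ge 1-\alpha$, and $$r_\alpha(\epsilon,\mathcal{E})=\inf\left\{r\ge 0:\ \inf_{\widehat{\mathrm{CI}}\in\mathcal{I}_\alpha(\mathcal{E})}\ \sup_{\theta,Q}P_{\epsilon,\theta,Q}\big(|\widehat{\mathrm{CI}}|\ge r\big)\le\alpha\right\},$$ where $|\cdot|$ is length (Lebesgue measure). Convention: $1/\log(1/\epsilon)=0$ when $\epsilon=0$; a quantity raised to the power $0$ equals $1$. *)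

theory Defs
  imports "HOL-Probability.Probability"
begin

definition location_dist :: "real measure \<Rightarrow> real \<Rightarrow> real measure" where
  "location_dist P0 \<theta> = distr P0 borel (\<lambda>x. x + \<theta>)"

definition mixture :: "real \<Rightarrow> real measure \<Rightarrow> real measure \<Rightarrow> real measure" where
  "mixture \<epsilon> P Q = measure_of UNIV (sets borel)
     (\<lambda>A. ennreal (1 - \<epsilon>) * emeasure P A + ennreal \<epsilon> * emeasure Q A)"

definition contaminated :: "real measure \<Rightarrow> real \<Rightarrow> real \<Rightarrow> real measure \<Rightarrow> real measure" where
  "contaminated P0 \<epsilon> \<theta> Q = mixture \<epsilon> (location_dist P0 \<theta>) Q"

definition iid_sample :: "nat \<Rightarrow> real measure \<Rightarrow> (nat \<Rightarrow> real) measure" where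
  "iid_sample n P = PiM {..<n} (\<lambda>_. P)"

text \<open>A data-dependent interval is represented by its pair of measurable endpoint functions;
  \<open>{l x..u x}\<close> is empty when \<open>u x < l x\<close>. All infima and suprema below are taken in
  \<^typ>\<open>ennreal\<close>, so that an infimum over an empty set is \<open>\<infinity>\<close>.\<close>

type_synonym interval_procedure =
  "((nat \<Rightarrow> real) \<Rightarrow> real) \<times> ((nat \<Rightarrow> real) \<Rightarrow> real)"

definition interval_of :: "interval_procedure \<Rightarrow> (nat \<Rightarrow> real) \<Rightarrow> real set" where
  "interval_of CI x = {fst CI x..snd CI x}"

definition coverage ::
    "real measure \<Rightarrow> nat \<Rightarrow> interval_procedure \<Rightarrow> real \<Rightarrow> real \<Rightarrow> real measure \<Rightarrow> ennreal" where
  "coverage P0 n CI \<epsilon> \<theta> Q =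
     (let M = iid_sample n (contaminated P0 \<epsilon> \<theta> Q)
      in emeasure M {x \<in> space M. \<theta> \<in> interval_of CI x})"

definition length_tail ::
    "real measure \<Rightarrow> nat \<Rightarrow> interval_procedure \<Rightarrow> real \<Rightarrow> real \<Rightarrow> real \<Rightarrow> real measure \<Rightarrow> ennreal" where
  "length_tail P0 n CI r \<epsilon> \<theta> Q =
     (let M = iid_sample n (contaminated P0 \<epsilon> \<theta> Q)
      in emeasure M {x \<in> space M. ennreal r \<le> emeasure lborel (interval_of CI x)})"

definition robust_CIs ::
    "real measure \<Rightarrow> nat \<Rightarrow> real \<Rightarrow> real set \<Rightarrow> interval_procedure set" where
  "robust_CIs P0 n \<alpha> E =
     {CI. fst CI \<in> borel_measurable (PiM {..<n} (\<lambda>_. borel)) \<and>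
          snd CI \<in> borel_measurable (PiM {..<n} (\<lambda>_. borel)) \<and>
          ennreal (1 - \<alpha>) \<le>
            (INF \<epsilon>\<in>E. INF \<theta>. INF Q\<in>space (prob_algebra borel). coverage P0 n CI \<epsilon> \<theta> Q)}"

definition optimal_length ::
    "real measure \<Rightarrow> nat \<Rightarrow> real \<Rightarrow> real \<Rightarrow> real set \<Rightarrow> ennreal" where
  "optimal_length P0 n \<alpha> \<epsilon> E =
     Inf {ennreal r | r. 0 \<le> r \<and>
       (INF CI\<in>robust_CIs P0 n \<alpha> E.
          SUP \<theta>. SUP Q\<in>space (prob_algebra borel). length_tail P0 n CI r \<epsilon> \<theta> Q) \<le> ennreal \<alpha>}"

text \<open>The constant \<open>c\<close> is chosen before \<open>\<epsilon>max\<close>; the constants in \<open>\<asymp>\<close> are chosen after \<open>\<epsilon>max\<close>,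
  but before \<open>n\<close> and \<open>\<epsilon>\<close>.\<close>

definition has_adaptive_rate ::
    "real \<Rightarrow> real measure \<Rightarrow> (nat \<Rightarrow> real \<Rightarrow> real) \<Rightarrow> bool" where
  "has_adaptive_rate \<alpha> P0 B \<longleftrightarrow>
     (\<exists>c>0. \<forall>\<epsilon>max>0. \<exists>c1>0. \<exists>c2>0. \<forall>n\<ge>1.
        1 / real n + \<epsilon>max \<le> c \<longrightarrow>
        (\<forall>\<epsilon>\<in>{0..\<epsilon>max}.
           ennreal (c1 * B n \<epsilon>) \<le> optimal_length P0 n \<alpha> \<epsilon> {0..\<epsilon>max} \<and>
           optimal_length P0 n \<alpha> \<epsilon> {0..\<epsilon>max} \<le> ennreal (c2 * B n \<epsilon>)))"

definition normalized_density :: "(real \<Rightarrow> real) \<Rightarrow> real measure" where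
  "normalized_density g = density lborel (\<lambda>t. ennreal (g t / (\<integral>s. g s \<partial>lborel)))"

definition t_dist :: "real \<Rightarrow> real measure" where
  "t_dist \<nu> = normalized_density (\<lambda>t. (1 + t\<^sup>2 / \<nu>) powr (- ((\<nu> + 1) / 2)))"

definition generalized_gaussian :: "real \<Rightarrow> real measure" where
  "generalized_gaussian \<beta> = normalized_density (\<lambda>t. exp (- (\<bar>t\<bar> powr \<beta>)))"

definition mollifier :: "real \<Rightarrow> real measure" where
  "mollifier \<beta> = normalized_density
     (\<lambda>t. if \<bar>t\<bar> < 1 then exp (- (1 / (1 - t\<^sup>2) powr \<beta>)) else 0)"

definition bates :: "nat \<Rightarrow> real measure" where
  "bates k = distr (PiM {..<k} (\<lambda>_. uniform_measure lborel {- 1 / 2..1 / 2})) borel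
     (\<lambda>u. (\<Sum>j<k. u j) / real k)"

definition inv_log_inv :: "real \<Rightarrow> real" where
  "inv_log_inv \<epsilon> = (if \<epsilon> = 0 then 0 else 1 / ln (1 / \<epsilon>))"

lemma sets_mixture [simp]: "sets (mixture \<epsilon> P Q) = sets borel"
  and space_mixture [simp]: "space (mixture \<epsilon> P Q) = UNIV"
  using sets.sigma_sets_eq[of "borel :: real measure"] by (simp_all add: mixture_def)

lemma emeasure_mixture:
  assumes "sets P = sets borel" "sets Q = sets borel" "A \<in> sets borel"
  shows "emeasure (mixture \<epsilon> P Q) A = ennreal (1 - \<epsilon>) * emeasure P A + ennreal \<epsilon> * emeasure Q A"
proof (rule emeasure_measure_of[OF mixture_def])
  show "countably_additive (sets (mixture \<epsilon> P Q))
      (\<lambda>A. ennreal (1 - \<epsilon>) * emeasure P A + ennreal \<epsilon> * emeasure Q A)"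
    using assms(1,2)
    by (auto simp: countably_additive_def suminf_add[symmetric] suminf_emeasure
        ennreal_suminf_cmult)
qed (use assms in \<open>auto simp: positive_def\<close>)

lemma prob_space_contaminated:
  assumes "prob_space P0" "sets P0 = sets borel" "Q \<in> space (prob_algebra borel)" "\<epsilon> \<in> {0..1}"
  shows "prob_space (contaminated P0 \<epsilon> \<theta> Q)"
proof -
  have meas: "(\<lambda>x. x + \<theta>) \<in> P0 \<rightarrow>\<^sub>M borel"
    using assms(2) by (simp cong: measurable_cong_sets)
  interpret L: prob_space "location_dist P0 \<theta>"
    unfolding location_dist_def by (rule prob_space.prob_space_distr[OF assms(1) meas])
  have Q: "prob_space Q" "sets Q = sets borel"
    using assms(3) by (auto simp: space_prob_algebra)
  have "emeasure (location_dist P0 \<theta>) UNIV = 1" "emeasure Q UNIV = 1"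
    using L.emeasure_space_1 prob_space.emeasure_space_1[OF Q(1)] sets_eq_imp_space_eq[OF Q(2)]
    by (simp_all add: location_dist_def)
  then show ?thesis
    using assms(4) Q(2)
    by (intro prob_spaceI)
      (simp add: contaminated_def emeasure_mixture location_dist_def flip: ennreal_plus)
qed

end

theory Submission
  imports Defs
begin

text \<open>
  Write \<open>G\<close> for the right tail function of \<open>P0\<close> and \<open>\<tau> = \<epsilon> + 1/n\<close>.

  Upper bound. Let \<open>X\<^sub>+\<close> and \<open>X\<^sub>-\<close> be the \<open>m\<close>-th largest and \<open>m\<close>-th smallest observations and take the
  interval \<open>[X\<^sub>- + s, X\<^sub>+ - s]\<close>. At every contamination level at most \<open>\<epsilon>max\<close>, a Chernoff bound gives
  \<open>X\<^sub>+ > \<theta> + s\<close> as soon as \<open>m\<close> is well below \<open>n G(s)\<close>; at level \<open>\<epsilon>\<close>, Markov's inequality gives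
  \<open>X\<^sub>+ \<le> \<theta> + s + d\<close> as soon as \<open>m\<close> is well above \<open>n (\<epsilon> + G(s + d))\<close>. Hence the length is at most \<open>2 d\<close>
  whenever \<open>G(s)\<close> exceeds a large multiple of \<open>\<tau> + G(s + d)\<close>.

  Lower bound. Suppose the density satisfies \<open>p(x - r) \<le> (1 + \<delta>) p(x)\<close> for \<open>x \<le> T\<close>, and the mass
  \<open>G(T - r)\<close> of the shifted density beyond \<open>T\<close> is at most a small multiple of \<open>\<tau>\<close>. Then
  contamination of size \<open>\<epsilon>max\<close> around \<open>r\<close> imitates contamination of size \<open>\<epsilon>\<close> around \<open>0\<close> up to
  total variation of order \<open>1/n\<close>, so that a valid interval has to contain both \<open>0\<close> and \<open>r\<close>.

  For light tails both conditions are governed by the logarithmic derivative of \<open>p\<close> at the quantile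
  of order \<open>\<tau>\<close>; for the Bates distribution the ratio condition is a scaling property of its density
  at the end point of the support.
\<close>

section \<open>Counting observations and order statistics\<close>

text \<open>Coverage only asks that both order statistics lie far enough out. Contamination may add
  mass to a tail, but it lowers the clean tail mass by at most a factor 2 once
  \<open>emax \<le> 1/2\<close>, so coverage survives at every level up to \<open>emax\<close>. The
  opposite bound, which contamination can ruin, is claimed at level \<open>\<epsilon>\<close> only.
  The rank \<open>m\<close> may be tuned to \<open>\<epsilon>\<close>, because
  \<open>optimal_length\<close> minimises over procedures for each fixed \<open>\<epsilon>\<close>.
  In the lower bound, a one-sided domination of likelihoods replaces total variation: if the n-fold
  likelihood drops by at most a factor 2, the failures at \<open>0\<close>, at \<open>r\<close> and
  of the length have probabilities \<open>\<alpha>\<close>, \<open>2\<alpha>\<close> and about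
  \<open>\<alpha>\<close>, which is where \<open>\<alpha> < 1/4\<close> enters. The order of
  quantifiers shapes the rate criterion. The threshold on \<open>1/n + \<epsilon>max\<close> is
  chosen before \<open>\<epsilon>max\<close>. The ratio tolerance \<open>\<delta>\<close> depends on
  \<open>\<epsilon>max\<close>, so it may affect constants but not the admissible range of
  \<open>\<tau>\<close>. The factor required in the upper bound depends on \<open>\<alpha>\<close>
  alone and may shrink that range.\<close>

lemma measurable_card_PiM:
  assumes [measurable]: "A \<in> sets P"
  shows "(\<lambda>x. card {i\<in>{..<n::nat}. x i \<in> A}) \<in> PiM {..<n} (\<lambda>_. P) \<rightarrow>\<^sub>M count_space UNIV"
proof -
  have "(\<lambda>x. \<Sum>i<n. if x i \<in> A then 1 else (0::nat)) \<in> PiM {..<n} (\<lambda>_. P) \<rightarrow>\<^sub>M count_space UNIV"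
    by measurable
  moreover have "(\<Sum>i<n. if x i \<in> A then 1 else (0::nat)) = card {i\<in>{..<n}. x i \<in> A}" for x
    by (simp add: sum.If_cases Int_def)
  ultimately show ?thesis by simp
qed

text \<open>Markov's inequality for the number of observations in \<open>A\<close>, whose mean is
  \<open>n * measure P A\<close>.\<close>

lemma prob_card_ge_PiM:
  assumes "prob_space P" and A[measurable]: "A \<in> sets P"
  shows "real m * measure (PiM {..<n} (\<lambda>_. P)) {x \<in> space (PiM {..<n} (\<lambda>_. P)). m \<le> card {i\<in>{..<n}. x i \<in> A}}
           \<le> real n * measure P A"
proof -
  interpret D: prob_space P by fact
  interpret product_prob_space "\<lambda>_::nat. P" "{..<n}" ..
  let ?M = "PiM {..<n} (\<lambda>_. P)"
  note measurable_card_PiM[OF A, of n, measurable]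
  have "real m * measure ?M {x \<in> space ?M. m \<le> card {i\<in>{..<n}. x i \<in> A}}
     = (\<integral>x. real m * indicator {x \<in> space ?M. m \<le> card {i\<in>{..<n}. x i \<in> A}} x \<partial>?M)"
    by simp
  also have "\<dots> \<le> (\<integral>x. (\<Sum>i<n. indicator A (x i)) \<partial>?M)"
  proof (rule integral_mono)
    fix x assume "x \<in> space ?M"
    have "(\<Sum>i<n. indicator A (x i)) = real (card {i\<in>{..<n}. x i \<in> A})"
      by (simp add: indicator_def sum.If_cases Int_def)
    then show "real m * indicator {x \<in> space ?M. m \<le> card {i\<in>{..<n}. x i \<in> A}} x
        \<le> (\<Sum>i<n. indicator A (x i))"
      by (auto simp: indicator_def)
  next
    show "integrable ?M (\<lambda>x. \<Sum>i<n. indicat_real A (x i))"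
      by (intro Bochner_Integration.integrable_sum integrable_const_bound[where B=1])
        (auto simp: indicator_def)
  qed (auto intro!: integrable_const_bound[where B=m] simp: indicator_def)
  also have "\<dots> = (\<Sum>i<n. (\<integral>x. indicator A (x i) \<partial>?M))"
    by (intro Bochner_Integration.integral_sum integrable_const_bound[where B=1]) (auto simp: indicator_def)
  also have "\<dots> = (\<Sum>i<n. measure P A)"
  proof (rule sum.cong[OF refl])
    fix i assume i: "i \<in> {..<n}"
    then have "distr ?M P (\<lambda>x. x i) = P" by (rule PiM_component)
    then have "measure P A = (\<integral>y. indicator A y \<partial>distr ?M P (\<lambda>x. x i))" by simp
    also have "\<dots> = (\<integral>x. indicator A (x i) \<partial>?M)"
      using i by (subst integral_distr) auto
    finally show "(\<integral>x. indicator A (x i) \<partial>?M) = measure P A" by simp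
  qed
  finally show ?thesis by simp
qed

text \<open>Chernoff bound with base 1/2: the indicator of \<open>card < m\<close> is at most
  \<open>2 ^ m * (1/2) ^ card\<close>, the expectation factorises into
  \<open>(1 - measure P A / 2) ^ n\<close>, and \<open>2 \<le> exp 1\<close> gives the exponential
  form.\<close>

lemma prob_card_less_PiM:
  assumes "prob_space P" and A[measurable]: "A \<in> sets P"
  shows "measure (PiM {..<n} (\<lambda>_. P)) {x \<in> space (PiM {..<n} (\<lambda>_. P)). card {i\<in>{..<n}. x i \<in> A} < m}
           \<le> exp (real m - real n * measure P A / 2)"
proof -
  interpret D: prob_space P by fact
  interpret product_prob_space "\<lambda>_::nat. P" "{..<n}" ..
  let ?M = "PiM {..<n} (\<lambda>_. P)" and ?g = "\<lambda>y. 1 - indicator A y / 2 :: real"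
  note measurable_card_PiM[OF A, of n, measurable]
  have int: "integrable P ?g"
    by (rule D.integrable_const_bound[where B=1]) (auto simp: indicator_def)
  have "measure ?M {x \<in> space ?M. card {i\<in>{..<n}. x i \<in> A} < m}
     = (\<integral>x. indicator {x \<in> space ?M. card {i\<in>{..<n}. x i \<in> A} < m} x \<partial>?M)"
    by simp
  also have "\<dots> \<le> (\<integral>x. 2 ^ m * (\<Prod>i<n. ?g (x i)) \<partial>?M)"
  proof (rule integral_mono)
    show "integrable ?M (\<lambda>x. 2 ^ m * (\<Prod>i<n. ?g (x i)))"
      by (intro integrable_mult_right product_integrable_prod int) auto
    fix x assume "x \<in> space ?M"
    have "(\<Prod>i<n. ?g (x i)) = (\<Prod>i<n. if x i \<in> A then 1/2 else 1)"
      by (intro prod.cong) auto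
    then have eq: "(\<Prod>i<n. ?g (x i)) = (1/2) ^ card {i\<in>{..<n}. x i \<in> A}"
      by (simp add: prod.If_cases Int_def)
    have "1 \<le> (2::real) ^ m * (1/2) ^ j" if "j < m" for j
      using that by (simp add: field_simps power_increasing)
    then show "indicator {x \<in> space ?M. card {i\<in>{..<n}. x i \<in> A} < m} x
        \<le> 2 ^ m * (\<Prod>i<n. ?g (x i))"
      unfolding eq by (auto simp: indicator_def)
  qed (auto intro!: integrable_const_bound[where B=1])
  also have "\<dots> = 2 ^ m * (1 - measure P A / 2) ^ n"
  proof -
    have "integrable P (\<lambda>y. indicat_real A y / 2)"
      by (rule D.integrable_const_bound[where B=1]) (auto simp: indicator_def)
    then have "D.expectation ?g = 1 - measure P A / 2"
      by (subst Bochner_Integration.integral_diff) (auto simp: D.prob_space)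
    then show ?thesis
      using product_integral_prod[of "{..<n}" "\<lambda>_. ?g"] int by simp
  qed
  also have "\<dots> \<le> exp 1 ^ m * exp (- measure P A / 2) ^ n"
  proof (intro mult_mono power_mono)
    show "(2::real) \<le> exp 1" using exp_ge_add_one_self[of 1] by simp
    show "1 - measure P A / 2 \<le> exp (- measure P A / 2)"
      using exp_ge_add_one_self[of "- measure P A / 2"] by simp
    show "0 \<le> 1 - measure P A / 2" using D.prob_le_1[of A] by linarith
    then show "0 \<le> (1 - measure P A / 2) ^ n" by (rule zero_le_power)
  qed auto
  also have "\<dots> = exp (real m - real n * measure P A / 2)"
    unfolding exp_of_nat_mult[symmetric] exp_add[symmetric] by simp
  finally show ?thesis .
qed

text \<open>The max-min form of an order statistic avoids sorting: it exceeds \<open>a\<close>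
  exactly when some \<open>m\<close>-subset does, which reduces its law and its measurability to
  counting. It is meaningful for \<open>1 \<le> m \<le> n\<close>.\<close>

definition kth_largest :: "nat \<Rightarrow> nat \<Rightarrow> (nat \<Rightarrow> real) \<Rightarrow> real" where
  "kth_largest n m x = (MAX S\<in>{S. S \<subseteq> {..<n} \<and> card S = m}. MIN i\<in>S. x i)"

lemma less_kth_largest_iff:
  assumes "1 \<le> m" "m \<le> n"
  shows "a < kth_largest n m x \<longleftrightarrow> m \<le> card {i\<in>{..<n}. x i \<in> {a<..}}"
proof -
  let ?F = "{S. S \<subseteq> {..<n} \<and> card S = m}"
  have fin: "finite ?F" by (rule finite_subset[of _ "Pow {..<n}"]) auto
  have ne: "?F \<noteq> {}" using assms by (auto intro!: exI[of _ "{..<m}"])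
  have S: "finite S" "S \<noteq> {}" if "S \<in> ?F" for S
    using that assms finite_subset[of S "{..<n}"] by auto
  have "a < kth_largest n m x \<longleftrightarrow> (\<exists>S\<in>?F. a < (MIN i\<in>S. x i))"
    unfolding kth_largest_def using fin ne by (subst Max_gr_iff) auto
  also have "\<dots> \<longleftrightarrow> (\<exists>S\<in>?F. \<forall>i\<in>S. a < x i)"
    using S by (intro bex_cong) (auto simp: Min_gr_iff)
  also have "\<dots> \<longleftrightarrow> m \<le> card {i\<in>{..<n}. x i \<in> {a<..}}"
  proof
    assume "\<exists>S\<in>?F. \<forall>i\<in>S. a < x i"
    then obtain S where "S \<in> ?F" "\<forall>i\<in>S. a < x i" by blast
    then show "m \<le> card {i\<in>{..<n}. x i \<in> {a<..}}"
      using card_mono[of "{i\<in>{..<n}. x i \<in> {a<..}}" S] by auto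
  next
    assume "m \<le> card {i\<in>{..<n}. x i \<in> {a<..}}"
    then obtain S where "S \<subseteq> {i\<in>{..<n}. x i \<in> {a<..}}" "card S = m"
      using obtain_subset_with_card_n by metis
    then show "\<exists>S\<in>?F. \<forall>i\<in>S. a < x i" by (intro bexI[of _ S]) auto
  qed
  finally show ?thesis .
qed

text \<open>The coordinates are abstract functions \<open>f i\<close>, so that the result serves
  both the sample and its negation, hence both endpoints.\<close>

lemma borel_measurable_kth_largest:
  assumes "1 \<le> m" "m \<le> n" and [measurable]: "\<And>i. i < n \<Longrightarrow> f i \<in> borel_measurable M"
  shows "(\<lambda>x. kth_largest n m (\<lambda>i. f i x)) \<in> borel_measurable M"
proof (rule borel_measurableI_greater)
  fix a
  have "{x \<in> space M. a < kth_largest n m (\<lambda>i. f i x)}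
      = {x \<in> space M. m \<le> (\<Sum>i<n. if f i x \<in> {a<..} then 1 else (0::nat))}"
    by (simp only: less_kth_largest_iff[OF assms(1,2)]) (simp add: sum.If_cases Int_def)
  also have "\<dots> \<in> sets M" by measurable
  finally show "{x \<in> space M. a < kth_largest n m (\<lambda>i. f i x)} \<in> sets M" .
qed

section \<open>The order statistic interval\<close>

lemma measure_contaminated:
  assumes "prob_space P0" "sets P0 = sets borel" "Q \<in> space (prob_algebra borel)" "e \<in> {0..1}"
    and A: "A \<in> sets borel"
  shows "measure (contaminated P0 e \<theta> Q) A
    = (1 - e) * measure P0 ((\<lambda>x. x + \<theta>) -` A) + e * measure Q A"
proof -
  interpret P0: prob_space P0 by fact
  have Q: "prob_space Q" "sets Q = sets borel"
    using assms(3) by (auto simp: space_prob_algebra)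
  interpret Q: prob_space Q by fact
  have sp: "space P0 = UNIV" using assms(2) sets_eq_imp_space_eq by fastforce
  have "(\<lambda>x. x + \<theta>) \<in> P0 \<rightarrow>\<^sub>M borel"
    using assms(2) by (simp cong: measurable_cong_sets)
  then have "emeasure (location_dist P0 \<theta>) A = emeasure P0 ((\<lambda>x. x + \<theta>) -` A)"
    using A by (simp add: location_dist_def emeasure_distr sp)
  then have "emeasure (contaminated P0 e \<theta> Q) A
    = ennreal ((1 - e) * measure P0 ((\<lambda>x. x + \<theta>) -` A) + e * measure Q A)"
    using assms(4) Q(2) A
    by (simp add: contaminated_def emeasure_mixture location_dist_def P0.emeasure_eq_measure
      Q.emeasure_eq_measure ennreal_mult ennreal_plus)
  moreover have "0 \<le> (1 - e) * measure P0 ((\<lambda>x. x + \<theta>) -` A) + e * measure Q A"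
    using assms(4) by auto
  ultimately show ?thesis by (simp add: measure_def)
qed

lemma sets_iid_sample [simp]:
  "sets P = sets borel \<Longrightarrow> sets (iid_sample n P) = sets (PiM {..<n} (\<lambda>_. borel))"
  unfolding iid_sample_def by (rule sets_PiM_cong) auto

lemma sets_contaminated [simp]: "sets (contaminated P0 e \<theta> Q) = sets borel"
  by (simp add: contaminated_def)

text \<open>Hypothesis \<open>K\<close> leaves room for an integer rank with
  \<open>2 n (q + 1/n) / \<alpha> \<le> m \<le> n G / 8\<close>. The left inequality feeds Markov,
  the right one Chernoff, each with error \<open>\<alpha> / 2\<close> per side. The inequality
  \<open>2 * d < r\<close> is strict because \<open>length_tail\<close> also counts lengths equal to
  \<open>r\<close>.\<close>

lemma optimal_length_le:
  fixes P0 :: "real measure"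
  assumes P0: "prob_space P0" "sets P0 = sets borel"
    and sym: "\<And>s. measure P0 {..<- s} = measure P0 {s<..}"
    and \<alpha>: "0 < \<alpha>" "\<alpha> < 1" and n: "1 \<le> n" and e: "emax \<le> 1 / 2" "e \<in> {0..emax}"
    and K: "8 * (2 / \<alpha> + 1) * (e + 1 / real n + measure P0 {s + d<..}) \<le> measure P0 {s<..}"
    and d: "0 \<le> d" "2 * d < r"
  shows "optimal_length P0 n \<alpha> e {0..emax} \<le> ennreal r"
proof -
  interpret P0: prob_space P0 by fact
  define G where "G = measure P0 {s<..}"
  define q where "q = e + measure P0 {s + d<..}"
  \<comment> \<open>The summand \<open>1 / n\<close> keeps \<open>m\<close> positive even if
    \<open>q = 0\<close>. Rounding up costs at most 1, which is the \<open>+ 1\<close> in the factor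
    \<open>2 / \<alpha> + 1\<close>.\<close>
  define m where "m = nat \<lceil>2 * real n * (q + 1 / real n) / \<alpha>\<rceil>"
  \<comment> \<open>The \<open>m\<close>-th smallest observation is minus the \<open>m\<close>-th
    largest negated one, so one order statistic yields both endpoints.\<close>
  define CI :: interval_procedure where
    "CI = (\<lambda>x. s - kth_largest n m (\<lambda>i. - x i), \<lambda>x. kth_largest n m x - s)"
  have q0: "0 \<le> q" using e by (simp add: q_def)
  have mm: "2 * real n * (q + 1 / real n) / \<alpha> \<le> real m"
    "real m \<le> 2 * real n * (q + 1 / real n) / \<alpha> + 1"
  proof -
    have "0 \<le> 2 * real n * (q + 1 / real n) / \<alpha>" using q0 \<alpha> by simp
    then have "real m = of_int \<lceil>2 * real n * (q + 1 / real n) / \<alpha>\<rceil>"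
      unfolding m_def by (subst of_nat_nat) linarith+
    then show "2 * real n * (q + 1 / real n) / \<alpha> \<le> real m"
      "real m \<le> 2 * real n * (q + 1 / real n) / \<alpha> + 1" by linarith+
  qed
  have nq: "1 \<le> real n * (q + 1 / real n)" using n q0 by (simp add: field_simps)
  have K': "8 * (2 / \<alpha> + 1) * (real n * (q + 1 / real n)) \<le> real n * G"
    using mult_left_mono[OF K of_nat_0_le_iff, of n] unfolding q_def G_def by (simp only: ac_simps)
  have "2 * real n * (q + 1 / real n) / \<alpha> + 1 \<le> (2 / \<alpha> + 1) * (real n * (q + 1 / real n))"
    unfolding distrib_right[of "2 / \<alpha>" 1] using nq by simp
  also have "\<dots> \<le> real n * G / 8"
  proof -
    have "x \<le> y / 8" if "8 * x \<le> y" for x y :: real using that by simp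
    then show ?thesis using K'[unfolded mult.assoc[of 8]] by blast
  qed
  finally have mG: "real m \<le> real n * G / 8" using mm(2) by linarith
  have "8 * (2 / \<alpha> + 1) \<le> 8 * (2 / \<alpha> + 1) * (real n * (q + 1 / real n))"
    using mult_left_mono[OF nq, of "8 * (2 / \<alpha> + 1)"] \<alpha> by simp
  also have "\<dots> \<le> real n * G"
    by (rule K')
  finally have nG: "2 / \<alpha> + 1 \<le> real n * G / 8" by simp
  have "G \<le> 1" by (simp add: G_def)
  then have "real n * G / 8 \<le> real n" using n mult_left_mono[of G 1 "real n"] by simp
  then have mn: "m \<le> n" using mG by linarith
  have "0 < 2 * real n * (q + 1 / real n) / \<alpha>" using nq \<alpha> by (auto intro!: divide_pos_pos)
  then have m1: "1 \<le> m" using mm(1) by linarith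

  have meas: "(\<lambda>x. kth_largest n m x) \<in> borel_measurable (PiM {..<n} (\<lambda>_. borel))"
     "(\<lambda>x. kth_largest n m (\<lambda>i. - x i)) \<in> borel_measurable (PiM {..<n} (\<lambda>_. borel))"
    using borel_measurable_kth_largest[OF m1 mn, of "\<lambda>i x. x i"]
      borel_measurable_kth_largest[OF m1 mn, of "\<lambda>i x. - x i"] by simp_all

  have few: "measure (iid_sample n C) {x \<in> space (iid_sample n C). card {i\<in>{..<n}. x i \<in> A} < m} \<le> \<alpha> / 2"
    if "prob_space C" "A \<in> sets C" "G / 2 \<le> measure C A" for C A
  proof -
    \<comment> \<open>The exponent is at most \<open>n G / 8 - n G / 4\<close>, and
      \<open>n G / 8 \<ge> 2 / \<alpha>\<close> turns the bound into
      \<open>exp (- 2 / \<alpha>) \<le> \<alpha> / 2\<close>.\<close>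
    have "exp (real m - real n * measure C A / 2) \<le> exp (- (real n * G / 8))"
      using mG mult_left_mono[OF that(3), of "real n"] by simp
    also have "\<dots> \<le> exp (- (2 / \<alpha>))" using nG by simp
    also have "\<dots> \<le> inverse (2 / \<alpha>)"
    proof -
      have "2 / \<alpha> \<le> exp (2 / \<alpha>)" using exp_ge_add_one_self[of "2 / \<alpha>"] by linarith
      then show ?thesis using \<alpha> unfolding exp_minus by (intro le_imp_inverse_le) auto
    qed
    finally show ?thesis using prob_card_less_PiM[OF that(1,2), of n m] by (simp add: iid_sample_def)
  qed
  have many: "measure (iid_sample n C) {x \<in> space (iid_sample n C). m \<le> card {i\<in>{..<n}. x i \<in> A}} \<le> \<alpha> / 2"
    if "prob_space C" "A \<in> sets C" "measure C A \<le> q" for C A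
  proof -
    have "real m * measure (iid_sample n C) {x \<in> space (iid_sample n C). m \<le> card {i\<in>{..<n}. x i \<in> A}} \<le> real n * q"
      using prob_card_ge_PiM[OF that(1,2), of m n] mult_left_mono[OF that(3), of "real n"]
      by (simp add: iid_sample_def)
    also have "\<dots> \<le> real m * (\<alpha> / 2)"
    proof -
      have "2 * real n * (q + 1 / real n) = 2 * (real n * q) + 2" using n by (simp add: distrib_left)
      then have "2 * (real n * q) + 2 \<le> real m * \<alpha>" using mm(1) \<alpha> by (simp add: pos_divide_le_eq)
      then show ?thesis by simp
    qed
    finally show ?thesis using m1 by simp
  qed
  have pre: "(\<lambda>x. x + \<theta>) -` {\<theta> + a<..} = {a<..}" "(\<lambda>x. x + \<theta>) -` {..<\<theta> - a} = {..<- a}" for \<theta> a :: real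
    by auto
  have cardneg: "card {i\<in>{..<n}. - x i \<in> {a - \<theta><..}} = card {i\<in>{..<n}. x i \<in> {..<\<theta> - a}}" for x :: "nat \<Rightarrow> real" and a \<theta>
    by (rule arg_cong[where f=card]) auto

  have "CI \<in> robust_CIs P0 n \<alpha> {0..emax}"
    unfolding robust_CIs_def
  proof (intro CollectI conjI INF_greatest)
    show "fst CI \<in> borel_measurable (PiM {..<n} (\<lambda>_. borel))" "snd CI \<in> borel_measurable (PiM {..<n} (\<lambda>_. borel))"
      using meas by (simp_all add: CI_def)
    fix e' \<theta> :: real and Q :: "real measure" assume e': "e' \<in> {0..emax}" and Q: "Q \<in> space (prob_algebra borel)"
    define C where "C = contaminated P0 e' \<theta> Q"
    define M where "M = iid_sample n C"
    have e'1: "e' \<in> {0..1}" using e' e by auto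
    have C: "prob_space C" "sets C = sets borel" using prob_space_contaminated[OF P0 Q e'1] by (auto simp: C_def)
    interpret M: prob_space M unfolding M_def iid_sample_def by (rule prob_space_PiM) (rule C)
    have setsM: "sets M = sets (PiM {..<n} (\<lambda>_. borel))" by (simp add: M_def C)
    have [measurable]: "(\<lambda>x. kth_largest n m x) \<in> borel_measurable M"
      "(\<lambda>x. kth_largest n m (\<lambda>i. - x i)) \<in> borel_measurable M"
      unfolding measurable_cong_sets[OF setsM refl] by (fact meas)+
    let ?A = "{\<theta> + s<..}" and ?B = "{..<\<theta> - s}"
    \<comment> \<open>At least half of the clean tail mass remains, whatever \<open>Q\<close> does:
      this is where \<open>emax \<le> 1 / 2\<close> is used.\<close>
    have half: "G / 2 \<le> (1 - e') * G" using e' e mult_right_mono[of "1/2" "1 - e'" G] by (auto simp: G_def)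
    have "measure C ?A = (1 - e') * G + e' * measure Q ?A" "measure C ?B = (1 - e') * G + e' * measure Q ?B"
      unfolding C_def G_def
      by (simp_all only: measure_contaminated[OF P0 Q e'1] lessThan_borel greaterThan_borel pre sym)
    moreover have "0 \<le> e' * measure Q A" for A using e' by simp
    ultimately have g: "G / 2 \<le> measure C ?A" "G / 2 \<le> measure C ?B"
      using half by (simp_all add: add_increasing2)
    have AB: "?A \<in> sets C" "?B \<in> sets C" by (simp_all add: C)
    define E where "E A = {x \<in> space M. card {i\<in>{..<n}. x i \<in> A} < m}" for A
    have ab: "M.prob (E ?A) \<le> \<alpha> / 2" "M.prob (E ?B) \<le> \<alpha> / 2"
      unfolding E_def M_def by (intro few C(1) AB g)+
    have Emeas: "E A \<in> sets M" if A: "A \<in> sets borel" for A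
    proof -
      have [measurable]: "(\<lambda>x. card {i\<in>{..<n}. x i \<in> A}) \<in> M \<rightarrow>\<^sub>M count_space UNIV"
        unfolding measurable_cong_sets[OF setsM refl] by (rule measurable_card_PiM[OF A])
      show ?thesis unfolding E_def by measurable
    qed
    define S where "S = {x \<in> space M. \<theta> \<in> interval_of CI x}"
    have "S = {x \<in> space M. s - kth_largest n m (\<lambda>i. - x i) \<le> \<theta> \<and> \<theta> \<le> kth_largest n m x - s}"
      unfolding S_def interval_of_def CI_def by simp
    also have "\<dots> \<in> sets M" by measurable
    finally have Smeas: "S \<in> sets M" .
    have "space M - S \<subseteq> E ?A \<union> E ?B"
    proof
      fix x assume x: "x \<in> space M - S"
      then have "\<not> \<theta> + s < kth_largest n m x \<or> \<not> s - \<theta> < kth_largest n m (\<lambda>i. - x i)"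
        by (auto simp: S_def interval_of_def CI_def)
      then show "x \<in> E ?A \<union> E ?B"
        using x unfolding less_kth_largest_iff[OF m1 mn] cardneg E_def not_le by blast
    qed
    then have "M.prob (space M - S) \<le> M.prob (E ?A \<union> E ?B)"
      by (intro M.finite_measure_mono sets.Un Emeas) simp_all
    also have "\<dots> \<le> M.prob (E ?A) + M.prob (E ?B)"
      by (intro measure_Un_le Emeas) simp_all
    finally have "1 - \<alpha> \<le> M.prob S" using M.prob_compl[OF Smeas] ab by simp
    then show "ennreal (1 - \<alpha>) \<le> coverage P0 n CI e' \<theta> Q"
      by (simp add: coverage_def Let_def M.emeasure_eq_measure flip: C_def M_def S_def)
  qed
  moreover have "length_tail P0 n CI r e \<theta> Q \<le> ennreal \<alpha>" if Q: "Q \<in> space (prob_algebra borel)" for \<theta> Q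
  proof -
    define C where "C = contaminated P0 e \<theta> Q"
    define M where "M = iid_sample n C"
    have e1: "e \<in> {0..1}" using e by auto
    have C: "prob_space C" "sets C = sets borel" using prob_space_contaminated[OF P0 Q e1] by (auto simp: C_def)
    interpret M: prob_space M unfolding M_def iid_sample_def by (rule prob_space_PiM) (rule C)
    interpret Q: prob_space Q using Q by (simp add: space_prob_algebra)
    have setsM: "sets M = sets (PiM {..<n} (\<lambda>_. borel))" by (simp add: M_def C)
    let ?A = "{\<theta> + (s + d)<..}" and ?B = "{..<\<theta> - (s + d)}"
    have le: "(1 - e) * a + e * b \<le> e + a" if "0 \<le> a" "b \<le> 1" for a b :: real
      using that e mult_left_mono[of b 1 e] mult_right_mono[of "1 - e" 1 a] by auto
    have g: "measure C ?A \<le> q" "measure C ?B \<le> q"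
      unfolding C_def q_def
      by (simp_all only: measure_contaminated[OF P0 Q e1] lessThan_borel greaterThan_borel pre sym)
        (simp_all add: le)
    have AB: "?A \<in> sets C" "?B \<in> sets C" by (simp_all add: C)
    define E where "E A = {x \<in> space M. m \<le> card {i\<in>{..<n}. x i \<in> A}}" for A
    have ab: "M.prob (E ?A) \<le> \<alpha> / 2" "M.prob (E ?B) \<le> \<alpha> / 2"
      unfolding E_def M_def by (intro many C(1) AB g)+
    have Emeas: "E A \<in> sets M" if A: "A \<in> sets borel" for A
    proof -
      have [measurable]: "(\<lambda>x. card {i\<in>{..<n}. x i \<in> A}) \<in> M \<rightarrow>\<^sub>M count_space UNIV"
        unfolding measurable_cong_sets[OF setsM refl] by (rule measurable_card_PiM[OF A])
      show ?thesis unfolding E_def by measurable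
    qed
    have "{x \<in> space M. ennreal r \<le> emeasure lborel (interval_of CI x)} \<subseteq> E ?A \<union> E ?B"
    proof
      fix x assume x: "x \<in> {x \<in> space M. ennreal r \<le> emeasure lborel (interval_of CI x)}"
      \<comment> \<open>Off both events the interval is contained in
        \<open>[\<theta> - d, \<theta> + d]\<close>.\<close>
      have "\<theta> + (s + d) < kth_largest n m x \<or> (s + d) - \<theta> < kth_largest n m (\<lambda>i. - x i)"
      proof (rule ccontr)
        assume "\<not> ?thesis"
        then have "snd CI x - fst CI x < r" using d by (auto simp: CI_def)
        then have "emeasure lborel (interval_of CI x) < ennreal r"
          using d by (cases "fst CI x \<le> snd CI x") (auto simp: interval_of_def ennreal_less_iff)
        then show False using x by auto
      qed
      then show "x \<in> E ?A \<union> E ?B"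
        using x unfolding less_kth_largest_iff[OF m1 mn] cardneg E_def by blast
    qed
    then have "emeasure M {x \<in> space M. ennreal r \<le> emeasure lborel (interval_of CI x)}
       \<le> emeasure M (E ?A \<union> E ?B)"
      by (intro emeasure_mono sets.Un Emeas) simp_all
    also have "\<dots> \<le> ennreal \<alpha>"
      unfolding M.emeasure_eq_measure
    proof (rule ennreal_leI)
      have "M.prob (E ?A \<union> E ?B) \<le> M.prob (E ?A) + M.prob (E ?B)"
        by (intro measure_Un_le Emeas) simp_all
      then show "M.prob (E ?A \<union> E ?B) \<le> \<alpha>" using ab by linarith
    qed
    finally show ?thesis by (simp add: length_tail_def Let_def flip: C_def M_def)
  qed
  ultimately have "(INF CI\<in>robust_CIs P0 n \<alpha> {0..emax}.
          SUP \<theta>. SUP Q\<in>space (prob_algebra borel). length_tail P0 n CI r e \<theta> Q) \<le> ennreal \<alpha>"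
    by (intro INF_lower2[of CI] SUP_least)
  then show ?thesis
    unfolding optimal_length_def using d by (intro Inf_lower) auto
qed

section \<open>Indistinguishable contaminated models\<close>

lemma nn_integral_scaled_mono:
  assumes "sets N' = sets N" and le: "\<And>A. A \<in> sets N \<Longrightarrow> c * emeasure N A \<le> emeasure N' A"
    and f: "f \<in> borel_measurable N"
  shows "c * (\<integral>\<^sup>+x. f x \<partial>N) \<le> (\<integral>\<^sup>+x. f x \<partial>N')"
proof -
  have "scale_measure c N \<le> N'"
    using assms by (subst le_measure) auto
  then have "(\<integral>\<^sup>+x. f x \<partial>scale_measure c N) \<le> (\<integral>\<^sup>+x. f x \<partial>N')"
    using assms by (intro nn_integral_mono_measure) auto
  then show ?thesis by (simp add: nn_integral_scale_measure f)
qed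

text \<open>Domination up to a factor tensorises: integrating out one coordinate at a time costs one
  factor \<open>c\<close> each.\<close>

lemma nn_integral_PiM_scaled_mono:
  fixes I :: "'i set"
  assumes "finite I" "prob_space N" "prob_space N'" and sets_eq: "sets N' = sets N"
    and le: "\<And>A. A \<in> sets N \<Longrightarrow> c * emeasure N A \<le> emeasure N' A"
    and f: "f \<in> borel_measurable (PiM I (\<lambda>_. N))"
  shows "c ^ card I * (\<integral>\<^sup>+x. f x \<partial>PiM I (\<lambda>_. N)) \<le> (\<integral>\<^sup>+x. f x \<partial>PiM I (\<lambda>_. N'))"
  using \<open>finite I\<close> f
proof (induction I arbitrary: f)
  case empty
  then show ?case by (simp add: PiM_empty)
next
  case (insert i I)
  interpret N: prob_space N by fact
  interpret N': prob_space N' by fact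
  interpret PN: product_sigma_finite "\<lambda>_::'i. N" ..
  interpret PN': product_sigma_finite "\<lambda>_::'i. N'" ..
  have eq: "sets (PiM J (\<lambda>_. N')) = sets (PiM J (\<lambda>_. N))" for J :: "'i set"
    by (rule sets_PiM_cong) (auto simp: sets_eq)
  note [measurable_cong] = sets_eq eq
  note [measurable] = insert.prems
  have [measurable]: "f \<in> borel_measurable (PiM (insert i I) (\<lambda>_. N'))"
    using insert.prems by (simp cong: measurable_cong_sets add: eq)
  have meas: "(\<lambda>x. \<integral>\<^sup>+y. f (x(i := y)) \<partial>N) \<in> borel_measurable (PiM I (\<lambda>_. N))"
    by measurable
  have "c ^ card (insert i I) * (\<integral>\<^sup>+x. f x \<partial>PiM (insert i I) (\<lambda>_. N))
     = c ^ card I * (c * (\<integral>\<^sup>+x. (\<integral>\<^sup>+y. f (x(i := y)) \<partial>N) \<partial>PiM I (\<lambda>_. N)))"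
    using insert by (simp add: PN.product_nn_integral_insert ac_simps)
  also have "\<dots> = c ^ card I * (\<integral>\<^sup>+x. c * (\<integral>\<^sup>+y. f (x(i := y)) \<partial>N) \<partial>PiM I (\<lambda>_. N))"
    using meas by (subst nn_integral_cmult) auto
  also have "\<dots> \<le> (\<integral>\<^sup>+x. c * (\<integral>\<^sup>+y. f (x(i := y)) \<partial>N) \<partial>PiM I (\<lambda>_. N'))"
    by (intro insert.IH borel_measurable_times_ennreal borel_measurable_const meas)
  also have "\<dots> \<le> (\<integral>\<^sup>+x. (\<integral>\<^sup>+y. f (x(i := y)) \<partial>N') \<partial>PiM I (\<lambda>_. N'))"
  proof (intro nn_integral_mono nn_integral_scaled_mono sets_eq le)
    fix x assume "x \<in> space (PiM I (\<lambda>_. N'))"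
    then have "x \<in> space (PiM I (\<lambda>_. N))" using sets_eq_imp_space_eq[OF eq] by simp
    then show "(\<lambda>y. f (x(i := y))) \<in> borel_measurable N" by measurable
  qed
  also have "\<dots> = (\<integral>\<^sup>+x. f x \<partial>PiM (insert i I) (\<lambda>_. N'))"
    by (rule PN'.product_nn_integral_insert[symmetric]) (use insert(1,2) in simp_all)
  finally show ?case .
qed

text \<open>Two-point argument. If lengths below \<open>\<rho>\<close> were achievable, then under
  the law centred at \<open>0\<close> the interval would miss \<open>0\<close>, miss
  \<open>\<rho>\<close>, or be too long, and the three probabilities add up to less than 1. Missing
  \<open>\<rho>\<close> is unlikely under the law centred at \<open>\<rho>\<close> and is
  transferred by \<open>dom\<close>.\<close>

lemma optimal_length_ge:
  fixes P0 :: "real measure"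
  assumes P0: "prob_space P0" "sets P0 = sets borel" and \<alpha>: "0 < \<alpha>" "\<alpha> < 1 / 4"
    and e: "e \<in> {0..emax}" "emax \<le> 1" and \<rho>: "0 \<le> \<rho>"
    and Q: "Q0 \<in> space (prob_algebra borel)" "Q1 \<in> space (prob_algebra borel)"
    and l: "0 \<le> l" "1 / 2 \<le> l ^ n"
    and dom: "\<And>A. A \<in> sets borel \<Longrightarrow> ennreal l * emeasure (contaminated P0 e 0 Q0) A
        \<le> emeasure (contaminated P0 emax \<rho> Q1) A"
  shows "ennreal \<rho> \<le> optimal_length P0 n \<alpha> e {0..emax}"
  unfolding optimal_length_def
proof (rule Inf_greatest, clarify)
  fix r :: real
  assume r: "0 \<le> r" and inf: "(INF CI\<in>robust_CIs P0 n \<alpha> {0..emax}.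
          SUP \<theta>. SUP Q\<in>space (prob_algebra borel). length_tail P0 n CI r e \<theta> Q) \<le> ennreal \<alpha>"
  show "ennreal \<rho> \<le> ennreal r"
  proof (rule ccontr)
    assume "\<not> ennreal \<rho> \<le> ennreal r"
    then have less: "r < \<rho>" using ennreal_leI not_le by blast
    \<comment> \<open>The infimum over procedures need not be attained; this is exactly the slack
      for which the final sum \<open>4 * \<alpha> + \<delta>\<close> equals 1.\<close>
    define \<delta> where "\<delta> = 1 - 4 * \<alpha>"
    have \<delta>: "0 < \<delta>" using \<alpha> by (simp add: \<delta>_def)
    have "ennreal \<alpha> < ennreal (\<alpha> + \<delta>)" using \<alpha> \<delta> by (intro ennreal_lessI) auto
    with inf have "(INF CI\<in>robust_CIs P0 n \<alpha> {0..emax}.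
          SUP \<theta>. SUP Q\<in>space (prob_algebra borel). length_tail P0 n CI r e \<theta> Q) < ennreal (\<alpha> + \<delta>)"
      by (rule order_le_less_trans)
    then obtain CI where CI: "CI \<in> robust_CIs P0 n \<alpha> {0..emax}"
      and tail: "(SUP \<theta>. SUP Q\<in>space (prob_algebra borel). length_tail P0 n CI r e \<theta> Q) < ennreal (\<alpha> + \<delta>)"
      unfolding INF_less_iff by blast
    have "length_tail P0 n CI r e 0 Q0 \<le> (SUP \<theta>. SUP Q\<in>space (prob_algebra borel). length_tail P0 n CI r e \<theta> Q)"
      by (rule SUP_upper2[of 0], simp, rule SUP_upper[OF Q(1)])
    with tail have tail0: "length_tail P0 n CI r e 0 Q0 < ennreal (\<alpha> + \<delta>)" by simp
    have cov: "ennreal (1 - \<alpha>) \<le> coverage P0 n CI e' \<theta> Q'"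
      if "e' \<in> {0..emax}" "Q' \<in> space (prob_algebra borel)" for e' \<theta> Q'
    proof -
      have "ennreal (1 - \<alpha>) \<le> (INF \<epsilon>\<in>{0..emax}. INF \<theta>. INF Q\<in>space (prob_algebra borel). coverage P0 n CI \<epsilon> \<theta> Q)"
        using CI by (simp add: robust_CIs_def)
      also have "\<dots> \<le> coverage P0 n CI e' \<theta> Q'"
        by (rule INF_lower2[OF that(1)], rule INF_lower2[of \<theta>], simp, rule INF_lower[OF that(2)])
      finally show ?thesis .
    qed
    define C0 C1 where "C0 = contaminated P0 e 0 Q0" and "C1 = contaminated P0 emax \<rho> Q1"
    define M0 M1 where "M0 = iid_sample n C0" and "M1 = iid_sample n C1"
    have C0: "prob_space C0" "sets C0 = sets borel" unfolding C0_def
      using prob_space_contaminated[OF P0 Q(1)] e by auto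
    have C1: "prob_space C1" "sets C1 = sets borel" unfolding C1_def
      using prob_space_contaminated[OF P0 Q(2), of emax] e by auto
    interpret M0: prob_space M0 unfolding M0_def iid_sample_def by (rule prob_space_PiM) (rule C0)
    interpret M1: prob_space M1 unfolding M1_def iid_sample_def by (rule prob_space_PiM) (rule C1)
    have setsM: "sets M0 = sets (PiM {..<n} (\<lambda>_. borel))" "sets M1 = sets (PiM {..<n} (\<lambda>_. borel))"
      by (simp_all add: M0_def M1_def C0 C1)
    then have spM: "space M1 = space M0" by (metis sets_eq_imp_space_eq)
    have [measurable]: "fst CI \<in> borel_measurable M0" "snd CI \<in> borel_measurable M0"
      unfolding measurable_cong_sets[OF setsM(1) refl] using CI by (simp_all add: robust_CIs_def)
    define S where "S \<theta> = {x \<in> space M0. \<theta> \<in> interval_of CI x}" for \<theta>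
    define L where "L = {x \<in> space M0. ennreal r \<le> emeasure lborel (interval_of CI x)}"
    have Smeas: "S \<theta> \<in> sets M0" for \<theta> unfolding S_def interval_of_def by simp
    \<comment> \<open>The disjunct \<open>r \<le> 0\<close> accounts for empty intervals, whose
      length 0 reaches \<open>r\<close> when \<open>r = 0\<close>.\<close>
    have "L = {x \<in> space M0. r \<le> 0 \<or> r \<le> snd CI x - fst CI x}"
      unfolding L_def using r
      by (intro Collect_cong conj_cong refl) (auto simp: interval_of_def emeasure_lborel_Icc_eq ennreal_le_iff2)
    also have "\<dots> \<in> sets M0" by measurable
    finally have Lmeas: "L \<in> sets M0" .
    have p0: "1 - \<alpha> \<le> M0.prob (S 0)"
      using cov[OF e(1) Q(1), of 0] \<alpha>
      by (simp add: coverage_def Let_def M0.emeasure_eq_measure flip: C0_def M0_def S_def)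
    have "1 - \<alpha> \<le> M1.prob (S \<rho>)"
      using cov[OF _ Q(2), of emax \<rho>] \<alpha> e
      by (simp add: coverage_def Let_def M1.emeasure_eq_measure spM flip: C1_def M1_def S_def)
    then have p1: "M1.prob (space M0 - S \<rho>) \<le> \<alpha>"
      using M1.prob_compl[of "S \<rho>"] Smeas setsM spM by simp
    have pL: "M0.prob L < \<alpha> + \<delta>"
      using tail0 \<alpha> \<delta>
      by (simp add: length_tail_def Let_def M0.emeasure_eq_measure ennreal_less_iff del: ennreal_plus flip: C0_def M0_def L_def)
    \<comment> \<open>Since \<open>l ^ n \<ge> 1 / 2\<close>, the failure event at
      \<open>\<rho>\<close> is at most twice as likely under \<open>M0\<close> as under
      \<open>M1\<close>.\<close>
    have "ennreal l ^ card {..<n} * (\<integral>\<^sup>+x. indicator (space M0 - S \<rho>) x \<partial>M0)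
        \<le> (\<integral>\<^sup>+x. indicator (space M0 - S \<rho>) x \<partial>M1)"
      unfolding M0_def M1_def iid_sample_def
      by (rule nn_integral_PiM_scaled_mono)
        (use C0 C1 dom Smeas in \<open>auto simp: C0_def C1_def M0_def iid_sample_def intro!: borel_measurable_indicator\<close>)
    moreover have "space M0 - S \<rho> \<in> sets M0" "space M0 - S \<rho> \<in> sets M1"
      using sets.compl_sets[OF Smeas] by (simp_all add: setsM)
    ultimately have "l ^ n * M0.prob (space M0 - S \<rho>) \<le> M1.prob (space M0 - S \<rho>)"
      using l(1) by (simp only: nn_integral_indicator M0.emeasure_eq_measure M1.emeasure_eq_measure
        ennreal_power ennreal_mult'[symmetric] card_lessThan ennreal_le_iff measure_nonneg zero_le_power)
    moreover have "1 / 2 * M0.prob (space M0 - S \<rho>) \<le> l ^ n * M0.prob (space M0 - S \<rho>)"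
      using l by (intro mult_right_mono) auto
    ultimately have p2: "M0.prob (space M0 - S \<rho>) \<le> 2 * \<alpha>" using p1 by simp
    have "space M0 \<subseteq> (space M0 - S 0) \<union> (space M0 - S \<rho>) \<union> L"
    proof
      fix x assume x: "x \<in> space M0"
      have "ennreal r \<le> emeasure lborel (interval_of CI x)" if "x \<in> S 0" "x \<in> S \<rho>"
      proof -
        have "ennreal \<rho> = emeasure lborel {0..\<rho>}" using \<rho> by simp
        also have "\<dots> \<le> emeasure lborel (interval_of CI x)"
          using that by (intro emeasure_mono) (auto simp: S_def interval_of_def)
        finally show ?thesis using less by (meson ennreal_leI less_imp_le order_trans)
      qed
      then show "x \<in> (space M0 - S 0) \<union> (space M0 - S \<rho>) \<union> L" using x by (auto simp: L_def)
    qed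
    then have "1 \<le> M0.prob ((space M0 - S 0) \<union> (space M0 - S \<rho>) \<union> L)"
      using M0.finite_measure_mono[of "space M0" "(space M0 - S 0) \<union> (space M0 - S \<rho>) \<union> L"] Smeas Lmeas
      by (simp add: M0.prob_space)
    also have "\<dots> \<le> M0.prob (space M0 - S 0) + M0.prob (space M0 - S \<rho>) + M0.prob L"
      using Smeas Lmeas
      by (intro order_trans[OF measure_Un_le] add_right_mono measure_Un_le) auto
    also have "\<dots> < \<alpha> + 2 * \<alpha> + (\<alpha> + \<delta>)"
      using p0 p2 pL M0.prob_compl[of "S 0"] Smeas by simp
    finally show False by (simp add: \<delta>_def)
  qed
qed

section \<open>Realising prescribed densities as contaminated models\<close>

lemma location_dist_density:
  assumes [measurable]: "p \<in> borel_measurable borel"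
  shows "location_dist (density lborel (\<lambda>x. ennreal (p x))) \<theta> = density lborel (\<lambda>x. ennreal (p (x - \<theta>)))"
proof (rule measure_eqI)
  fix A assume "A \<in> sets (location_dist (density lborel (\<lambda>x. ennreal (p x))) \<theta>)"
  then have [measurable]: "A \<in> sets borel" by (simp add: location_dist_def)
  have [measurable]: "(\<lambda>x. x + \<theta>) -` A \<in> sets borel"
    using measurable_sets[of "\<lambda>x. x + \<theta>" borel borel A] by simp
  have "emeasure (location_dist (density lborel (\<lambda>x. ennreal (p x))) \<theta>) A
    = (\<integral>\<^sup>+x. ennreal (p x) * indicator A (x + \<theta>) \<partial>lborel)"
    by (simp add: location_dist_def emeasure_distr emeasure_density)
      (auto intro!: nn_integral_cong simp: indicator_def)
  also have "\<dots> = (\<integral>\<^sup>+x. ennreal (p (x - \<theta>)) * indicator A x \<partial>lborel)"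
    by (subst nn_integral_real_affine[where c=1 and t="-\<theta>"]) (auto simp: algebra_simps)
  finally show "emeasure (location_dist (density lborel (\<lambda>x. ennreal (p x))) \<theta>) A
    = emeasure (density lborel (\<lambda>x. ennreal (p (x - \<theta>)))) A"
    by (simp add: emeasure_density)
qed (simp add: location_dist_def)

text \<open>The contaminant is the excess of \<open>g\<close> over the floor
  \<open>(1 - e) * p (x - \<theta>)\<close>, divided by \<open>e\<close>; comparing total masses
  shows that it is a probability.\<close>

lemma contaminated_eq_densityE:
  assumes [measurable]: "p \<in> borel_measurable borel" "g \<in> borel_measurable borel"
    and p: "\<And>x. 0 \<le> p x" "prob_space (density lborel (\<lambda>x. ennreal (p x)))"
    and g: "prob_space (density lborel (\<lambda>x. ennreal (g x)))"
    and le: "\<And>x. (1 - e) * p (x - \<theta>) \<le> g x" and e: "0 < e" "e \<le> 1"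
  obtains Q where "Q \<in> space (prob_algebra borel)"
    "contaminated (density lborel (\<lambda>x. ennreal (p x))) e \<theta> Q = density lborel (\<lambda>x. ennreal (g x))"
proof
  let ?P = "density lborel (\<lambda>x. ennreal (p x))" and ?q = "\<lambda>x. (g x - (1 - e) * p (x - \<theta>)) / e"
  define Q where "Q = density lborel (\<lambda>x. ennreal (?q x))"
  have eq: "ennreal (1 - e) * emeasure (location_dist ?P \<theta>) A + ennreal e * emeasure Q A
      = emeasure (density lborel (\<lambda>x. ennreal (g x))) A" if [measurable]: "A \<in> sets borel" for A
  proof -
    have pt: "ennreal (1 - e) * ennreal (p (x - \<theta>)) + ennreal e * ennreal (?q x) = ennreal (g x)" for x
      using e le[of x] p(1)[of "x - \<theta>"] by (simp flip: ennreal_mult ennreal_plus)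
    have "ennreal (1 - e) * emeasure (location_dist ?P \<theta>) A + ennreal e * emeasure Q A
      = (\<integral>\<^sup>+x. ennreal (1 - e) * (ennreal (p (x - \<theta>)) * indicator A x) + ennreal e * (ennreal (?q x) * indicator A x) \<partial>lborel)"
      by (simp add: location_dist_density Q_def emeasure_density nn_integral_add nn_integral_cmult)
    also have "\<dots> = (\<integral>\<^sup>+x. ennreal (g x) * indicator A x \<partial>lborel)"
      by (intro nn_integral_cong) (simp add: pt mult.assoc[symmetric] distrib_right[symmetric])
    finally show ?thesis by (simp add: emeasure_density)
  qed
  have "emeasure (location_dist ?P \<theta>) UNIV = 1"
    using prob_space.emeasure_space_1[OF p(2)]
    by (simp add: location_dist_def emeasure_distr)
  moreover have "emeasure (density lborel (\<lambda>x. ennreal (g x))) UNIV = 1"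
    using prob_space.emeasure_space_1[OF g] by simp
  ultimately have "ennreal (1 - e) + ennreal e * emeasure Q UNIV = 1"
    using eq[of UNIV] by simp
  then have "emeasure Q UNIV = 1"
    using e by (cases "emeasure Q UNIV") (auto simp: ennreal_mult_top simp flip: ennreal_mult ennreal_plus)
  then show Q: "Q \<in> space (prob_algebra borel)"
    by (auto simp: space_prob_algebra Q_def intro!: prob_spaceI)
  show "contaminated ?P e \<theta> Q = density lborel (\<lambda>x. ennreal (g x))"
  proof (rule measure_eqI)
    fix A assume "A \<in> sets (contaminated ?P e \<theta> Q)"
    then have "A \<in> sets borel" by simp
    then show "emeasure (contaminated ?P e \<theta> Q) A = emeasure (density lborel (\<lambda>x. ennreal (g x))) A"
      using eq by (simp add: contaminated_def emeasure_mixture location_dist_def Q_def)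
  qed simp
qed

text \<open>Both models are mixtures of \<open>p\<close> and of the part \<open>h\<close> of the
  shifted density beyond \<open>T\<close>. Up to \<open>T\<close> the ratio bound lets
  \<open>p\<close> itself carry the floor required at \<open>r\<close>, and beyond \<open>T\<close>
  the function \<open>h\<close> carries it; at \<open>0\<close> the contamination budget
  \<open>e\<close> is spent on imitating \<open>h\<close>.\<close>

lemma optimal_length_ge_density:
  fixes p :: "real \<Rightarrow> real"
  defines "P0 \<equiv> density lborel (\<lambda>x. ennreal (p x))"
  assumes p[measurable]: "p \<in> borel_measurable borel" and p0: "\<And>x. 0 \<le> p x" and P0: "prob_space P0"
    and \<alpha>: "0 < \<alpha>" "\<alpha> < 1 / 4" and n: "1 \<le> n" and emax: "0 < emax" "emax \<le> 1 / 2" and e: "e \<in> {0..emax}"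
    and r: "0 \<le> r" and ratio: "\<And>x. x \<le> T \<Longrightarrow> p (x - r) \<le> (1 + emax / 2) * p x"
    and tail: "measure P0 {T - r<..} \<le> emax / 2" "measure P0 {T - r<..} \<le> e + 1 / (4 * real n)"
  shows "ennreal r \<le> optimal_length P0 n \<alpha> e {0..emax}"
proof -
  interpret P0: prob_space P0 by fact
  define a where "a = measure P0 {T - r<..}"
  \<comment> \<open>Level \<open>e\<close> pays for mass at most \<open>e\<close> of
    \<open>h\<close>. If \<open>a = 0\<close> then \<open>\<kappa> = 0\<close> as well, so the
    quotient \<open>\<kappa> / a\<close>, which is 0 by convention, is harmless.\<close>
  define \<kappa> where "\<kappa> = min a e"
  define h where "h x = (if T < x then p (x - r) else 0)" for x
  define g0 where "g0 x = (1 - \<kappa>) * p x + \<kappa> / a * h x" for x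
  define g1 where "g1 x = (1 - a) * p x + h x" for x
  define l where "l = (1 - a) / (1 - \<kappa>)"
  have a: "0 \<le> a" "a \<le> 1 / 4" using tail emax by (auto simp: a_def)
  have \<kappa>: "0 \<le> \<kappa>" "\<kappa> \<le> a" "\<kappa> \<le> e" using a e by (auto simp: \<kappa>_def)
  have h0: "0 \<le> h x" for x using p0 by (simp add: h_def)
  have [measurable]: "h \<in> borel_measurable borel" "g0 \<in> borel_measurable borel" "g1 \<in> borel_measurable borel"
    unfolding h_def[abs_def] g0_def[abs_def] g1_def[abs_def] by measurable
  have ip: "(\<integral>\<^sup>+x. ennreal (p x) \<partial>lborel) = 1"
    using P0.emeasure_space_1 by (simp add: P0_def emeasure_density)
  have "ennreal a = emeasure P0 {T - r<..}" by (simp add: a_def P0.emeasure_eq_measure)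
  also have "\<dots> = (\<integral>\<^sup>+x. ennreal (p x) * indicator {T - r<..} x \<partial>lborel)"
    by (simp add: P0_def emeasure_density)
  also have "\<dots> = (\<integral>\<^sup>+x. ennreal (h x) \<partial>lborel)"
    by (subst nn_integral_real_affine[where c=1 and t="-r"])
      (auto simp: h_def indicator_def algebra_simps intro!: nn_integral_cong)
  finally have ih: "(\<integral>\<^sup>+x. ennreal (h x) \<partial>lborel) = ennreal a" ..
  have comb: "(\<integral>\<^sup>+x. ennreal (u * p x + v * h x) \<partial>lborel) = ennreal (u + v * a)" if "0 \<le> u" "0 \<le> v" for u v
    using that p0 h0 a by (simp add: ennreal_plus ennreal_mult nn_integral_add nn_integral_cmult ip ih)
  have prob: "prob_space (density lborel (\<lambda>x. ennreal (u * p x + v * h x)))" if "0 \<le> u" "0 \<le> v" "u + v * a = 1" for u v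
    using comb[OF that(1,2)] that(3) by (intro prob_spaceI) (simp add: emeasure_density)
  have prob0: "prob_space (density lborel (\<lambda>x. ennreal (g0 x)))"
    unfolding g0_def using \<kappa> a by (intro prob) auto
  have prob1: "prob_space (density lborel (\<lambda>x. ennreal (g1 x)))"
    using prob[of "1 - a" 1] a by (simp add: g1_def)
  obtain Q1 where Q1: "Q1 \<in> space (prob_algebra borel)"
    "contaminated P0 emax r Q1 = density lborel (\<lambda>x. ennreal (g1 x))"
    unfolding P0_def
  proof (rule contaminated_eq_densityE[OF p _ p0 P0[unfolded P0_def] prob1])
    \<comment> \<open>Up to \<open>T\<close> the point is
      \<open>(1 - emax) * (1 + emax / 2) \<le> 1 - emax / 2 \<le> 1 - a\<close>.\<close>
    show "(1 - emax) * p (x - r) \<le> g1 x" for x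
    proof (cases "x \<le> T")
      case True
      have "(1 - emax) * p (x - r) \<le> (1 - emax) * ((1 + emax / 2) * p x)"
        using ratio[OF True] emax by (intro mult_left_mono) auto
      also have "\<dots> = ((1 - emax) * (1 + emax / 2)) * p x" by simp
      also have "\<dots> \<le> (1 - a) * p x"
      proof (intro mult_right_mono p0)
        have "(1 - emax) * (1 + emax / 2) = 1 - emax / 2 - emax * emax / 2" by (simp add: field_simps)
        also have "\<dots> \<le> 1 - a" using tail(1) zero_le_square[of emax] unfolding a_def by linarith
        finally show "(1 - emax) * (1 + emax / 2) \<le> 1 - a" .
      qed
      finally show ?thesis using h0[of x] by (simp add: g1_def)
    next
      case False
      then have "g1 x \<ge> p (x - r)" using a p0 by (simp add: g1_def h_def)
      moreover have "(1 - emax) * p (x - r) \<le> p (x - r)"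
        using emax p0 by (intro mult_left_le_one_le) auto
      ultimately show ?thesis by linarith
    qed
  qed (use emax in auto)
  have P0': "P0 \<in> space (prob_algebra borel)" using P0 by (simp add: space_prob_algebra P0_def)
  obtain Q0 where Q0: "Q0 \<in> space (prob_algebra borel)"
    "contaminated P0 e 0 Q0 = density lborel (\<lambda>x. ennreal (g0 x))"
  \<comment> \<open>Division by \<open>e\<close> in the excess rules out \<open>e = 0\<close>; then
    \<open>g0 = p\<close>, and any contaminant, such as \<open>P0\<close>, will do.\<close>
  proof (cases "e = 0")
    case True
    then have "\<kappa> = 0" using \<kappa> by simp
    then have "g0 = p" by (auto simp: g0_def)
    moreover have "contaminated P0 0 0 P0 = P0"
    proof (rule measure_eqI)
      fix A assume "A \<in> sets (contaminated P0 0 0 P0)"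
      then show "emeasure (contaminated P0 0 0 P0) A = emeasure P0 A"
        using location_dist_density[OF p, of 0]
        by (simp add: contaminated_def emeasure_mixture P0_def location_dist_def)
    qed (simp add: P0_def)
    ultimately show ?thesis using that[OF P0'] True by (simp add: P0_def)
  next
    case False
    show ?thesis
      unfolding P0_def
    proof (rule contaminated_eq_densityE[OF p _ p0 P0[unfolded P0_def] prob0, of e 0])
      show "(1 - e) * p (x - 0) \<le> g0 x" for x
        using mult_right_mono[of "1 - e" "1 - \<kappa>" "p x"] \<kappa> a p0 h0 by (auto simp: g0_def intro!: add_increasing2)
      fix Q assume "Q \<in> space (prob_algebra borel)"
        "contaminated (density lborel (\<lambda>x. ennreal (p x))) e 0 Q = density lborel (\<lambda>x. ennreal (g0 x))"
      then show ?thesis using that by (simp add: P0_def)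
    qed (use e emax False in auto)
  qed
  have l01: "0 \<le> l" "l \<le> 1" using a \<kappa> by (auto simp: l_def divide_simps)
  \<comment> \<open>The weights are compared term by term: \<open>l * (1 - \<kappa>) = 1 - a\<close>
    for \<open>p\<close>, and \<open>l * \<kappa> / a \<le> 1\<close> for \<open>h\<close>.\<close>
  have lg: "l * g0 x \<le> g1 x" for x
  proof -
    have "l * (\<kappa> / a) \<le> 1" using l01 \<kappa> a by (intro mult_le_one) (auto simp: divide_simps)
    then have "l * (\<kappa> / a) * h x \<le> 1 * h x" by (intro mult_right_mono h0)
    moreover have "l * (1 - \<kappa>) = 1 - a" using \<kappa> a by (simp add: l_def)
    ultimately show ?thesis unfolding g0_def g1_def distrib_left mult.assoc[symmetric] by simp
  qed
  \<comment> \<open>Only the part of \<open>a\<close> not covered by the budget \<open>e\<close> is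
    lost, and it is at most \<open>1 / (4 n)\<close>; Bernoulli's inequality then handles the
    \<open>n\<close>-th power.\<close>
  have ln: "1 / 2 \<le> l ^ n"
  proof -
    have "a \<le> e + 1 / (4 * real n)" using tail(2) by (simp add: a_def)
    then have "a - \<kappa> \<le> 1 / (4 * real n)" by (simp add: \<kappa>_def min_def)
    then have "real n * (a - \<kappa>) \<le> 1 / 4" using n by (simp add: field_simps)
    then have "real n * (a - \<kappa>) / (1 - \<kappa>) \<le> 1 / 2" using \<kappa> a by (simp add: divide_simps)
    moreover have l: "l = 1 + - ((a - \<kappa>) / (1 - \<kappa>))" using \<kappa> a by (simp add: l_def field_simps)
    ultimately have "1 / 2 \<le> 1 + real n * (- ((a - \<kappa>) / (1 - \<kappa>)))" by simp
    also have "\<dots> \<le> l ^ n" unfolding l by (rule Bernoulli_inequality) (use l01 l in simp)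
    finally show ?thesis .
  qed
  show ?thesis
  proof (rule optimal_length_ge[OF P0 _ \<alpha> e _ r Q0(1) Q1(1) l01(1) ln])
    fix A :: "real set" assume [measurable]: "A \<in> sets borel"
    have "ennreal l * emeasure (contaminated P0 e 0 Q0) A
      = (\<integral>\<^sup>+x. ennreal l * (ennreal (g0 x) * indicator A x) \<partial>lborel)"
      by (simp add: Q0 emeasure_density nn_integral_cmult)
    also have "\<dots> \<le> (\<integral>\<^sup>+x. ennreal (g1 x) * indicator A x \<partial>lborel)"
      using lg l01 by (intro nn_integral_mono) (auto simp: indicator_def ennreal_leI simp flip: ennreal_mult')
    also have "\<dots> = emeasure (contaminated P0 emax r Q1) A" by (simp add: Q1 emeasure_density)
    finally show "ennreal l * emeasure (contaminated P0 e 0 Q0) A \<le> emeasure (contaminated P0 emax r Q1) A" .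
  qed (use emax in \<open>auto simp: P0_def\<close>)
qed

section \<open>A rate criterion for even densities\<close>

locale even_density =
  fixes p :: "real \<Rightarrow> real"
  assumes p_measurable [measurable]: "p \<in> borel_measurable borel"
    and p_nonneg: "0 \<le> p x"
    and p_even: "p (- x) = p x"
    and prob_space_p: "prob_space (density lborel (\<lambda>x. ennreal (p x)))"
begin

abbreviation P :: "real measure" where "P \<equiv> density lborel (\<lambda>x. ennreal (p x))"

sublocale prob_space P by (fact prob_space_p)

section \<open>Calculus of the tail function\<close>

definition tail :: "real \<Rightarrow> real" where "tail s = measure P {s<..}"

lemma ennreal_tail: "ennreal (tail s) = (\<integral>\<^sup>+x. ennreal (p x) * indicator {s<..} x \<partial>lborel)"
  unfolding tail_def emeasure_eq_measure[symmetric] by (simp add: emeasure_density)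

lemma measure_lessThan_uminus: "measure P {..<- s} = tail s"
proof -
  have "emeasure P {..<- s} = (\<integral>\<^sup>+x. ennreal (p x) * indicator {..<- s} x \<partial>lborel)"
    by (simp add: emeasure_density)
  also have "\<dots> = (\<integral>\<^sup>+x. ennreal (p x) * indicator {s<..} x \<partial>lborel)"
    by (subst nn_integral_real_affine[where c="-1" and t=0])
      (auto simp: p_even indicator_def intro!: nn_integral_cong)
  finally have "emeasure P {..<- s} = ennreal (tail s)" by (simp add: ennreal_tail)
  then show ?thesis by (simp add: emeasure_eq_measure tail_def)
qed

lemma tail_nonneg: "0 \<le> tail s" by (simp add: tail_def)

lemma tail_antimono: "s \<le> t \<Longrightarrow> tail t \<le> tail s"
  unfolding tail_def by (intro finite_measure_mono) auto

lemma tail_zero: "tail 0 = 1 / 2"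
proof -
  have "emeasure P {0} = (\<integral>\<^sup>+x. ennreal (p x) * indicator {0} x \<partial>lborel)"
    by (rule emeasure_density) auto
  also have "\<dots> = integral\<^sup>N lborel (\<lambda>x::real. 0)"
  proof (rule nn_integral_cong_AE)
    have "AE x in lborel. x \<noteq> (0::real)" by (rule AE_lborel_singleton)
    then show "AE x in lborel. ennreal (p x) * indicator {0} x = 0" by eventually_elim simp
  qed
  finally have "emeasure P {0} = 0" by simp
  then have "prob {0} = 0" by (simp add: measure_def)
  moreover have "prob (({..<0} \<union> {0<..}) \<union> {0}) = prob ({..<0} \<union> {0<..}) + prob {0}"
    by (intro finite_measure_Union) auto
  moreover have "prob ({..<0} \<union> {0<..}) = prob {..<0} + prob {0<..}"
    by (intro finite_measure_Union) auto
  moreover have "({..<0} \<union> {0<..}) \<union> {0} = (UNIV :: real set)" by auto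
  moreover have "prob UNIV = 1" using prob_space by simp
  ultimately show ?thesis
    using measure_lessThan_uminus[of 0] by (simp add: tail_def)
qed

lemma tail_less_ex: "0 < e \<Longrightarrow> \<exists>t\<ge>0. tail t < e"
proof -
  assume e: "0 < e"
  have "(\<lambda>n. prob {real n<..}) \<longlonglongrightarrow> prob (\<Inter>n. {real n<..})"
    by (intro finite_Lim_measure_decseq) (auto simp: decseq_def)
  moreover have "(\<Inter>n. {real n<..}) = {}"
  proof -
    have "x \<notin> (\<Inter>n. {real n<..})" for x
    proof -
      obtain n where "x < real n" using reals_Archimedean2 by blast
      then show ?thesis by (auto intro!: exI[of _ n])
    qed
    then show ?thesis by blast
  qed
  ultimately have "(\<lambda>n. tail (real n)) \<longlonglongrightarrow> 0" by (simp add: tail_def)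
  then have "eventually (\<lambda>n. tail (real n) < e) sequentially" using e by (rule order_tendstoD)
  then obtain n where "tail (real n) < e" by (auto simp: eventually_sequentially)
  then show ?thesis by (intro exI[of _ "real n"]) auto
qed

text \<open>Translation by \<open>d\<close> moves the tail integral back to \<open>{s<..}\<close>,
  where the pointwise decay applies.\<close>

lemma tail_add_le:
  assumes "\<And>x. s \<le> x \<Longrightarrow> p (x + d) \<le> q * p x" "0 \<le> q"
  shows "tail (s + d) \<le> q * tail s"
proof -
  have "ennreal (tail (s + d)) = (\<integral>\<^sup>+x. ennreal (p (x + d)) * indicator {s<..} x \<partial>lborel)"
    unfolding ennreal_tail by (subst nn_integral_real_affine[where c=1 and t=d])
      (auto simp: indicator_def add.commute intro!: nn_integral_cong)
  also have "\<dots> \<le> (\<integral>\<^sup>+x. ennreal q * (ennreal (p x) * indicator {s<..} x) \<partial>lborel)"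
    using assms by (intro nn_integral_mono) (auto simp: indicator_def ennreal_leI simp flip: ennreal_mult')
  also have "\<dots> = ennreal (q * tail s)"
    using assms(2) by (simp add: nn_integral_cmult ennreal_tail ennreal_mult')
  finally show ?thesis using assms(2) tail_nonneg by (simp add: ennreal_le_iff)
qed

lemma tail_ge:
  assumes "a \<le> b" "0 \<le> m" "\<And>x. a < x \<Longrightarrow> x < b \<Longrightarrow> m \<le> p x"
  shows "(b - a) * m \<le> tail a"
proof -
  have "ennreal ((b - a) * m) = (\<integral>\<^sup>+x. ennreal m * indicator {a<..<b} x \<partial>lborel)"
    using assms by (simp add: nn_integral_cmult_indicator ennreal_mult' mult.commute)
  also have "\<dots> \<le> ennreal (tail a)"
    unfolding ennreal_tail using assms by (intro nn_integral_mono) (auto simp: indicator_def ennreal_leI)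
  finally show ?thesis using tail_nonneg by (simp add: ennreal_le_iff)
qed

text \<open>\<open>upper\<close> may restrict \<open>\<tau>\<close> in terms of \<open>K\<close>,
  since \<open>K\<close> is fixed by \<open>\<alpha>\<close>. In \<open>lower\<close> the range
  \<open>\<tau> \<le> c0\<close> is fixed before \<open>\<delta>\<close>, because
  \<open>\<delta>\<close> is derived from \<open>emax\<close>, which is quantified after the
  threshold.\<close>

theorem has_adaptive_rateI:
  assumes \<alpha>: "0 < \<alpha>" "\<alpha> < 1 / 4" and c0: "0 < c0"
    and R: "\<And>\<tau>. 0 < \<tau> \<Longrightarrow> \<tau> \<le> c0 \<Longrightarrow> 0 < R \<tau>"
    and upper: "\<And>K. 0 < K \<Longrightarrow> \<exists>c>0. \<exists>C>0. \<forall>\<tau>. 0 < \<tau> \<longrightarrow> \<tau> \<le> c \<longrightarrow>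
        (\<exists>s d. 0 \<le> d \<and> d \<le> C * R \<tau> \<and> K * (\<tau> + tail (s + d)) \<le> tail s)"
    and lower: "\<And>\<delta>. 0 < \<delta> \<Longrightarrow> \<delta> < 1 \<Longrightarrow> \<exists>c>0. \<forall>\<tau>. 0 < \<tau> \<longrightarrow> \<tau> \<le> c0 \<longrightarrow>
        (\<exists>r T. c * R \<tau> \<le> r \<and> (\<forall>x\<le>T. p (x - r) \<le> (1 + \<delta>) * p x) \<and> tail (T - r) \<le> \<delta> * \<tau>)"
    and b: "0 < b"
    and B: "\<And>n e. 1 \<le> n \<Longrightarrow> 0 \<le> e \<Longrightarrow> e + 1 / real n \<le> c0 \<Longrightarrow>
        B n e \<le> b * R (e + 1 / real n) \<and> R (e + 1 / real n) \<le> b * B n e"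
  shows "has_adaptive_rate \<alpha> P B"
proof -
  define K where "K = 8 * (2 / \<alpha> + 1)"
  have K0: "0 < K" using \<alpha> by (simp add: K_def add_pos_pos)
  obtain cU C where cU: "0 < cU" "0 < C" and U: "\<forall>\<tau>. 0 < \<tau> \<longrightarrow> \<tau> \<le> cU \<longrightarrow>
        (\<exists>s d. 0 \<le> d \<and> d \<le> C * R \<tau> \<and> K * (\<tau> + tail (s + d)) \<le> tail s)"
    using upper[OF K0] by blast
  define c where "c = min (min c0 cU) (1 / 2)"
  show ?thesis unfolding has_adaptive_rate_def
  proof (rule exI[of _ c], intro conjI allI impI)
    show "0 < c" using c0 cU by (simp add: c_def)
    fix emax :: real assume emax: "0 < emax"
    \<comment> \<open>\<open>emax / 2\<close> is the slack that
      \<open>optimal_length_ge_density\<close> allows for both the ratio and the tail mass;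
      \<open>1 / 4\<close> ensures \<open>\<delta> * \<tau> \<le> e + 1 / (4 * n)\<close>.\<close>
    define \<delta> where "\<delta> = min (emax / 2) (1 / 4)"
    have \<delta>: "0 < \<delta>" "\<delta> < 1" "\<delta> \<le> emax / 2" "\<delta> \<le> 1 / 4" using emax by (auto simp: \<delta>_def)
    obtain cL where cL: "0 < cL" and L: "\<forall>\<tau>. 0 < \<tau> \<longrightarrow> \<tau> \<le> c0 \<longrightarrow>
        (\<exists>r T. cL * R \<tau> \<le> r \<and> (\<forall>x\<le>T. p (x - r) \<le> (1 + \<delta>) * p x) \<and> tail (T - r) \<le> \<delta> * \<tau>)"
      using lower[OF \<delta>(1,2)] by blast
    have "ennreal (cL / b * B n e) \<le> optimal_length P n \<alpha> e {0..emax} \<and>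
          optimal_length P n \<alpha> e {0..emax} \<le> ennreal (3 * C * b * B n e)"
      if n: "1 \<le> n" and c: "1 / real n + emax \<le> c" and e: "e \<in> {0..emax}" for n e
    proof -
      define \<tau> where "\<tau> = e + 1 / real n"
      have \<tau>: "0 < \<tau>" "\<tau> \<le> c0" "\<tau> \<le> cU" "\<tau> \<le> 1 / 2" and emax2: "emax \<le> 1 / 2"
      proof -
        have n0: "0 < 1 / real n" using n by simp
        have "c \<le> c0" "c \<le> cU" "c \<le> 1 / 2" by (simp_all add: c_def)
        moreover have "\<tau> \<le> c" using c e by (simp add: \<tau>_def)
        ultimately show "\<tau> \<le> c0" "\<tau> \<le> cU" "\<tau> \<le> 1 / 2" by linarith+
        have "0 \<le> e" using e by simp
        then show "0 < \<tau>" using n0 unfolding \<tau>_def by linarith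
        show "emax \<le> 1 / 2" using n0 c \<open>c \<le> 1 / 2\<close> by linarith
      qed
      have e0: "0 \<le> e" using e by simp
      have Bn: "B n e \<le> b * R \<tau>" "R \<tau> \<le> b * B n e"
        using B[OF n e0] \<tau> by (auto simp: \<tau>_def)
      have R0: "0 < R \<tau>" using R \<tau> by auto
      obtain r T where r: "cL * R \<tau> \<le> r" and ratio: "\<And>x. x \<le> T \<Longrightarrow> p (x - r) \<le> (1 + \<delta>) * p x"
        and tl: "tail (T - r) \<le> \<delta> * \<tau>"
        using L[rule_format, OF \<tau>(1,2)] by blast
      have "ennreal r \<le> optimal_length P n \<alpha> e {0..emax}"
      proof (rule optimal_length_ge_density[OF p_measurable p_nonneg prob_space_p \<alpha> n emax emax2 e])
        show "0 \<le> r" using r mult_pos_pos[OF cL R0] by linarith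
        show "p (x - r) \<le> (1 + emax / 2) * p x" if "x \<le> T" for x
        proof -
          have "(1 + \<delta>) * p x \<le> (1 + emax / 2) * p x"
            using \<delta> p_nonneg by (intro mult_right_mono) auto
          then show ?thesis using ratio[OF that] by linarith
        qed
        have "\<delta> * \<tau> \<le> \<delta>" using \<delta> \<tau> by (intro mult_left_le) auto
        then show "prob {T - r<..} \<le> emax / 2" using tl \<delta>(3) unfolding tail_def by linarith
        have "\<delta> * \<tau> \<le> 1 / 4 * \<tau>" using \<delta> \<tau> by (intro mult_right_mono) auto
        also have "\<dots> \<le> e + 1 / (4 * real n)" using e0 by (simp add: \<tau>_def)
        finally show "prob {T - r<..} \<le> e + 1 / (4 * real n)" using tl unfolding tail_def by linarith
      qed
      moreover have "cL / b * B n e \<le> r"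
      proof -
        have "cL / b * B n e \<le> cL / b * (b * R \<tau>)" using Bn cL b by (intro mult_left_mono) auto
        also have "\<dots> = cL * R \<tau>" using b by simp
        finally show ?thesis using r by linarith
      qed
      ultimately have lo: "ennreal (cL / b * B n e) \<le> optimal_length P n \<alpha> e {0..emax}"
        using order_trans[OF ennreal_leI] by blast
      obtain s d where d: "0 \<le> d" "d \<le> C * R \<tau>" and K: "K * (\<tau> + tail (s + d)) \<le> tail s"
        using U[rule_format, OF \<tau>(1,3)] by blast
      \<comment> \<open>The factor is 3 because \<open>2 * d < r\<close> has to be strict while
        \<open>d\<close> may equal \<open>C * R \<tau>\<close>.\<close>
      have "optimal_length P n \<alpha> e {0..emax} \<le> ennreal (3 * (C * R \<tau>))"
      proof (rule optimal_length_le[OF prob_space_p])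
        show "8 * (2 / \<alpha> + 1) * (e + 1 / real n + prob {s + d<..}) \<le> prob {s<..}"
          using K by (simp add: K_def \<tau>_def tail_def)
        have "0 < C * R \<tau>" using cU R0 by simp
        then show "2 * d < 3 * (C * R \<tau>)" using d by linarith
        show "prob {..<- s} = prob {s<..}" for s
          using measure_lessThan_uminus[of s] by (simp add: tail_def)
      qed (use \<alpha> n e d emax2 in auto)
      also have "\<dots> \<le> ennreal (3 * C * b * B n e)"
        using mult_left_mono[OF Bn(2), of "3 * C"] cU by (intro ennreal_leI) (simp add: ac_simps)
      finally show ?thesis using lo by blast
    qed
    then show "\<exists>c1>0. \<exists>c2>0. \<forall>n::nat\<ge>1. 1 / real n + emax \<le> c \<longrightarrow>
        (\<forall>e\<in>{0..emax}. ennreal (c1 * B n e) \<le> optimal_length P n \<alpha> e {0..emax} \<and>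
           optimal_length P n \<alpha> e {0..emax} \<le> ennreal (c2 * B n e))"
      using cL cU b by (intro exI[of _ "cL / b"] conjI exI[of _ "3 * C * b"] allI ballI impI) auto
  qed
qed

text \<open>A shift that is harmless at every point lets \<open>T\<close> move out as far as the
  tail condition requires, with \<open>r\<close> independent of \<open>\<tau>\<close>. The upper
  bound starts at the median, \<open>s = 0\<close>, where the tail is \<open>1 / 2\<close>.\<close>

lemma has_adaptive_rate_const:
  assumes \<alpha>: "0 < \<alpha>" "\<alpha> < 1 / 4"
    and ratio: "\<And>\<delta>. 0 < \<delta> \<Longrightarrow> \<delta> < 1 \<Longrightarrow> \<exists>r>0. \<forall>x. p (x - r) \<le> (1 + \<delta>) * p x"
    and B: "\<And>n e. 1 \<le> n \<Longrightarrow> 0 \<le> e \<Longrightarrow> e + 1 / real n \<le> 1 / 2 \<Longrightarrow> B n e = 1"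
  shows "has_adaptive_rate \<alpha> P B"
proof (rule has_adaptive_rateI[where R="\<lambda>_. 1" and b=1 and ?c0.0="1/2", OF \<alpha>])
  fix K :: real assume K: "0 < K"
  then obtain t where t: "0 \<le> t" "tail t < 1 / (4 * K)" using tail_less_ex[of "1 / (4 * K)"] by auto
  have "K * (\<tau> + tail t) \<le> 1 / 2" if "\<tau> \<le> 1 / (4 * K)" for \<tau>
  proof -
    have "\<tau> + tail t \<le> 1 / (2 * K)" using that t(2) by (simp add: field_simps)
    then have "K * (\<tau> + tail t) \<le> K * (1 / (2 * K))" using K by (intro mult_left_mono) auto
    then show ?thesis using K by simp
  qed
  then show "\<exists>c>0. \<exists>C>0. \<forall>\<tau>. 0 < \<tau> \<longrightarrow> \<tau> \<le> c \<longrightarrow>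
        (\<exists>s d. 0 \<le> d \<and> d \<le> C * 1 \<and> K * (\<tau> + tail (s + d)) \<le> tail s)"
    using K t by (intro exI[of _ "1 / (4 * K)"] conjI exI[of _ "t + 1"] allI impI exI[of _ 0] exI[of _ t])
      (auto simp: tail_zero)
next
  fix \<delta> :: real assume \<delta>: "0 < \<delta>" "\<delta> < 1"
  obtain r where r: "0 < r" "\<And>x. p (x - r) \<le> (1 + \<delta>) * p x" using ratio[OF \<delta>] by blast
  have "\<exists>T. tail (T - r) \<le> \<delta> * \<tau>" if \<tau>: "0 < \<tau>" for \<tau>
  proof -
    obtain t where "tail t < \<delta> * \<tau>" using tail_less_ex[OF mult_pos_pos[OF \<delta>(1) \<tau>]] by blast
    then show ?thesis by (intro exI[of _ "t + r"]) simp
  qed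
  then show "\<exists>c>0. \<forall>\<tau>. 0 < \<tau> \<longrightarrow> \<tau> \<le> 1 / 2 \<longrightarrow>
        (\<exists>r T. c * 1 \<le> r \<and> (\<forall>x\<le>T. p (x - r) \<le> (1 + \<delta>) * p x) \<and> tail (T - r) \<le> \<delta> * \<tau>)"
    using r by (intro exI[of _ r]) fastforce
qed (use B in auto)

end

section \<open>Logarithmic rates\<close>

text \<open>The larger of \<open>e\<close> and \<open>1 / n\<close> lies between
  \<open>\<tau> / 2\<close> and \<open>\<tau> = e + 1 / n\<close>, so its logarithm exceeds
  \<open>L = ln (1 / \<tau>)\<close> by at most \<open>ln 2\<close>, and \<open>ln 2 \<le> L\<close>
  because \<open>\<tau> \<le> 1 / 4\<close>. For the upper bound both summands are at most
  \<open>1 / L\<close>.\<close>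

lemma inverse_log_rate_bounds:
  assumes n: "1 \<le> n" and e: "0 \<le> e" and \<tau>: "e + 1 / real n \<le> 1 / 4"
  shows "1 / (2 * ln (1 / (e + 1 / real n))) \<le> 1 / ln (real n) + inv_log_inv e"
    "1 / ln (real n) + inv_log_inv e \<le> 2 / ln (1 / (e + 1 / real n))"
proof -
  define t where "t = e + 1 / real n"
  define L where "L = ln (1 / t)"
  have n0: "0 < 1 / real n" using n by simp
  have t: "0 < t" "t \<le> 1 / 4" "1 / real n \<le> t" "e \<le> t" using e n0 \<tau> unfolding t_def by linarith+
  have "ln 2 \<le> L" unfolding L_def using t by (subst ln_le_cancel_iff) (auto simp: field_simps)
  moreover have ln2: "0 < ln (2::real)" by simp
  ultimately have L: "0 < L" "ln 2 \<le> L" by linarith+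
  have ge: "L \<le> ln (1 / x)" if "0 < x" "x \<le> t" for x
    unfolding L_def using that t by (subst ln_le_cancel_iff) (auto simp: frac_le)
  have le: "ln (1 / x) \<le> 2 * L" if "0 < x" "t \<le> 2 * x" for x
  proof -
    have "ln (1 / x) \<le> ln (2 * (1 / t))"
      using that t by (subst ln_le_cancel_iff) (auto simp: field_simps)
    also have "\<dots> = ln 2 + L" unfolding L_def using t by (subst ln_mult) auto
    finally show ?thesis using L by linarith
  qed
  have n1: "L \<le> ln (real n)" using ge[OF n0 t(3)] by simp
  then have A: "0 < 1 / ln (real n)" "1 / ln (real n) \<le> 1 / L" using L by (auto simp: frac_le)
  have E: "0 \<le> inv_log_inv e \<and> inv_log_inv e \<le> 1 / L"
  proof (cases "e = 0")
    case False
    then show ?thesis using ge[of e] e t L by (auto simp: inv_log_inv_def frac_le)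
  qed (use L in \<open>simp add: inv_log_inv_def\<close>)
  show "1 / ln (real n) + inv_log_inv e \<le> 2 / ln (1 / (e + 1 / real n))"
    using A E unfolding t_def[symmetric] L_def[symmetric] by simp
  have "1 / (2 * L) \<le> 1 / ln (real n) + inv_log_inv e"
  proof (cases "e \<le> 1 / real n")
    case True
    then have "ln (real n) \<le> 2 * L" using le[OF n0] by (simp add: t_def)
    then have "1 / (2 * L) \<le> 1 / ln (real n)" using n1 L by (intro frac_le) auto
    then show ?thesis using E by linarith
  next
    case False
    then have e0: "0 < e" using n0 by linarith
    then have "ln (1 / e) \<le> 2 * L" using le[OF e0] False by (simp add: t_def)
    moreover have "0 < ln (1 / e)" using ge[OF e0 t(4)] L by linarith
    ultimately have "1 / (2 * L) \<le> 1 / ln (1 / e)" by (intro frac_le) auto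
    also have "\<dots> = inv_log_inv e" using e0 by (simp add: inv_log_inv_def)
    finally show ?thesis using A(1) by linarith
  qed
  then show "1 / (2 * ln (1 / (e + 1 / real n))) \<le> 1 / ln (real n) + inv_log_inv e"
    unfolding L_def t_def .
qed

context even_density
begin

text \<open>The parameter \<open>w\<close> is a logarithmic scale: \<open>s w\<close> and
  \<open>T w\<close> sit where the tail is exponentially small in \<open>w\<close>, and
  \<open>w powr - \<gamma>\<close> is the distance over which the density changes by a constant
  factor there. The exponents \<open>\<kappa>\<close> and \<open>\<kappa>'\<close> need not agree,
  since rescaling \<open>w\<close> changes \<open>w powr - \<gamma>\<close> only by a
  constant.\<close>

lemma has_adaptive_rate_log:
  assumes \<alpha>: "0 < \<alpha>" "\<alpha> < 1 / 4" and \<gamma>: "0 < \<gamma>" and w0: "0 < w0"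
    and U: "0 < c" "0 < \<kappa>" "\<And>w. w0 \<le> w \<Longrightarrow> c * exp (- (\<kappa> * w)) \<le> tail (s w)"
    and decay: "\<And>D. 0 < D \<Longrightarrow> \<exists>C>0. \<forall>w\<ge>w0. \<forall>x\<ge>s w. p (x + C * w powr - \<gamma>) \<le> exp (- D) * p x"
    and L: "0 < C'" "0 < \<kappa>'" "\<And>\<delta>. 0 < \<delta> \<Longrightarrow> \<delta> < 1 \<Longrightarrow> \<exists>a>0. \<forall>w\<ge>w0.
      (\<forall>x\<le>T w. p (x - a * w powr - \<gamma>) \<le> (1 + \<delta>) * p x) \<and> tail (T w - a * w powr - \<gamma>) \<le> C' * exp (- (\<kappa>' * w))"
  shows "has_adaptive_rate \<alpha> P (\<lambda>n \<epsilon>. (1 / ln (real n) + inv_log_inv \<epsilon>) powr \<gamma>)"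
proof -
  have Lpos: "1 \<le> ln (1 / \<tau>)" "\<tau> = exp (- ln (1 / \<tau>))" if "0 < \<tau>" "\<tau> \<le> 1 / 4" for \<tau> :: real
  proof -
    have "exp 1 \<le> (4::real)" using exp_le by linarith
    also have "4 \<le> 1 / \<tau>" using that by (simp add: field_simps)
    finally show "1 \<le> ln (1 / \<tau>)" using that by (subst ln_ge_iff) auto
    show "\<tau> = exp (- ln (1 / \<tau>))" using that by (simp add: ln_div)
  qed
  show ?thesis
  proof (rule has_adaptive_rateI[where R="\<lambda>\<tau>. ln (1 / \<tau>) powr - \<gamma>" and b="2 powr \<gamma>" and ?c0.0="1/4", OF \<alpha>])
    show "0 < ln (1 / \<tau>) powr - \<gamma>" if "0 < \<tau>" "\<tau> \<le> 1 / 4" for \<tau> :: real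
      using Lpos[OF that] by simp
  next
    fix K :: real assume K: "0 < K"
    \<comment> \<open>\<open>exp (- D) = 1 / (2 * K + 1)\<close>, so \<open>K * tail (s + d)\<close>
      takes at most half of \<open>tail s\<close> and leaves the other half for
      \<open>K * \<tau>\<close>.\<close>
    define D where "D = ln (2 * K + 1)"
    have D0: "0 < D" using K by (simp add: D_def)
    obtain C where C: "0 < C" and dec: "\<forall>w\<ge>w0. \<forall>x\<ge>s w. p (x + C * w powr - \<gamma>) \<le> exp (- D) * p x"
      using decay[OF D0] by blast
    \<comment> \<open>The first entry makes \<open>w \<ge> w0\<close>; the second lets
      \<open>exp (l / 2)\<close> absorb \<open>2 * K / c\<close>.\<close>
    define X where "X = max (2 * \<kappa> * w0) (2 * ln (2 * K / c))"
    define C2 where "C2 = C * (1 / (2 * \<kappa>)) powr - \<gamma>"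
    have C2: "0 < C2" using C U by (simp add: C2_def)
    have "\<exists>s d. 0 \<le> d \<and> d \<le> C2 * ln (1 / \<tau>) powr - \<gamma> \<and> K * (\<tau> + tail (s + d)) \<le> tail s"
      if \<tau>: "0 < \<tau>" "\<tau> \<le> min (1 / 4) (exp (- X))" for \<tau>
    proof -
      define l where "l = ln (1 / \<tau>)"
      have l: "1 \<le> l" "\<tau> = exp (- l)" using Lpos[of \<tau>] \<tau> by (auto simp: l_def)
      have X: "X \<le> l" using \<tau>(2) l(2) by simp
      \<comment> \<open>Half of \<open>l\<close> is spent on
        \<open>tail (s w) \<ge> c * exp (- l / 2)\<close>; the other half lets this beat
        \<open>\<tau> = exp (- l)\<close> by the required factor.\<close>
      define w where "w = l / (2 * \<kappa>)"
      have w: "w0 \<le> w" using X U by (simp add: w_def X_def field_simps)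
      define d where "d = C * w powr - \<gamma>"
      have deq: "d = C2 * l powr - \<gamma>"
        using U l unfolding d_def C2_def w_def by (simp add: powr_mult powr_divide powr_minus field_simps)
      have d0: "0 \<le> d" using C by (simp add: d_def)
      have ts: "2 * K * \<tau> \<le> tail (s w)"
      proof -
        have "2 * K / c = exp (ln (2 * K / c))" using K U(1) by simp
        also have "\<dots> \<le> exp (l / 2)" using X by (simp add: X_def)
        finally have "2 * K / c \<le> exp (l / 2)" .
        then have "2 * K \<le> c * exp (l / 2)" using U by (simp add: field_simps)
        then have "2 * K * exp (- l) \<le> c * exp (l / 2) * exp (- l)" by (intro mult_right_mono) auto
        also have "\<dots> = c * exp (- (\<kappa> * w))" using U by (simp add: w_def mult.assoc flip: exp_add)
        also have "\<dots> \<le> tail (s w)" by (rule U(3)[OF w])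
        finally show ?thesis using l by simp
      qed
      have "tail (s w + d) \<le> exp (- D) * tail (s w)"
        unfolding d_def by (rule tail_add_le) (use dec w in auto)
      moreover have "exp (- D) = 1 / (2 * K + 1)" using K by (simp add: D_def exp_minus field_simps)
      ultimately have "2 * K * tail (s w + d) \<le> 2 * K * (1 / (2 * K + 1) * tail (s w))"
        using K by (intro mult_left_mono) auto
      also have "\<dots> = (2 * K / (2 * K + 1)) * tail (s w)" by simp
      also have "\<dots> \<le> tail (s w)" using K tail_nonneg by (intro mult_left_le_one_le) auto
      finally have "K * (\<tau> + tail (s w + d)) \<le> tail (s w)" using ts by (simp add: algebra_simps)
      then show ?thesis
        using d0 order_refl[of d] unfolding l_def[symmetric] deq[symmetric] by blast
    qed
    then have "\<forall>\<tau>. 0 < \<tau> \<longrightarrow> \<tau> \<le> min (1 / 4) (exp (- X)) \<longrightarrow>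
        (\<exists>s d. 0 \<le> d \<and> d \<le> C2 * ln (1 / \<tau>) powr - \<gamma> \<and> K * (\<tau> + tail (s + d)) \<le> tail s)"
      by blast
    moreover have "0 < min (1 / 4) (exp (- X))" by simp
    ultimately show "\<exists>c>0. \<exists>C>0. \<forall>\<tau>. 0 < \<tau> \<longrightarrow> \<tau> \<le> c \<longrightarrow>
        (\<exists>s d. 0 \<le> d \<and> d \<le> C * ln (1 / \<tau>) powr - \<gamma> \<and> K * (\<tau> + tail (s + d)) \<le> tail s)"
      using C2 by blast
  next
    fix \<delta> :: real assume \<delta>: "0 < \<delta>" "\<delta> < 1"
    obtain a where a: "0 < a" and ratio: "\<forall>w\<ge>w0. \<forall>x\<le>T w. p (x - a * w powr - \<gamma>) \<le> (1 + \<delta>) * p x"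
      and tl: "\<forall>w\<ge>w0. tail (T w - a * w powr - \<gamma>) \<le> C' * exp (- (\<kappa>' * w))"
      using L(3)[OF \<delta>] by blast
    define X where "X = max 0 (ln (C' / \<delta>))"
    \<comment> \<open>The claim is needed for all \<open>\<tau> \<le> 1 / 4\<close>, so the loss
      \<open>C' / \<delta>\<close> cannot be absorbed by shrinking \<open>\<tau>\<close>; the larger
      scale \<open>w = A * l\<close> absorbs it, at the price of a constant in the rate.\<close>
    define A where "A = max w0 ((1 + X) / \<kappa>')"
    have A: "0 < A" "w0 \<le> A" "1 + X \<le> \<kappa>' * A" "0 \<le> X" using w0 L(2) by (auto simp: A_def X_def field_simps max_def)
    have "\<exists>r T. a * A powr - \<gamma> * ln (1 / \<tau>) powr - \<gamma> \<le> r \<and> (\<forall>x\<le>T. p (x - r) \<le> (1 + \<delta>) * p x) \<and> tail (T - r) \<le> \<delta> * \<tau>"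
      if \<tau>: "0 < \<tau>" "\<tau> \<le> 1 / 4" for \<tau>
    proof -
      define l where "l = ln (1 / \<tau>)"
      have l: "1 \<le> l" "\<tau> = exp (- l)" using Lpos[OF \<tau>] by (auto simp: l_def)
      define w where "w = A * l"
      have "A * 1 \<le> w" unfolding w_def using A l by (intro mult_left_mono) auto
      then have w: "w0 \<le> w" using A by linarith
      have "l + X \<le> (1 + X) * l" using mult_left_mono[OF l(1), of X] A by (simp add: algebra_simps)
      also have "\<dots> \<le> \<kappa>' * w" using mult_right_mono[OF A(3), of l] l by (simp add: w_def)
      finally have "exp (- (\<kappa>' * w)) \<le> exp (- X) * exp (- l)" by (simp flip: exp_add)
      then have "C' * exp (- (\<kappa>' * w)) \<le> C' * (exp (- X) * exp (- l))"
        using L(1) by (intro mult_left_mono) auto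
      also have "\<dots> \<le> \<delta> * exp (- l)"
      proof -
        have "C' / \<delta> = exp (ln (C' / \<delta>))" using L(1) \<delta> by simp
        also have "\<dots> \<le> exp X" by (simp add: X_def)
        finally have "C' * exp (- X) \<le> \<delta>" using \<delta> by (simp add: exp_minus field_simps)
        then have "C' * exp (- X) * exp (- l) \<le> \<delta> * exp (- l)" by (intro mult_right_mono) auto
        then show ?thesis by (simp only: mult.assoc)
      qed
      finally have "tail (T w - a * w powr - \<gamma>) \<le> \<delta> * \<tau>" using tl w l(2) by force
      moreover have "a * A powr - \<gamma> * l powr - \<gamma> = a * w powr - \<gamma>"
        using A l by (simp add: w_def powr_mult)
      ultimately show ?thesis
        using ratio w order_refl[of "a * w powr - \<gamma>"] unfolding l_def[symmetric] by metis
    qed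
    moreover have "0 < a * A powr - \<gamma>" using a A by simp
    ultimately show "\<exists>c>0. \<forall>\<tau>. 0 < \<tau> \<longrightarrow> \<tau> \<le> 1 / 4 \<longrightarrow>
        (\<exists>r T. c * ln (1 / \<tau>) powr - \<gamma> \<le> r \<and> (\<forall>x\<le>T. p (x - r) \<le> (1 + \<delta>) * p x) \<and> tail (T - r) \<le> \<delta> * \<tau>)"
      by blast
  next
    fix n :: nat and e :: real assume ne: "1 \<le> n" "0 \<le> e" "e + 1 / real n \<le> 1 / 4"
    define l where "l = ln (1 / (e + 1 / real n))"
    define y where "y = 1 / ln (real n) + inv_log_inv e"
    have "0 < 1 / real n" using ne by simp
    then have "0 < e + 1 / real n" using ne by linarith
    then have l: "1 \<le> l" using Lpos(1) ne by (simp add: l_def)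
    have y: "1 / (2 * l) \<le> y" "y \<le> 2 / l"
      using inverse_log_rate_bounds[OF ne] by (simp_all add: l_def y_def)
    have y0: "0 < y" using y(1) l by (smt (verit) divide_pos_pos)
    have "y powr \<gamma> \<le> (2 / l) powr \<gamma>" using y y0 \<gamma> by (intro powr_mono2) auto
    also have "\<dots> = 2 powr \<gamma> * l powr - \<gamma>" using l by (simp add: powr_divide powr_minus field_simps)
    finally have 1: "y powr \<gamma> \<le> 2 powr \<gamma> * l powr - \<gamma>" .
    have "1 / l \<le> 2 * y" using y(1) l by (simp add: field_simps)
    then have "(1 / l) powr \<gamma> \<le> (2 * y) powr \<gamma>" using l \<gamma> by (intro powr_mono2) auto
    then have 2: "l powr - \<gamma> \<le> 2 powr \<gamma> * y powr \<gamma>"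
      using l y0 by (simp add: powr_mult powr_divide powr_minus field_simps)
    show "(1 / ln (real n) + inv_log_inv e) powr \<gamma> \<le> 2 powr \<gamma> * ln (1 / (e + 1 / real n)) powr - \<gamma> \<and>
        ln (1 / (e + 1 / real n)) powr - \<gamma> \<le> 2 powr \<gamma> * (1 / ln (real n) + inv_log_inv e) powr \<gamma>"
      using 1 2 unfolding l_def y_def by blast
  qed simp_all
qed

end

section \<open>Normalised densities and the t distribution\<close>

text \<open>Convexity of a power. It serves with \<open>q = \<beta> > 1\<close> for generalized
  Gaussians and \<open>q = - \<beta>\<close> for mollifiers, and depending on the order of
  \<open>u\<close> and \<open>v\<close> it bounds increments from below or from above.\<close>

lemma powr_above_tangent:
  fixes q u v :: real
  assumes "0 \<le> q * (q - 1)" "0 < u" "0 < v"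
  shows "q * u powr (q - 1) * (v - u) \<le> v powr q - u powr q"
proof (rule convex_on_imp_above_tangent[of "{0<..}" "\<lambda>x. x powr q" u v])
  show "convex_on {0<..} (\<lambda>x::real. x powr q)"
  proof (rule f''_ge0_imp_convex)
    show "((\<lambda>x. x powr q) has_real_derivative q * x powr (q - 1)) (at x)" if "x \<in> {0<..}" for x
      using that by (auto intro!: derivative_eq_intros)
    show "((\<lambda>x. q * x powr (q - 1)) has_real_derivative q * ((q - 1) * x powr (q - 1 - 1))) (at x)"
      if "x \<in> {0<..}" for x
      using that by (auto intro!: derivative_eq_intros)
    show "0 \<le> q * ((q - 1) * x powr (q - 1 - 1))" for x
      using assms(1) by (simp add: mult.assoc[symmetric])
  qed simp
  show "((\<lambda>x. x powr q) has_real_derivative q * u powr (q - 1)) (at u within {0<..})"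
    using assms by (auto intro!: derivative_eq_intros)
qed (use assms in \<open>auto simp: interior_open\<close>)

text \<open>Both \<open>a / (a + b)\<close> and \<open>b / (a + b)\<close> lie in [0, 1], where
  \<open>t \<le> t powr \<beta>\<close>, and they sum to 1.\<close>

lemma powr_add_le_add_powr:
  fixes a b \<beta> :: real
  assumes "0 \<le> a" "0 \<le> b" "0 < \<beta>" "\<beta> \<le> 1"
  shows "(a + b) powr \<beta> \<le> a powr \<beta> + b powr \<beta>"
proof (cases "a + b = 0")
  case False
  then have ab: "0 < a + b" using assms by simp
  have le: "t \<le> t powr \<beta>" if "0 \<le> t" "t \<le> 1" for t :: real
    using powr_mono'[of \<beta> 1 t] that assms by simp
  have "1 = a / (a + b) + b / (a + b)" using ab by (simp flip: add_divide_distrib)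
  also have "\<dots> \<le> (a / (a + b)) powr \<beta> + (b / (a + b)) powr \<beta>"
    using assms ab by (intro add_mono le) auto
  also have "\<dots> = (a powr \<beta> + b powr \<beta>) / (a + b) powr \<beta>"
    using assms by (simp add: powr_divide add_divide_distrib)
  finally show ?thesis using ab by (simp add: pos_le_divide_eq)
qed (use assms in simp)

lemma powr_le_exp:
  fixes a w :: real
  assumes "0 < a" "0 < w"
  shows "w powr a \<le> a powr a * exp w"
proof -
  have "a * ln (w / a) \<le> a * (w / a)"
    using assms ln_le_minus_one[of "w / a"] by (intro mult_left_mono) auto
  then have "(w / a) powr a \<le> exp w" using assms by (simp add: powr_def)
  then have "a powr a * (w / a) powr a \<le> a powr a * exp w" by (intro mult_left_mono) auto
  then show ?thesis using assms by (simp add: powr_divide)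
qed

section \<open>Integrability and normalisation of explicit densities\<close>

lemma integrable_even_powr_decay:
  fixes g :: "real \<Rightarrow> real"
  assumes [measurable]: "g \<in> borel_measurable borel" and nonneg: "\<And>x. 0 \<le> g x"
    and even: "\<And>x. g (- x) = g x" and bound: "\<And>x. g x \<le> B"
    and a: "1 < a" and decay: "\<And>x. 1 \<le> x \<Longrightarrow> g x \<le> C * x powr - a"
  shows "integrable lborel g"
proof -
  define h where "h x = indicator {1..} x * x powr - a" for x :: real
  have [measurable]: "h \<in> borel_measurable borel" unfolding h_def[abs_def] by measurable
  have h0: "0 \<le> h x" for x by (simp add: h_def)
  have "(\<integral>\<^sup>+x. ennreal (h x) \<partial>lborel) = ennreal (- (1 powr (- a + 1)) / (- a + 1))"
    unfolding h_def by (rule nn_integral_has_integral_lebesgue) (use has_integral_powr_to_inf[of "- a" 1] a in auto)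
  then have ih: "integrable lborel h"
    using h0 by (intro integrableI_nonneg) auto
  then have ih': "integrable lborel (\<lambda>x. h (- x))"
    using lborel_integrable_real_affine[of h "-1" 0] by simp
  have ii: "integrable lborel (\<lambda>x. indicator {-1..1::real} x * B)"
    by (intro integrable_mult_left integrable_real_indicator) auto
  show ?thesis
  proof (rule Bochner_Integration.integrable_bound)
    show "integrable lborel (\<lambda>x. indicator {-1..1} x * B + C * h x + C * h (- x))"
      by (intro Bochner_Integration.integrable_add integrable_mult_right ih ih' ii)
    have "g x \<le> indicator {-1..1} x * B + C * h x + C * h (- x)" for x
    proof -
      consider "x < -1" | "x = -1" | "-1 < x" "x < 1" | "x = 1" | "1 < x" by linarith
      then show ?thesis
      proof cases
        case 1
        then show ?thesis using decay[of "- x"] even[of x] by (simp add: h_def)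
      next
        case 5
        then show ?thesis using decay[of x] by (simp add: h_def)
      next
        case 2
        have "0 \<le> C" using decay[of 1] nonneg[of 1] by simp
        then show ?thesis using 2 bound[of x] by (simp add: h_def)
      next
        case 4
        have "0 \<le> C" using decay[of 1] nonneg[of 1] by simp
        then show ?thesis using 4 bound[of x] by (simp add: h_def)
      qed (use bound[of x] in \<open>simp add: h_def\<close>)
    qed
    then show "AE x in lborel. norm (g x) \<le> norm (indicator {-1..1} x * B + C * h x + C * h (- x))"
      using nonneg by (intro AE_I2) (smt (verit) real_norm_def)
  qed auto
qed

lemma integral_pos_of_ge:
  fixes g :: "real \<Rightarrow> real"
  assumes "integrable lborel g" "\<And>x. 0 \<le> g x" "a < b" "0 < m" "\<And>x. a < x \<Longrightarrow> x < b \<Longrightarrow> m \<le> g x"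
  shows "0 < (\<integral>x. g x \<partial>lborel)"
proof -
  have "0 < (b - a) * m" using assms by simp
  also have "(b - a) * m = (\<integral>x. indicator {a<..<b} x * m \<partial>lborel)" using assms by simp
  also have "\<dots> \<le> (\<integral>x. g x \<partial>lborel)"
  proof (rule integral_mono)
    show "integrable lborel (\<lambda>x. indicator {a<..<b} x * m)"
      using assms(3) by (intro integrable_mult_left integrable_real_indicator) auto
    show "indicator {a<..<b} x * m \<le> g x" for x
      using assms(2)[of x] assms(5)[of x] by (cases "x \<in> {a<..<b}") auto
  qed fact
  finally show ?thesis .
qed

lemma even_density_normalized:
  fixes g :: "real \<Rightarrow> real"
  assumes [measurable]: "g \<in> borel_measurable borel" and "\<And>x. 0 \<le> g x" "\<And>x. g (- x) = g x"
    and int: "integrable lborel g" and pos: "0 < (\<integral>x. g x \<partial>lborel)"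
  shows "even_density (\<lambda>x. g x / (\<integral>x. g x \<partial>lborel))"
proof (rule even_density.intro)
  let ?Z = "\<integral>x. g x \<partial>lborel"
  have "(\<integral>\<^sup>+x. ennreal (g x / ?Z) \<partial>lborel) = ennreal (\<integral>x. g x / ?Z \<partial>lborel)"
    using assms by (intro nn_integral_eq_integral integrable_divide AE_I2) auto
  also have "\<dots> = 1" using pos by simp
  finally show "prob_space (density lborel (\<lambda>x. ennreal (g x / ?Z)))"
    by (intro prob_spaceI) (simp add: emeasure_density)
  show "(\<lambda>x. g x / ?Z) \<in> borel_measurable borel" by measurable
  show "0 \<le> g x / ?Z" for x using assms(2)[of x] pos by simp
  show "g (- x) / ?Z = g x / ?Z" for x using assms(3)[of x] by simp
qed

text \<open>A small shift multiplies \<open>1 + x\<^sup>2 / \<nu>\<close> by at most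
  \<open>1 + \<eta>\<close> uniformly in \<open>x\<close>, so heavy tails never reveal the shift and
  the rate is constant.\<close>

theorem has_adaptive_rate_t_dist:
  assumes \<alpha>: "0 < \<alpha>" "\<alpha> < 1 / 4" and \<nu>: "0 < \<nu>"
  shows "has_adaptive_rate \<alpha> (t_dist \<nu>) (\<lambda>n \<epsilon>. 1)"
proof -
  define h where "h = (\<nu> + 1) / 2"
  define g where "g t = (1 + t\<^sup>2 / \<nu>) powr - h" for t :: real
  define Z where "Z = (\<integral>t. g t \<partial>lborel)"
  have h: "0 < h" "1 < 2 * h" using \<nu> by (auto simp: h_def)
  have base: "1 \<le> 1 + t\<^sup>2 / \<nu>" for t using \<nu> by simp
  have [measurable]: "g \<in> borel_measurable borel" unfolding g_def[abs_def] by measurable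
  have g0: "0 \<le> g t" for t by (simp add: g_def)
  have g1: "g t \<le> 1" for t
    using powr_mono2'[of "- h" 1 "1 + t\<^sup>2 / \<nu>"] base[of t] h by (simp add: g_def)
  have int: "integrable lborel g"
  proof (rule integrable_even_powr_decay[where B=1 and a="2 * h" and C="\<nu> powr h"])
    fix x :: real assume x: "1 \<le> x"
    have "g x \<le> (x\<^sup>2 / \<nu>) powr - h"
      unfolding g_def using \<nu> x h by (intro powr_mono2') auto
    also have "\<dots> = \<nu> powr h * (x\<^sup>2) powr - h"
      using \<nu> x by (simp add: powr_divide powr_minus field_simps)
    also have "x\<^sup>2 = x powr 2" using x by (simp add: powr_numeral)
    also have "(x powr 2) powr - h = x powr - (2 * h)" by (simp add: powr_powr)
    finally show "g x \<le> \<nu> powr h * x powr - (2 * h)" .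
  qed (use g0 g1 h in \<open>auto simp: g_def\<close>)
  have pos: "0 < Z" unfolding Z_def
  proof (rule integral_pos_of_ge[OF int g0, of 0 1 "(1 + 1 / \<nu>) powr - h"])
    fix x :: real assume "0 < x" "x < 1"
    then have "x\<^sup>2 \<le> 1" by (simp add: power_le_one)
    then show "(1 + 1 / \<nu>) powr - h \<le> g x" unfolding g_def
      using \<nu> h less_le_trans[OF zero_less_one base[of x]] by (intro powr_mono2') (auto simp: divide_right_mono)
  next
    have "0 < 1 + 1 / \<nu>" using \<nu> by (simp add: add_pos_pos)
    then show "0 < (1 + 1 / \<nu>) powr - h" by simp
  qed simp
  interpret even_density "\<lambda>x. g x / Z"
    unfolding Z_def by (rule even_density_normalized[OF _ g0 _ int pos[unfolded Z_def]]) (auto simp: g_def)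
  have "has_adaptive_rate \<alpha> P (\<lambda>n \<epsilon>. 1)"
  proof (rule has_adaptive_rate_const[OF \<alpha>])
    fix \<delta> :: real assume \<delta>: "0 < \<delta>" "\<delta> < 1"
    \<comment> \<open>Chosen so that \<open>(1 + \<eta>) powr h = 1 + \<delta>\<close>.\<close>
    define \<eta> where "\<eta> = (1 + \<delta>) powr (1 / h) - 1"
    have "1 < (1 + \<delta>) powr (1 / h)" using \<delta> h by (intro gr_one_powr) auto
    then have \<eta>: "0 < \<eta>" by (simp add: \<eta>_def)
    have \<eta>h: "(1 + \<eta>) powr h = 1 + \<delta>" using h \<delta> by (simp add: \<eta>_def powr_powr)
    \<comment> \<open>Chosen so that the additive term
      \<open>(1 + 1 / \<eta>) * r\<^sup>2 / \<nu>\<close> equals \<open>\<eta>\<close> and merges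
      into the factor \<open>1 + \<eta>\<close>.\<close>
    define r where "r = sqrt (\<nu> * \<eta> / (1 + 1 / \<eta>))"
    have "0 < 1 + 1 / \<eta>" using \<eta> by (simp add: add_pos_pos)
    then have r: "0 < r" "(1 + 1 / \<eta>) * r\<^sup>2 = \<nu> * \<eta>" using \<nu> \<eta> by (simp_all add: r_def)
    have "g (x - r) \<le> (1 + \<delta>) * g x" for x
    proof -
      \<comment> \<open>Completing the square gives Young's inequality for
        \<open>2 * (x - r) * r\<close>.\<close>
      have sq: "(sqrt \<eta> * u - r / sqrt \<eta>)\<^sup>2 = \<eta> * u\<^sup>2 - 2 * (u * r) + r\<^sup>2 / \<eta>" for u
        using \<eta> by (simp add: power2_diff power_mult_distrib power_divide)
      have "0 \<le> \<eta> * (x - r)\<^sup>2 - 2 * ((x - r) * r) + r\<^sup>2 / \<eta>" unfolding sq[symmetric] by simp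
      then have "x\<^sup>2 \<le> (1 + \<eta>) * (x - r)\<^sup>2 + (1 + 1 / \<eta>) * r\<^sup>2"
        by (simp add: power2_eq_square algebra_simps)
      then have "x\<^sup>2 / \<nu> \<le> (1 + \<eta>) * ((x - r)\<^sup>2 / \<nu>) + \<eta>"
        using \<nu> r by (simp add: field_simps)
      then have le: "1 + x\<^sup>2 / \<nu> \<le> (1 + \<eta>) * (1 + (x - r)\<^sup>2 / \<nu>)" by (simp add: algebra_simps)
      have "(1 + x\<^sup>2 / \<nu>) powr h \<le> ((1 + \<eta>) * (1 + (x - r)\<^sup>2 / \<nu>)) powr h"
        using base[of x] h by (intro powr_mono2 le) auto
      also have "\<dots> = (1 + \<delta>) * (1 + (x - r)\<^sup>2 / \<nu>) powr h"
        using \<eta> by (simp add: powr_mult \<eta>h)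
      finally have 1: "(1 + x\<^sup>2 / \<nu>) powr h \<le> (1 + \<delta>) * (1 + (x - r)\<^sup>2 / \<nu>) powr h" .
      have "0 < (1 + x\<^sup>2 / \<nu>) powr h" "0 < (1 + (x - r)\<^sup>2 / \<nu>) powr h"
        using base[of x] base[of "x - r"] by (simp_all add: powr_gt_zero)
      then show ?thesis using 1 unfolding g_def powr_minus by (simp add: field_simps)
    qed
    then have "\<forall>x. g (x - r) / Z \<le> (1 + \<delta>) * (g x / Z)" using pos by (simp add: field_simps)
    then show "\<exists>r>0. \<forall>x. g (x - r) / Z \<le> (1 + \<delta>) * (g x / Z)" using r(1) by blast
  qed simp
  then show ?thesis
    by (simp add: t_dist_def normalized_density_def g_def[abs_def] Z_def h_def)
qed

section \<open>Generalized Gaussian distributions\<close>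

text \<open>\<open>powr_le_exp\<close> with exponent \<open>2 / \<beta>\<close> turns
  \<open>exp (- a * x powr \<beta>)\<close> into a multiple of \<open>x powr - 2\<close>.\<close>

lemma integrable_exp_minus_powr:
  fixes a \<beta> :: real
  assumes "0 < a" "0 < \<beta>"
  shows "integrable lborel (\<lambda>x. exp (- (a * \<bar>x\<bar> powr \<beta>)))"
proof (rule integrable_even_powr_decay[where B=1 and a=2 and C="(2 / \<beta>) powr (2 / \<beta>) * a powr - (2 / \<beta>)"])
  fix x :: real assume x: "1 \<le> x"
  define c w where "c = 2 / \<beta>" and "w = a * x powr \<beta>"
  have c: "0 < c" and w: "0 < w" using assms x by (auto simp: c_def w_def)
  have "w powr c * exp (- w) \<le> c powr c * exp w * exp (- w)"
    using powr_le_exp[OF c w] by (intro mult_right_mono) auto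
  also have "\<dots> = c powr c" by (simp add: mult.assoc flip: exp_add)
  finally have "w powr - c * (w powr c * exp (- w)) \<le> w powr - c * c powr c"
    by (intro mult_left_mono) auto
  also have "w powr - c * (w powr c * exp (- w)) = exp (- w)"
    using w by (simp add: mult.assoc[symmetric] flip: powr_add)
  also have "w powr - c = a powr - c * x powr - 2"
    using assms x by (simp add: w_def c_def powr_mult powr_powr)
  finally show "exp (- (a * \<bar>x\<bar> powr \<beta>)) \<le> (2 / \<beta>) powr (2 / \<beta>) * a powr - (2 / \<beta>) * x powr - 2"
    using x by (simp add: c_def w_def mult_ac)
qed (use assms in auto)

text \<open>For \<open>\<beta> \<le> 1\<close> the exponent is subadditive, so a shift changes the
  log density by a bounded amount everywhere and the rate is constant. For
  \<open>\<beta> > 1\<close> the exponent equals \<open>w\<close> at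
  \<open>s w = w powr (1 / \<beta>)\<close> and has slope \<open>\<beta> * w powr \<gamma>\<close>
  there, which makes \<open>w powr - \<gamma>\<close> the local scale.\<close>

theorem has_adaptive_rate_generalized_gaussian:
  assumes \<alpha>: "0 < \<alpha>" "\<alpha> < 1 / 4" and \<beta>: "0 < \<beta>"
  shows "has_adaptive_rate \<alpha> (generalized_gaussian \<beta>)
    (\<lambda>n \<epsilon>. (1 / ln (real n) + inv_log_inv \<epsilon>) powr (max (\<beta> - 1) 0 / \<beta>))"
proof -
  define g where "g t = exp (- (\<bar>t\<bar> powr \<beta>))" for t :: real
  define Z where "Z = (\<integral>t. g t \<partial>lborel)"
  have [measurable]: "g \<in> borel_measurable borel" unfolding g_def[abs_def] by measurable
  have g0: "0 \<le> g t" for t by (simp add: g_def)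
  have int: "integrable lborel g"
    using integrable_exp_minus_powr[of 1 \<beta>] \<beta> unfolding g_def[abs_def] by simp
  have pos: "0 < Z" unfolding Z_def
  proof (rule integral_pos_of_ge[OF int g0, of 0 1 "exp (- 1)"])
    fix x :: real assume "0 < x" "x < 1"
    then have "\<bar>x\<bar> powr \<beta> \<le> 1" using \<beta> by (simp add: powr_le1)
    then show "exp (- 1) \<le> g x" by (simp add: g_def)
  qed auto
  interpret even_density "\<lambda>x. g x / Z"
    unfolding Z_def by (rule even_density_normalized[OF _ g0 _ int pos[unfolded Z_def]]) (auto simp: g_def)
  have ratioI: "g y / Z \<le> k * (g x / Z)" if "g y \<le> k * g x" for x y k
    using that pos by (simp add: divide_right_mono)
  have "has_adaptive_rate \<alpha> P (\<lambda>n \<epsilon>. (1 / ln (real n) + inv_log_inv \<epsilon>) powr (max (\<beta> - 1) 0 / \<beta>))"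
  proof (cases "\<beta> \<le> 1")
    case True
    show ?thesis
    proof (rule has_adaptive_rate_const[OF \<alpha>])
      fix \<delta> :: real assume \<delta>: "0 < \<delta>" "\<delta> < 1"
      define r where "r = ln (1 + \<delta>) powr (1 / \<beta>)"
      have l0: "0 < ln (1 + \<delta>)" using \<delta> by simp
      then have r: "0 < r" "r powr \<beta> = ln (1 + \<delta>)" using \<beta> by (auto simp: r_def powr_powr)
      have "g (x - r) \<le> (1 + \<delta>) * g x" for x
      proof -
        have "\<bar>x\<bar> powr \<beta> \<le> (\<bar>x - r\<bar> + r) powr \<beta>" using r \<beta> by (intro powr_mono2) auto
        also have "\<dots> \<le> \<bar>x - r\<bar> powr \<beta> + r powr \<beta>" using r \<beta> True by (intro powr_add_le_add_powr) auto
        finally have "exp (- (\<bar>x - r\<bar> powr \<beta>)) \<le> exp (ln (1 + \<delta>) + - (\<bar>x\<bar> powr \<beta>))" using r by simp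
        also have "\<dots> = (1 + \<delta>) * exp (- (\<bar>x\<bar> powr \<beta>))" unfolding exp_add using \<delta> by simp
        finally show ?thesis by (simp add: g_def)
      qed
      then show "\<exists>r>0. \<forall>x. g (x - r) / Z \<le> (1 + \<delta>) * (g x / Z)" using r(1) ratioI by blast
    next
      fix n :: nat and e :: real assume ne: "1 \<le> n" "0 \<le> e" "e + 1 / real n \<le> 1 / 2"
      have "1 / real n \<le> 1 / 2" using ne by linarith
      then have "2 \<le> n" using ne(1) by (simp add: field_simps)
      then have "0 < 1 / ln (real n)" by simp
      moreover have "0 \<le> inv_log_inv e"
      proof (cases "e = 0")
        case False
        have "0 < 1 / real n" using ne(1) by simp
        then have "e < 1" using ne by linarith
        then show ?thesis using False ne(2) by (simp add: inv_log_inv_def ln_div ln_le_zero_iff)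
      qed (simp add: inv_log_inv_def)
      \<comment> \<open>Positivity is needed because \<open>0 powr 0\<close> is 0 here;
        \<open>e + 1 / n \<le> 1 / 2\<close> excludes \<open>n = 1\<close>, where
        \<open>1 / ln n\<close> would be 0.\<close>
      ultimately have "0 < 1 / ln (real n) + inv_log_inv e" by linarith
      then show "(1 / ln (real n) + inv_log_inv e) powr (max (\<beta> - 1) 0 / \<beta>) = 1" using True by simp
    qed
  next
    case False
    then have \<beta>1: "1 < \<beta>" by simp
    define \<gamma> where "\<gamma> = (\<beta> - 1) / \<beta>"
    define s where "s w = w powr (1 / \<beta>)" for w :: real
    have \<gamma>: "0 < \<gamma>" using \<beta>1 by (simp add: \<gamma>_def)
    have s1: "1 \<le> s w" if "1 \<le> w" for w using that \<beta> by (simp add: s_def ge_one_powr_ge_zero)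
    have s\<beta>: "s w powr \<beta> = w" if "1 \<le> w" for w using that \<beta> by (simp add: s_def powr_powr)
    have s\<gamma>: "s w powr (\<beta> - 1) * w powr - \<gamma> = 1" if "1 \<le> w" for w
      using that \<beta> by (simp add: s_def \<gamma>_def powr_powr flip: powr_add)
    have w\<gamma>: "w powr - \<gamma> \<le> 1" if "1 \<le> w" for w
      using that \<gamma> powr_mono[of "- \<gamma>" 0 w] by simp
    have conv: "0 \<le> \<beta> * (\<beta> - 1)" using \<beta>1 by simp
    \<comment> \<open>Half of the exponent supplies the decay of the tail; the other half remains
      integrable, with integral \<open>I\<close>.\<close>
    define I where "I = (\<integral>x. exp (- (1 / 2 * \<bar>x\<bar> powr \<beta>)) \<partial>lborel)"
    have intI: "integrable lborel (\<lambda>x. exp (- (1 / 2 * \<bar>x\<bar> powr \<beta>)))"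
      using \<beta> by (intro integrable_exp_minus_powr) auto
    have I0: "0 \<le> I" unfolding I_def by (rule Bochner_Integration.integral_nonneg) auto
    have tail_le: "tail t \<le> I / Z * exp (- (1 / 2 * t powr \<beta>))" if "0 \<le> t" for t
    proof -
      have "ennreal (tail t) \<le> (\<integral>\<^sup>+x. ennreal (exp (- (1 / 2 * t powr \<beta>)) / Z * exp (- (1 / 2 * \<bar>x\<bar> powr \<beta>))) \<partial>lborel)"
        unfolding ennreal_tail
      proof (rule nn_integral_mono)
        fix x :: real
        have "g x / Z \<le> exp (- (1 / 2 * t powr \<beta>)) / Z * exp (- (1 / 2 * \<bar>x\<bar> powr \<beta>))" if "t < x"
        proof -
          have "t powr \<beta> \<le> \<bar>x\<bar> powr \<beta>" using that \<open>0 \<le> t\<close> \<beta> by (intro powr_mono2) auto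
          then have "g x \<le> exp (- (1 / 2 * t powr \<beta>)) * exp (- (1 / 2 * \<bar>x\<bar> powr \<beta>))"
            unfolding g_def exp_add[symmetric] by simp
          then show ?thesis using divide_right_mono[of _ _ Z] pos by fastforce
        qed
        then show "ennreal (g x / Z) * indicator {t<..} x \<le> ennreal (exp (- (1 / 2 * t powr \<beta>)) / Z * exp (- (1 / 2 * \<bar>x\<bar> powr \<beta>)))"
          by (cases "t < x") (auto intro: ennreal_leI)
      qed
      also have "\<dots> = ennreal (exp (- (1 / 2 * t powr \<beta>)) / Z * I)"
        unfolding I_def integral_mult_right_zero[symmetric] using intI pos
        by (intro nn_integral_eq_integral integrable_mult_right AE_I2) auto
      finally show ?thesis using I0 pos by (simp add: ennreal_le_iff mult.commute)
    qed
    have "has_adaptive_rate \<alpha> P (\<lambda>n \<epsilon>. (1 / ln (real n) + inv_log_inv \<epsilon>) powr \<gamma>)"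
    \<comment> \<open>Points of \<open>[s w, s w + 1]\<close> are at most \<open>2 * s w\<close>,
      whence \<open>\<kappa>\<close>. The shifted cut-off stays above \<open>s w / 2\<close>, whence
      \<open>(1 / 2) powr \<beta>\<close> in \<open>\<kappa>'\<close>; the other
      \<open>1 / 2\<close> comes from the halved exponent. \<open>I + 1\<close> makes
      \<open>C'\<close> visibly positive.\<close>
    proof (rule has_adaptive_rate_log[where ?w0.0=1 and s=s and T=s and c="1 / Z" and \<kappa>="2 powr \<beta>"
          and C'="(I + 1) / Z" and \<kappa>'="1 / 2 * (1 / 2) powr \<beta>", OF \<alpha> \<gamma>])
      fix w :: real assume w: "1 \<le> w"
      have "exp (- (2 powr \<beta> * w)) / Z \<le> g x / Z" if "s w < x" "x < s w + 1" for x
      proof -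
        have "\<bar>x\<bar> powr \<beta> \<le> (2 * s w) powr \<beta>" using that s1[OF w] \<beta> by (intro powr_mono2) auto
        also have "\<dots> = 2 powr \<beta> * w" using s1[OF w] by (simp add: powr_mult s\<beta>[OF w])
        finally show ?thesis using pos by (simp add: g_def divide_right_mono)
      qed
      then show "1 / Z * exp (- (2 powr \<beta> * w)) \<le> tail (s w)"
        using tail_ge[of "s w" "s w + 1" "exp (- (2 powr \<beta> * w)) / Z"] pos by simp
    next
      fix D :: real assume D: "0 < D"
      have "g (x + D / \<beta> * w powr - \<gamma>) / Z \<le> exp (- D) * (g x / Z)" if w: "1 \<le> w" and x: "s w \<le> x" for w x
      proof (rule ratioI)
        define d where "d = D / \<beta> * w powr - \<gamma>"
        have d: "0 \<le> d" using D \<beta> by (simp add: d_def)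
        have x1: "1 \<le> x" using s1[OF w] x by linarith
        \<comment> \<open>The slope of the exponent at \<open>s w\<close> times the shift is exactly
          \<open>D\<close>, and the slope only grows further out.\<close>
        have "D = \<beta> * s w powr (\<beta> - 1) * d"
          using s\<gamma>[OF w] \<beta> by (simp add: d_def mult.assoc mult.left_commute)
        also have "\<dots> \<le> \<beta> * x powr (\<beta> - 1) * d"
          using \<beta>1 x s1[OF w] d by (intro mult_right_mono mult_left_mono powr_mono2) auto
        also have "\<dots> \<le> (x + d) powr \<beta> - x powr \<beta>"
          using powr_above_tangent[OF conv, of x "x + d"] x1 d by simp
        finally have "- ((x + d) powr \<beta>) \<le> - D + - (x powr \<beta>)" by simp
        then have "exp (- ((x + d) powr \<beta>)) \<le> exp (- D) * exp (- (x powr \<beta>))"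
          unfolding exp_add[symmetric] by simp
        then show "g (x + D / \<beta> * w powr - \<gamma>) \<le> exp (- D) * g x"
          unfolding d_def[symmetric] g_def using x1 d by simp
      qed
      moreover have "0 < D / \<beta>" using D \<beta> by simp
      ultimately show "\<exists>C>0. \<forall>w\<ge>1. \<forall>x\<ge>s w. g (x + C * w powr - \<gamma>) / Z \<le> exp (- D) * (g x / Z)"
        by blast
    next
      fix \<delta> :: real assume \<delta>: "0 < \<delta>" "\<delta> < 1"
      \<comment> \<open>The cap \<open>1 / 2\<close> keeps the shifted cut-off above
        \<open>s w / 2\<close>; the other entry bounds slope times shift by
        \<open>ln (1 + \<delta>)\<close>.\<close>
      define a where "a = min (1 / 2) (ln (1 + \<delta>) / \<beta>)"
      have a: "0 < a" "a \<le> 1 / 2" "\<beta> * a \<le> ln (1 + \<delta>)"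
        using \<delta> \<beta> by (auto simp: a_def min_def field_simps)
      have ratio: "g (x - a * w powr - \<gamma>) / Z \<le> (1 + \<delta>) * (g x / Z)" if w: "1 \<le> w" and x: "x \<le> s w" for w x
      proof (rule ratioI)
        define r where "r = a * w powr - \<gamma>"
        have r: "0 < r" using a w by (simp add: r_def)
        have "\<bar>x\<bar> powr \<beta> \<le> \<bar>x - r\<bar> powr \<beta> + ln (1 + \<delta>)"
        proof (cases "\<bar>x\<bar> \<le> \<bar>x - r\<bar>")
          case True
          then have "\<bar>x\<bar> powr \<beta> \<le> \<bar>x - r\<bar> powr \<beta>" using \<beta> by (intro powr_mono2) auto
          then show ?thesis using \<delta> by (simp add: add_increasing2)
        next
          case False
          then have x0: "0 < x" "\<bar>x - r\<bar> < x" "x - \<bar>x - r\<bar> \<le> r" using r by auto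
          have "x powr \<beta> - \<bar>x - r\<bar> powr \<beta> \<le> \<beta> * x powr (\<beta> - 1) * (x - \<bar>x - r\<bar>)"
          \<comment> \<open>The tangent inequality needs two positive points, but
            \<open>\<bar>x - r\<bar> = 0\<close> if \<open>x = r\<close>; there the claim is
            \<open>x powr \<beta> \<le> \<beta> * x powr \<beta>\<close>.\<close>
          proof (cases "x = r")
            case True
            then show ?thesis using x0 \<beta>1 by (simp add: powr_mult_base[symmetric] mult.assoc mult.commute[of _ x] powr_diff)
          next
            case False
            then show ?thesis using powr_above_tangent[OF conv x0(1), of "\<bar>x - r\<bar>"]
              by (simp add: algebra_simps)
          qed
          also have "\<dots> \<le> \<beta> * s w powr (\<beta> - 1) * r"
            using x0 x \<beta>1 by (intro mult_mono powr_mono2) auto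
          also have "\<dots> = \<beta> * a * (s w powr (\<beta> - 1) * w powr - \<gamma>)" by (simp add: r_def)
          also have "\<dots> \<le> ln (1 + \<delta>)" using a by (simp add: s\<gamma>[OF w])
          finally show ?thesis using x0 by simp
        qed
        then have "exp (- (\<bar>x - r\<bar> powr \<beta>)) \<le> exp (ln (1 + \<delta>) + - (\<bar>x\<bar> powr \<beta>))" by simp
        also have "\<dots> = (1 + \<delta>) * exp (- (\<bar>x\<bar> powr \<beta>))" unfolding exp_add using \<delta> by simp
        finally show "g (x - a * w powr - \<gamma>) \<le> (1 + \<delta>) * g x" by (simp add: g_def r_def)
      qed
      have "tail (s w - a * w powr - \<gamma>) \<le> (I + 1) / Z * exp (- (1 / 2 * (1 / 2) powr \<beta> * w))" if w: "1 \<le> w" for w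
      proof -
        have "a * w powr - \<gamma> \<le> 1 / 2 * 1" using a w\<gamma>[OF w] by (intro mult_mono) auto
        then have "1 / 2 * s w \<le> s w - a * w powr - \<gamma>" using s1[OF w] by simp
        then have "tail (s w - a * w powr - \<gamma>) \<le> tail (1 / 2 * s w)" by (rule tail_antimono)
        also have "\<dots> \<le> I / Z * exp (- (1 / 2 * (1 / 2 * s w) powr \<beta>))"
          using s1[OF w] by (intro tail_le) auto
        also have "(1 / 2 * s w) powr \<beta> = (1 / 2) powr \<beta> * w" using s1[OF w] by (simp only: powr_mult s\<beta>[OF w])
        also have "I / Z * exp (- (1 / 2 * ((1 / 2) powr \<beta> * w))) \<le> (I + 1) / Z * exp (- (1 / 2 * ((1 / 2) powr \<beta> * w)))"
          using pos by (intro mult_right_mono divide_right_mono) auto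
        finally show ?thesis by (simp only: mult.assoc)
      qed
      then show "\<exists>a>0. \<forall>w\<ge>1. (\<forall>x\<le>s w. g (x - a * w powr - \<gamma>) / Z \<le> (1 + \<delta>) * (g x / Z)) \<and>
          tail (s w - a * w powr - \<gamma>) \<le> (I + 1) / Z * exp (- (1 / 2 * (1 / 2) powr \<beta> * w))"
        using ratio a(1) by blast
    qed (use pos I0 in auto)
    then show ?thesis using \<beta>1 by (simp add: \<gamma>_def max_def)
  qed
  then show ?thesis
    by (simp add: generalized_gaussian_def normalized_density_def g_def[abs_def] Z_def)
qed

section \<open>Mollifiers\<close>

lemma (in even_density) tail_le:
  assumes "a \<le> b" "0 \<le> m" and le: "\<And>x. a < x \<Longrightarrow> x \<le> b \<Longrightarrow> p x \<le> m" and zero: "\<And>x. b < x \<Longrightarrow> p x = 0"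
  shows "tail a \<le> (b - a) * m"
proof -
  have "ennreal (tail a) \<le> (\<integral>\<^sup>+x. ennreal m * indicator {a<..b} x \<partial>lborel)"
    unfolding ennreal_tail
  proof (rule nn_integral_mono)
    fix x :: real
    consider "x \<le> a" | "a < x" "x \<le> b" | "b < x" by linarith
    then show "ennreal (p x) * indicator {a<..} x \<le> ennreal m * indicator {a<..b} x"
      by cases (use le zero in \<open>auto intro: ennreal_leI\<close>)
  qed
  also have "\<dots> = ennreal ((b - a) * m)"
    using assms by (simp add: nn_integral_cmult_indicator ennreal_mult' mult.commute)
  finally show ?thesis using assms by (simp add: ennreal_le_iff)
qed

text \<open>At distance \<open>y w = w powr - (1 / \<beta>)\<close> from the edge the exponent
  \<open>(1 - t\<^sup>2) powr - \<beta>\<close> is of order \<open>w\<close>, and its slope is of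
  order \<open>y w powr (- \<beta> - 1) = w powr \<gamma>\<close>; the local scale is therefore
  \<open>w powr - \<gamma>\<close>.\<close>

theorem has_adaptive_rate_mollifier:
  assumes \<alpha>: "0 < \<alpha>" "\<alpha> < 1 / 4" and \<beta>: "0 < \<beta>"
  shows "has_adaptive_rate \<alpha> (mollifier \<beta>)
    (\<lambda>n \<epsilon>. (1 / ln (real n) + inv_log_inv \<epsilon>) powr ((\<beta> + 1) / \<beta>))"
proof -
  define g where "g t = (if \<bar>t\<bar> < 1 then exp (- (1 / (1 - t\<^sup>2) powr \<beta>)) else 0)" for t :: real
  define Z where "Z = (\<integral>t. g t \<partial>lborel)"
  have g_in: "g t = exp (- ((1 - t\<^sup>2) powr - \<beta>))" if "\<bar>t\<bar> < 1" for t
    using that by (simp add: g_def powr_minus_divide)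
  have g_out: "g t = 0" if "1 \<le> \<bar>t\<bar>" for t using that by (simp add: g_def)
  have sq: "0 < 1 - t\<^sup>2" if "\<bar>t\<bar> < 1" for t :: real using that by (simp add: abs_square_less_1)
  have fac: "1 - t\<^sup>2 = (1 - t) * (1 + t)" for t :: real by (simp add: power2_eq_square algebra_simps)
  have [measurable]: "g \<in> borel_measurable borel" unfolding g_def[abs_def] by measurable
  have g0: "0 \<le> g t" for t by (simp add: g_def)
  have g1: "g t \<le> 1" for t by (simp add: g_def)
  have int: "integrable lborel g"
  proof (rule integrableI_bounded_set[where A="{-1..1}" and B=1])
    show "AE x in lborel. x \<in> {-1..1} \<longrightarrow> norm (g x) \<le> 1" using g0 g1 by (intro AE_I2) auto
    show "AE x in lborel. x \<notin> {-1..1} \<longrightarrow> g x = 0" using g_out by (intro AE_I2) auto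
  qed auto
  have pos: "0 < Z" unfolding Z_def
  proof (rule integral_pos_of_ge[OF int g0, of 0 "1 / 2" "exp (- ((1 / 2) powr - \<beta>))"])
    fix x :: real assume x: "0 < x" "x < 1 / 2"
    have "1 / 2 * 1 \<le> (1 - x) * (1 + x)" using x by (intro mult_mono) auto
    then have "(1 - x\<^sup>2) powr - \<beta> \<le> (1 / 2) powr - \<beta>" unfolding fac using \<beta> x by (intro powr_mono2') auto
    then show "exp (- ((1 / 2) powr - \<beta>)) \<le> g x" using x g_in[of x] by simp
  qed auto
  interpret even_density "\<lambda>x. g x / Z"
    unfolding Z_def by (rule even_density_normalized[OF _ g0 _ int pos[unfolded Z_def]]) (auto simp: g_def)
  have ratioI: "g y / Z \<le> k * (g x / Z)" if "g y \<le> k * g x" for x y k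
    using that pos by (simp add: divide_right_mono)
  define \<gamma> where "\<gamma> = (\<beta> + 1) / \<beta>"
  define y where "y w = w powr - (1 / \<beta>)" for w :: real
  \<comment> \<open>Ensures \<open>y w \<le> 1 / 2\<close>, so that points beyond
    \<open>1 - y w\<close> are at least \<open>1 / 2\<close> and \<open>1 - 2 * y w\<close> is
    nonnegative.\<close>
  define w0 where "w0 = 2 powr \<beta>"
  have \<gamma>: "0 < \<gamma>" using \<beta> by (simp add: \<gamma>_def)
  have w0: "0 < w0" by (simp add: w0_def)
  have wpos: "0 < w" if "w0 \<le> w" for w using that w0 by linarith
  have y0: "0 < y w" if "w0 \<le> w" for w using wpos[OF that] by (simp add: y_def)
  have y1: "y w \<le> 1 / 2" if "w0 \<le> w" for w
  proof -
    have "y w \<le> w0 powr - (1 / \<beta>)" unfolding y_def using that w0 \<beta> by (intro powr_mono2') auto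
    also have "\<dots> = 1 / 2" using \<beta> by (simp add: w0_def powr_powr powr_minus_divide)
    finally show ?thesis .
  qed
  have y\<beta>: "y w powr - \<beta> = w" if "w0 \<le> w" for w using wpos[OF that] \<beta> by (simp add: y_def powr_powr)
  have y\<gamma>: "w powr - \<gamma> = y w powr (\<beta> + 1)" if "w0 \<le> w" for w
    using \<beta> by (simp add: y_def powr_powr \<gamma>_def add_divide_distrib)
  have yinv: "y w powr (- \<beta> - 1) * y w powr (\<beta> + 1) = 1" if "w0 \<le> w" for w
    using y0[OF that] by (simp flip: powr_add)
  have conv: "0 \<le> - \<beta> * (- \<beta> - 1)" using \<beta> by (intro mult_nonpos_nonpos) auto
  \<comment> \<open>\<open>powr_le_exp\<close> then gives \<open>y w \<ge> exp (- w) / A\<close>: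
    the width of the strip that bounds the tail from below is paid for by the \<open>+ 1\<close> in
    \<open>\<kappa>\<close>.\<close>
  define A where "A = (1 / \<beta>) powr (1 / \<beta>)"
  have A: "0 < A" using \<beta> by (simp add: A_def)
  have "has_adaptive_rate \<alpha> P (\<lambda>n \<epsilon>. (1 / ln (real n) + inv_log_inv \<epsilon>) powr \<gamma>)"
  proof (rule has_adaptive_rate_log[where ?w0.0=w0 and s="\<lambda>w. 1 - y w" and T="\<lambda>w. 1 - y w"
        and c="1 / (2 * A * Z)" and \<kappa>="2 powr \<beta> + 1" and C'="1 / Z" and \<kappa>'="4 powr - \<beta>", OF \<alpha> \<gamma> w0])
    fix w :: real assume w: "w0 \<le> w"
    have "exp (- (2 powr \<beta> * w)) / Z \<le> g x / Z" if x: "1 - y w < x" "x < 1 - y w / 2" for x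
    proof -
      have x01: "0 < x" "x < 1" using x y0[OF w] y1[OF w] by auto
      have "y w / 2 * 1 \<le> (1 - x) * (1 + x)" using x x01 y0[OF w] by (intro mult_mono) auto
      then have "(1 - x\<^sup>2) powr - \<beta> \<le> (y w / 2) powr - \<beta>"
        unfolding fac using \<beta> y0[OF w] by (intro powr_mono2') auto
      also have "\<dots> = 2 powr \<beta> * w"
      proof -
        have half: "(1 / 2) powr - \<beta> = 2 powr \<beta>" by (simp add: powr_minus powr_divide)
        have "(y w * (1 / 2)) powr - \<beta> = w * 2 powr \<beta>"
          using y0[OF w] by (simp only: powr_mult half y\<beta>[OF w])
        then show ?thesis by (simp add: mult.commute)
      qed
      finally show ?thesis using x01 pos by (simp add: g_in divide_right_mono)
    qed
    then have "y w / 2 * (exp (- (2 powr \<beta> * w)) / Z) \<le> tail (1 - y w)"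
      using tail_ge[of "1 - y w" "1 - y w / 2" "exp (- (2 powr \<beta> * w)) / Z"] pos y0[OF w] by simp
    moreover have "exp (- w) / A \<le> y w"
    proof -
      have "w powr (1 / \<beta>) \<le> A * exp w" unfolding A_def using \<beta> wpos[OF w] by (intro powr_le_exp) auto
      then show ?thesis using A wpos[OF w] by (simp add: y_def powr_minus exp_minus field_simps)
    qed
    then have "exp (- w) / A / 2 * (exp (- (2 powr \<beta> * w)) / Z) \<le> y w / 2 * (exp (- (2 powr \<beta> * w)) / Z)"
      using pos by (intro mult_right_mono) auto
    moreover have "1 / (2 * A * Z) * exp (- ((2 powr \<beta> + 1) * w)) = exp (- w) / A / 2 * (exp (- (2 powr \<beta> * w)) / Z)"
      by (simp add: distrib_right exp_diff exp_minus field_simps flip: exp_add)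
    ultimately show "1 / (2 * A * Z) * exp (- ((2 powr \<beta> + 1) * w)) \<le> tail (1 - y w)" by linarith
  next
    fix D :: real assume D: "0 < D"
    \<comment> \<open>Since \<open>1 - x\<^sup>2\<close> can be as large as \<open>2 * y w\<close>,
      the slope may fall short by \<open>2 powr (- \<beta> - 1)\<close>; the last factor
      compensates.\<close>
    define C where "C = D / \<beta> * 2 powr (\<beta> + 1)"
    have C: "0 < C" using D \<beta> by (simp add: C_def)
    have "g (x + C * w powr - \<gamma>) / Z \<le> exp (- D) * (g x / Z)" if w: "w0 \<le> w" and x: "1 - y w \<le> x" for w x
    proof (rule ratioI)
      define d where "d = C * y w powr (\<beta> + 1)"
      have d: "0 < d" using C y0[OF w] by (simp add: d_def)
      have x12: "1 / 2 \<le> x" using x y1[OF w] by linarith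
      have "g (x + d) \<le> exp (- D) * g x"
      proof (cases "x + d < 1")
        case False
        then show ?thesis using g0[of x] g_out[of "x + d"] x12 d by simp
      next
        case True
        define u v where "u = 1 - x\<^sup>2" and "v = 1 - (x + d)\<^sup>2"
        have uv: "0 < u" "0 < v" using sq[of x] sq[of "x + d"] x12 d True by (auto simp: u_def v_def)
        have "d * 1 \<le> d * (2 * x + d)" using x12 d by (intro mult_left_mono) auto
        then have diff: "d \<le> u - v" by (simp add: u_def v_def power2_eq_square algebra_simps)
        have "u \<le> y w * 2" unfolding u_def fac using x x12 d True y0[OF w] by (intro mult_mono) auto
        then have "(y w * 2) powr (- \<beta> - 1) \<le> u powr (- \<beta> - 1)" using uv \<beta> by (intro powr_mono2') auto
        then have "\<beta> * (y w * 2) powr (- \<beta> - 1) * d \<le> \<beta> * u powr (- \<beta> - 1) * (u - v)"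
          using diff d \<beta> by (intro mult_mono) auto
        also have "\<dots> = - \<beta> * u powr (- \<beta> - 1) * (v - u)" by (simp add: algebra_simps)
        also have "\<dots> \<le> v powr - \<beta> - u powr - \<beta>" by (rule powr_above_tangent[OF conv uv])
        finally have "\<beta> * (y w * 2) powr (- \<beta> - 1) * d \<le> v powr - \<beta> - u powr - \<beta>" .
        moreover have "\<beta> * (y w * 2) powr (- \<beta> - 1) * d = D"
        proof -
          have "\<beta> * (y w * 2) powr (- \<beta> - 1) * d
             = (\<beta> * (D / \<beta>)) * (2 powr (- \<beta> - 1) * 2 powr (\<beta> + 1)) * (y w powr (- \<beta> - 1) * y w powr (\<beta> + 1))"
            using y0[OF w] by (simp add: d_def C_def powr_mult mult_ac)
          also have "\<dots> = D" unfolding yinv[OF w] using \<beta> by (simp flip: powr_add)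
          finally show ?thesis .
        qed
        ultimately have "- (v powr - \<beta>) \<le> - D + - (u powr - \<beta>)" by linarith
        then have "exp (- (v powr - \<beta>)) \<le> exp (- D) * exp (- (u powr - \<beta>))"
          unfolding exp_add[symmetric] by simp
        then show ?thesis using g_in[of x] g_in[of "x + d"] x12 d True by (simp add: u_def v_def)
      qed
      then show "g (x + C * w powr - \<gamma>) \<le> exp (- D) * g x" by (simp add: d_def y\<gamma>[OF w])
    qed
    then show "\<exists>C>0. \<forall>w\<ge>w0. \<forall>x\<ge>1 - y w. g (x + C * w powr - \<gamma>) / Z \<le> exp (- D) * (g x / Z)"
      using C by blast
  next
    fix \<delta> :: real assume \<delta>: "0 < \<delta>" "\<delta> < 1"
    \<comment> \<open>The cap 1 keeps the shift at most \<open>y w\<close>; the 2 in the denominator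
      pays for \<open>v - u \<le> r * 2\<close>.\<close>
    define a where "a = min 1 (ln (1 + \<delta>) / (2 * \<beta>))"
    have a: "0 < a" "a \<le> 1" "2 * \<beta> * a \<le> ln (1 + \<delta>)"
      using \<delta> \<beta> by (auto simp: a_def min_def field_simps)
    have ratio: "g (x - a * w powr - \<gamma>) / Z \<le> (1 + \<delta>) * (g x / Z)" if w: "w0 \<le> w" and x: "x \<le> 1 - y w" for w x
    proof (rule ratioI)
      define r where "r = a * y w powr (\<beta> + 1)"
      have r: "0 < r" using a y0[OF w] by (simp add: r_def)
      have "g (x - r) \<le> (1 + \<delta>) * g x"
      proof (cases "\<bar>x - r\<bar> < 1")
        case False
        then show ?thesis using g_out[of "x - r"] g0[of x] \<delta> by simp
      next
        case True
        define u v where "u = 1 - x\<^sup>2" and "v = 1 - (x - r)\<^sup>2"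
        have x1: "\<bar>x\<bar> < 1" using x y0[OF w] True r by auto
        have uv: "0 < u" "0 < v" using sq[of x] sq[of "x - r"] x1 True by (auto simp: u_def v_def)
        have "u powr - \<beta> \<le> v powr - \<beta> + ln (1 + \<delta>)"
        proof (cases "v \<le> u")
          case True
          then have "u powr - \<beta> \<le> v powr - \<beta>" using \<beta> uv by (intro powr_mono2') auto
          then show ?thesis using \<delta> by (simp add: add_increasing2)
        next
          case False
          \<comment> \<open>If the shift moves towards the centre, then \<open>x > 0\<close>, and
            \<open>u = (1 - x) * (1 + x) \<ge> y w\<close> limits the slope.\<close>
          then have "r * r < r * (2 * x)" by (simp add: u_def v_def power2_eq_square algebra_simps)
          then have x0: "0 < x" using r mult_less_cancel_left_pos[OF r] by auto
          have "y w * 1 \<le> u" unfolding u_def fac using x x0 x1 y0[OF w] by (intro mult_mono) auto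
          then have le: "u powr (- \<beta> - 1) \<le> y w powr (- \<beta> - 1)" using \<beta> y0[OF w] by (intro powr_mono2') auto
          have vu: "v - u = r * (2 * x - r)" by (simp add: u_def v_def power2_eq_square algebra_simps)
          also have "\<dots> \<le> r * 2" using r x1 by (intro mult_left_mono) auto
          finally have vu2: "v - u \<le> r * 2" .
          have "- \<beta> * u powr (- \<beta> - 1) * (v - u) \<le> v powr - \<beta> - u powr - \<beta>"
            by (rule powr_above_tangent[OF conv uv])
          then have "u powr - \<beta> - v powr - \<beta> \<le> \<beta> * u powr (- \<beta> - 1) * (v - u)" by simp
          also have "\<dots> \<le> \<beta> * y w powr (- \<beta> - 1) * (r * 2)"
            using le vu2 \<beta> False by (intro mult_mono) auto
          also have "\<dots> = 2 * \<beta> * a * (y w powr (- \<beta> - 1) * y w powr (\<beta> + 1))" by (simp add: r_def)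
          also have "\<dots> \<le> ln (1 + \<delta>)" unfolding yinv[OF w] using a by simp
          finally show ?thesis by simp
        qed
        then have "exp (- (v powr - \<beta>)) \<le> exp (ln (1 + \<delta>) + - (u powr - \<beta>))" by simp
        also have "\<dots> = (1 + \<delta>) * exp (- (u powr - \<beta>))" unfolding exp_add using \<delta> by simp
        finally show ?thesis using g_in[OF x1] g_in[OF True] by (simp add: u_def v_def)
      qed
      then show "g (x - a * w powr - \<gamma>) \<le> (1 + \<delta>) * g x" by (simp add: r_def y\<gamma>[OF w])
    qed
    have "tail ((1 - y w) - a * w powr - \<gamma>) \<le> 1 / Z * exp (- (4 powr - \<beta> * w))" if w: "w0 \<le> w" for w
    proof -
      define m where "m = exp (- (4 powr - \<beta> * w)) / Z"
      have m0: "0 \<le> m" using pos by (simp add: m_def)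
      \<comment> \<open>The shifted cut-off is within \<open>2 * y w\<close> of the edge, where
        \<open>1 - x\<^sup>2 \<le> 4 * y w\<close>; this explains
        \<open>\<kappa>' = 4 powr - \<beta>\<close>.\<close>
      have "y w powr (\<beta> + 1) \<le> y w powr 1" using y0[OF w] y1[OF w] \<beta> by (intro powr_mono') auto
      then have "a * w powr - \<gamma> \<le> 1 * y w"
        unfolding y\<gamma>[OF w] using a y0[OF w] by (intro mult_mono) auto
      then have "tail ((1 - y w) - a * w powr - \<gamma>) \<le> tail (1 - 2 * y w)" by (intro tail_antimono) simp
      also have "\<dots> \<le> (1 - (1 - 2 * y w)) * m"
      proof (rule tail_le)
        fix x :: real assume x': "1 - 2 * y w < x" "x \<le> 1"
        show "g x / Z \<le> m"
        proof (cases "x = 1")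
          case True
          then show ?thesis using g_out[of x] m0 by simp
        next
          case False
          then have x: "1 - 2 * y w < x" "x < 1" using x' by auto
          have x0: "0 < x" using x y1[OF w] by linarith
          have "1 - x\<^sup>2 \<le> 2 * y w * 2" unfolding fac using x x0 y0[OF w] by (intro mult_mono) auto
          then have "(2 * y w * 2) powr - \<beta> \<le> (1 - x\<^sup>2) powr - \<beta>"
            using sq[of x] x x0 \<beta> by (intro powr_mono2') auto
          moreover have "(2 * y w * 2) powr - \<beta> = 4 powr - \<beta> * w"
            using y0[OF w] powr_mult[of 4 "y w" "- \<beta>"] by (simp add: y\<beta>[OF w])
          ultimately show ?thesis using g_in[of x] x x0 pos by (simp add: m_def divide_right_mono)
        qed
      qed (use y0[OF w] m0 g_out in auto)
      also have "\<dots> \<le> 1 * m" using y1[OF w] m0 by (intro mult_right_mono) auto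
      finally show ?thesis by (simp add: m_def)
    qed
    then show "\<exists>a>0. \<forall>w\<ge>w0. (\<forall>x\<le>1 - y w. g (x - a * w powr - \<gamma>) / Z \<le> (1 + \<delta>) * (g x / Z)) \<and>
        tail (1 - y w - a * w powr - \<gamma>) \<le> 1 / Z * exp (- (4 powr - \<beta> * w))"
      using ratio a(1) by blast
  qed (use pos A in \<open>auto simp: add_pos_pos\<close>)
  then show ?thesis
    by (simp add: mollifier_def normalized_density_def g_def[abs_def] Z_def \<gamma>_def)
qed

section \<open>Bates distributions\<close>

text \<open>\<open>uniform_sum_density k\<close> is the density of the sum of \<open>k + 1\<close> independent uniform
  variables on \<open>[-1/2, 1/2]\<close>.\<close>

fun uniform_sum_density :: "nat \<Rightarrow> real \<Rightarrow> ennreal" where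
  "uniform_sum_density 0 t = indicator {- 1 / 2..1 / 2} t"
| "uniform_sum_density (Suc k) t =
    (\<integral>\<^sup>+y. indicator {- 1 / 2..1 / 2} y * uniform_sum_density k (t - y) \<partial>lborel)"

lemma measurable_uniform_sum_density [measurable]:
  "uniform_sum_density k \<in> borel_measurable borel"
proof (induction k)
  case 0
  show ?case unfolding uniform_sum_density.simps by measurable
next
  case (Suc k)
  note Suc[measurable]
  show ?case unfolding uniform_sum_density.simps by measurable
qed

lemma uniform_sum_density_even: "uniform_sum_density k (- t) = uniform_sum_density k t"
proof (induction k arbitrary: t)
  case 0
  show ?case by (auto simp: indicator_def)
next
  case (Suc k)
  have "uniform_sum_density (Suc k) (- t)
    = (\<integral>\<^sup>+y. indicator {- 1 / 2..1 / 2} (- y) * uniform_sum_density k (- t - (- y)) \<partial>lborel)"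
    unfolding uniform_sum_density.simps by (subst nn_integral_real_affine[where c="-1" and t=0]) simp_all
  also have "\<dots> = uniform_sum_density (Suc k) t"
    unfolding uniform_sum_density.simps
  proof (rule nn_integral_cong)
    fix y :: real
    show "indicator {- 1 / 2..1 / 2} (- y) * uniform_sum_density k (- t - (- y))
      = indicator {- 1 / 2..1 / 2} y * uniform_sum_density k (t - y)"
      using Suc[of "t - y"] by (auto simp: indicator_def)
  qed
  finally show ?case .
qed

lemma uniform_sum_density_le_1: "uniform_sum_density k t \<le> 1"
proof (induction k arbitrary: t)
  case (Suc k)
  have "uniform_sum_density (Suc k) t \<le> (\<integral>\<^sup>+y. indicator {- 1 / 2..1 / 2 :: real} y \<partial>lborel)"
    unfolding uniform_sum_density.simps using Suc by (intro nn_integral_mono) (auto simp: indicator_def)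
  then show ?case by simp
qed (simp add: indicator_def)

text \<open>The convolution in coordinates measured from the right end point: \<open>w\<close> is
  the distance of the sum from its maximum, \<open>v\<close> that of one summand. All estimates
  below are inductions on this form.\<close>

lemma uniform_sum_density_edge:
  "uniform_sum_density (Suc k) (real (Suc (Suc k)) / 2 - w)
    = (\<integral>\<^sup>+v. indicator {0..1} v * uniform_sum_density k (real (Suc k) / 2 - (w - v)) \<partial>lborel)"
proof -
  have "uniform_sum_density (Suc k) (real (Suc (Suc k)) / 2 - w)
    = (\<integral>\<^sup>+v. indicator {- 1 / 2..1 / 2} (1 / 2 + (- 1) * v)
        * uniform_sum_density k (real (Suc (Suc k)) / 2 - w - (1 / 2 + (- 1) * v)) \<partial>lborel)"
    unfolding uniform_sum_density.simps by (subst nn_integral_real_affine[where c="-1" and t="1/2"]) simp_all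
  also have "\<dots> = (\<integral>\<^sup>+v. indicator {0..1} v * uniform_sum_density k (real (Suc k) / 2 - (w - v)) \<partial>lborel)"
  proof (rule nn_integral_cong)
    fix v :: real
    have eq: "real (Suc (Suc k)) / 2 - w - (1 / 2 + (- 1) * v) = real (Suc k) / 2 - (w - v)" by (simp add: field_simps)
    show "indicator {- 1 / 2..1 / 2} (1 / 2 + (- 1) * v)
        * uniform_sum_density k (real (Suc (Suc k)) / 2 - w - (1 / 2 + (- 1) * v))
      = indicator {0..1} v * uniform_sum_density k (real (Suc k) / 2 - (w - v))"
      unfolding eq by (auto simp: indicator_def)
  qed
  finally show ?thesis .
qed

lemma uniform_sum_density_eq_0: "w < 0 \<Longrightarrow> uniform_sum_density k (real (Suc k) / 2 - w) = 0"
proof (induction k arbitrary: w)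
  case (Suc k)
  then show ?case unfolding uniform_sum_density_edge
    by (subst nn_integral_0_iff_AE) (auto simp: indicator_def)
qed (simp add: indicator_def)

text \<open>Substituting \<open>l * v\<close> for \<open>v\<close> in the recursion costs one factor
  \<open>l\<close> per convolution, and \<open>[0, l]\<close> stays inside \<open>[0, 1]\<close>.
  This comparison, exact for the power \<open>w ^ k\<close>, replaces a bound on the logarithmic
  derivative.\<close>

lemma uniform_sum_density_scale:
  assumes "0 < l" "l \<le> 1"
  shows "ennreal (l ^ k) * uniform_sum_density k (real (Suc k) / 2 - w)
    \<le> uniform_sum_density k (real (Suc k) / 2 - l * w)"
proof (induction k arbitrary: w)
  case 0
  have "0 \<le> l * w \<and> l * w \<le> 1" if "0 \<le> w" "w \<le> 1"
    using that assms mult_le_one[of l w] by auto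
  then show ?case by (auto simp: indicator_def)
next
  case (Suc k)
  let ?f = "uniform_sum_density k" and ?b = "real (Suc k) / 2"
  have "ennreal (l ^ Suc k) * uniform_sum_density (Suc k) (real (Suc (Suc k)) / 2 - w)
    = ennreal l * (\<integral>\<^sup>+v. indicator {0..1} v * (ennreal (l ^ k) * ?f (?b - (w - v))) \<partial>lborel)"
    unfolding uniform_sum_density_edge using assms
    by (simp add: ennreal_mult mult.assoc mult.left_commute[of _ "ennreal (l ^ k)"] nn_integral_cmult)
  also have "\<dots> \<le> ennreal l * (\<integral>\<^sup>+v. indicator {0..1} (0 + l * v) * ?f (?b - (l * w - (0 + l * v))) \<partial>lborel)"
  proof (intro mult_left_mono nn_integral_mono)
    fix v :: real
    have "ennreal (l ^ k) * ?f (?b - (w - v)) \<le> ?f (?b - l * (w - v))" by (rule Suc.IH)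
    also have "?b - l * (w - v) = ?b - (l * w - (0 + l * v))" by (simp add: right_diff_distrib)
    finally show "indicator {0..1} v * (ennreal (l ^ k) * ?f (?b - (w - v)))
      \<le> indicator {0..1} (0 + l * v) * ?f (?b - (l * w - (0 + l * v)))"
      using assms mult_le_one[of l v] by (auto simp: indicator_def)
  qed simp
  also have "\<dots> = uniform_sum_density (Suc k) (real (Suc (Suc k)) / 2 - l * w)"
    unfolding uniform_sum_density_edge using assms
    by (subst nn_integral_real_affine[where c=l and t=0]) simp_all
  finally show ?case .
qed

text \<open>The density vanishes beyond the edge, so only \<open>v\<close> in \<open>[0, w]\<close>
  contributes and each convolution gains a factor \<open>w\<close>.\<close>

lemma uniform_sum_density_le_power:
  "0 \<le> w \<Longrightarrow> uniform_sum_density k (real (Suc k) / 2 - w) \<le> ennreal (w ^ k)"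
proof (induction k arbitrary: w)
  case (Suc k)
  have "uniform_sum_density (Suc k) (real (Suc (Suc k)) / 2 - w)
    \<le> (\<integral>\<^sup>+v. ennreal (w ^ k) * indicator {0..w} v \<partial>lborel)"
    unfolding uniform_sum_density_edge
  proof (rule nn_integral_mono)
    fix v :: real
    show "indicator {0..1} v * uniform_sum_density k (real (Suc k) / 2 - (w - v)) \<le> ennreal (w ^ k) * indicator {0..w} v"
    proof (cases "0 \<le> v \<and> v \<le> w")
      case True
      then have "uniform_sum_density k (real (Suc k) / 2 - (w - v)) \<le> ennreal ((w - v) ^ k)" by (intro Suc.IH) auto
      also have "\<dots> \<le> ennreal (w ^ k)" using True by (intro ennreal_leI power_mono) auto
      finally show ?thesis using True by (auto simp: indicator_def)
    next
      case False
      then show ?thesis using uniform_sum_density_eq_0[of "w - v" k] by (auto simp: indicator_def)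
    qed
  qed
  also have "\<dots> = ennreal (w ^ Suc k)"
    using Suc.prems by (simp add: nn_integral_cmult_indicator ennreal_mult' mult.commute)
  finally show ?case .
qed (simp add: indicator_def)

lemma uniform_sum_density_ge_power:
  "\<exists>c>0. \<forall>w. 0 \<le> w \<longrightarrow> w \<le> 1 \<longrightarrow> ennreal (c * w ^ k) \<le> uniform_sum_density k (real (Suc k) / 2 - w)"
proof (induction k)
  case 0
  show ?case by (intro exI[of _ 1]) (auto simp: indicator_def)
next
  case (Suc k)
  then obtain c where c: "0 < c"
    and IH: "\<forall>w. 0 \<le> w \<longrightarrow> w \<le> 1 \<longrightarrow> ennreal (c * w ^ k) \<le> uniform_sum_density k (real (Suc k) / 2 - w)"
    by blast
  have "ennreal (c / 2 ^ Suc k * w ^ Suc k) \<le> uniform_sum_density (Suc k) (real (Suc (Suc k)) / 2 - w)"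
    if w: "0 \<le> w" "w \<le> 1" for w
  proof -
    \<comment> \<open>Restricting to \<open>v \<le> w / 2\<close> keeps
      \<open>w - v \<ge> w / 2\<close>, hence the powers of 2 in the constant.\<close>
    have eq: "c / 2 ^ Suc k * w ^ Suc k = c * (w / 2) ^ k * (w / 2)" by (simp add: power_divide mult_ac)
    have "ennreal (c / 2 ^ Suc k * w ^ Suc k) = (\<integral>\<^sup>+v. ennreal (c * (w / 2) ^ k) * indicator {0..w / 2} v \<partial>lborel)"
      unfolding eq by (subst ennreal_mult) (use w c in \<open>auto simp: nn_integral_cmult_indicator\<close>)
    also have "\<dots> \<le> uniform_sum_density (Suc k) (real (Suc (Suc k)) / 2 - w)"
      unfolding uniform_sum_density_edge
    proof (rule nn_integral_mono)
      fix v :: real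
      have "ennreal (c * (w / 2) ^ k) \<le> uniform_sum_density k (real (Suc k) / 2 - (w - v))" if v: "0 \<le> v" "v \<le> w / 2"
      proof -
        have "ennreal (c * (w / 2) ^ k) \<le> ennreal (c * (w - v) ^ k)"
          using v w c by (intro ennreal_leI mult_left_mono power_mono) auto
        also have "\<dots> \<le> uniform_sum_density k (real (Suc k) / 2 - (w - v))" using IH v w by auto
        finally show ?thesis .
      qed
      then show "ennreal (c * (w / 2) ^ k) * indicator {0..w / 2} v
        \<le> indicator {0..1} v * uniform_sum_density k (real (Suc k) / 2 - (w - v))"
        using w by (auto simp: indicator_def)
    qed
    finally show ?thesis .
  qed
  moreover have "0 < c / 2 ^ Suc k" using c by simp
  ultimately show ?case by blast
qed

text \<open>The test function \<open>f\<close> is arbitrary so that the induction hypothesis applies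
  to \<open>f (s + y)\<close> integrated over the last variable \<open>y\<close>; Fubini and a
  translation then produce the convolution.\<close>

lemma nn_integral_uniform_sum:
  assumes "f \<in> borel_measurable borel"
  shows "(\<integral>\<^sup>+u. f (\<Sum>j<Suc k. u j) \<partial>PiM {..<Suc k} (\<lambda>_. uniform_measure lborel {- 1 / 2..1 / 2}))
    = (\<integral>\<^sup>+t. f t * uniform_sum_density k t \<partial>lborel)"
  using assms
proof (induction k arbitrary: f)
  case 0
  define U where "U = uniform_measure lborel {- 1 / 2..1 / 2 :: real}"
  have U: "prob_space U" unfolding U_def by (rule prob_space_uniform_measure) auto
  interpret U: prob_space U by (rule U)
  interpret product_sigma_finite "\<lambda>_::nat. U" ..
  note 0[measurable]
  have "(\<integral>\<^sup>+u. f (u (0::nat)) \<partial>PiM {0} (\<lambda>_. U)) = (\<integral>\<^sup>+t. f t \<partial>U)"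
    by (rule product_nn_integral_singleton) (simp add: U_def)
  also have "\<dots> = (\<integral>\<^sup>+t. f t * indicator {- 1 / 2..1 / 2} t \<partial>lborel)"
    unfolding U_def by (subst nn_integral_uniform_measure) (auto simp: divide_ennreal_def)
  finally show ?case by (simp add: U_def lessThan_Suc)
next
  case (Suc k)
  define U where "U = uniform_measure lborel {- 1 / 2..1 / 2 :: real}"
  have U: "prob_space U" unfolding U_def by (rule prob_space_uniform_measure) auto
  interpret U: prob_space U by (rule U)
  interpret product_sigma_finite "\<lambda>_::nat. U" ..
  have setsU[measurable_cong]: "sets U = sets borel" by (simp add: U_def)
  note Suc.prems[measurable]
  let ?K = "Suc k" and ?F = "uniform_sum_density k" and ?i = "indicator {- 1 / 2..1 / 2} :: real \<Rightarrow> ennreal"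
  have intU: "(\<integral>\<^sup>+y. h y \<partial>U) = (\<integral>\<^sup>+y. h y * ?i y \<partial>lborel)" if [measurable]: "h \<in> borel_measurable borel" for h
    unfolding U_def by (subst nn_integral_uniform_measure) (auto simp: divide_ennreal_def)
  have "(\<integral>\<^sup>+u. f (\<Sum>j<Suc ?K. u j) \<partial>PiM {..<Suc ?K} (\<lambda>_. U))
    = (\<integral>\<^sup>+u. f ((\<Sum>j<?K. u j) + u ?K) \<partial>PiM (insert ?K {..<?K}) (\<lambda>_. U))"
    unfolding lessThan_Suc[of ?K] by (simp add: add.commute)
  also have "\<dots> = (\<integral>\<^sup>+u. \<integral>\<^sup>+y. f ((\<Sum>j<?K. (u(?K := y)) j) + (u(?K := y)) ?K) \<partial>U \<partial>PiM {..<?K} (\<lambda>_. U))"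
    by (rule product_nn_integral_insert) auto
  also have "\<dots> = (\<integral>\<^sup>+u. \<integral>\<^sup>+y. f ((\<Sum>j<?K. u j) + y) \<partial>U \<partial>PiM {..<?K} (\<lambda>_. U))"
    by (intro nn_integral_cong) (simp cong: sum.cong_simp)
  also have "\<dots> = (\<integral>\<^sup>+s. (\<integral>\<^sup>+y. f (s + y) \<partial>U) * ?F s \<partial>lborel)"
    unfolding U_def by (rule Suc.IH) (unfold U_def[symmetric], measurable)
  also have "\<dots> = (\<integral>\<^sup>+s. \<integral>\<^sup>+y. f (s + y) * ?i y * ?F s \<partial>lborel \<partial>lborel)"
    by (intro nn_integral_cong) (simp add: intU nn_integral_multc)
  also have "\<dots> = (\<integral>\<^sup>+y. \<integral>\<^sup>+s. f (s + y) * ?i y * ?F s \<partial>lborel \<partial>lborel)"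
    by (rule lborel_pair.Fubini') measurable
  also have "\<dots> = (\<integral>\<^sup>+y. \<integral>\<^sup>+t. f t * (?i y * ?F (t - y)) \<partial>lborel \<partial>lborel)"
  proof (rule nn_integral_cong)
    fix y :: real
    show "(\<integral>\<^sup>+s. f (s + y) * ?i y * ?F s \<partial>lborel) = (\<integral>\<^sup>+t. f t * (?i y * ?F (t - y)) \<partial>lborel)"
      by (subst nn_integral_real_affine[where c=1 and t="- y"]) (auto simp: mult.assoc)
  qed
  also have "\<dots> = (\<integral>\<^sup>+t. \<integral>\<^sup>+y. f t * (?i y * ?F (t - y)) \<partial>lborel \<partial>lborel)"
    by (rule lborel_pair.Fubini') measurable
  also have "\<dots> = (\<integral>\<^sup>+t. f t * uniform_sum_density ?K t \<partial>lborel)"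
    unfolding uniform_sum_density.simps by (intro nn_integral_cong nn_integral_cmult) measurable
  finally show ?case unfolding U_def .
qed

text \<open>The tail at distance \<open>z\<close> from the end point \<open>1 / 2\<close> is of
  order \<open>z ^ N\<close>, so the quantile of order \<open>\<tau>\<close> lies at distance
  \<open>\<tau> powr (1 / N)\<close>. A shift by a small multiple of this distance changes the
  density by a factor near 1, by the scaling property.\<close>

theorem has_adaptive_rate_bates:
  assumes \<alpha>: "0 < \<alpha>" "\<alpha> < 1 / 4" and "1 \<le> (N :: nat)"
  shows "has_adaptive_rate \<alpha> (bates N) (\<lambda>n \<epsilon>. (1 / real n + \<epsilon>) powr (1 / real N))"
proof -
  obtain k where k: "N = Suc k" using assms(3) by (cases N) auto
  have N: "0 < real N" by (simp add: k)
  define F where "F t = enn2real (uniform_sum_density k t)" for t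
  have fin: "uniform_sum_density k t < top" for t
    by (rule le_less_trans[OF uniform_sum_density_le_1]) simp
  have F: "ennreal (F t) = uniform_sum_density k t" for t using fin[of t] by (simp add: F_def)
  have F0: "0 \<le> F t" for t by (simp add: F_def)
  have [measurable]: "F \<in> borel_measurable borel" unfolding F_def[abs_def] by measurable
  have Fscale: "l ^ k * F (real N / 2 - w) \<le> F (real N / 2 - l * w)" if "0 < l" "l \<le> 1" for l w
    using uniform_sum_density_scale[OF that, of k w] that F0
    unfolding k[symmetric] F[symmetric] by (simp add: ennreal_le_iff flip: ennreal_mult)
  have Fle: "F (real N / 2 - w) \<le> w ^ k" if "0 \<le> w" for w
    using uniform_sum_density_le_power[OF that, of k] that
    unfolding k[symmetric] F[symmetric] by (simp add: ennreal_le_iff)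
  have Feq0: "F (real N / 2 - w) = 0" if "w < 0" for w
    using uniform_sum_density_eq_0[OF that, of k] unfolding k[symmetric] by (simp add: F_def)
  obtain c where c: "0 < c" and "\<forall>w. 0 \<le> w \<longrightarrow> w \<le> 1 \<longrightarrow> ennreal (c * w ^ k) \<le> uniform_sum_density k (real N / 2 - w)"
    using uniform_sum_density_ge_power[of k] unfolding k by blast
  then have Fge: "c * w ^ k \<le> F (real N / 2 - w)" if "0 \<le> w" "w \<le> 1" for w
    using that F0 unfolding F[symmetric] by (simp add: ennreal_le_iff)
  define p where "p x = real N * F (real N / 2 - real N * (1 / 2 - x))" for x
  have pN: "p x = real N * F (real N * x)" for x by (simp add: p_def right_diff_distrib)
  have [measurable]: "p \<in> borel_measurable borel" unfolding p_def[abs_def] by measurable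
  define U where "U = uniform_measure lborel {- 1 / 2..1 / 2 :: real}"
  have U: "prob_space U" unfolding U_def by (rule prob_space_uniform_measure) auto
  have setsU[measurable_cong]: "sets U = sets borel" by (simp add: U_def)
  have mean[measurable]: "(\<lambda>u. (\<Sum>j<N. u j) / real N) \<in> PiM {..<N} (\<lambda>_. U) \<rightarrow>\<^sub>M borel" by measurable
  have bates: "bates N = density lborel (\<lambda>x. ennreal (p x))"
  proof (rule measure_eqI)
    fix A assume "A \<in> sets (bates N)"
    then have [measurable]: "A \<in> sets borel" by (simp add: bates_def)
    have "emeasure (bates N) A = (\<integral>\<^sup>+u. indicator A ((\<Sum>j<N. u j) / real N) \<partial>PiM {..<N} (\<lambda>_. U))"
    proof -
      have "emeasure (bates N) A = (\<integral>\<^sup>+x. indicator A x \<partial>bates N)" by (simp add: bates_def)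
      also have "\<dots> = (\<integral>\<^sup>+u. indicator A ((\<Sum>j<N. u j) / real N) \<partial>PiM {..<N} (\<lambda>_. U))"
        unfolding bates_def U_def[symmetric] by (rule nn_integral_distr[OF mean]) simp
      finally show ?thesis .
    qed
    also have "\<dots> = (\<integral>\<^sup>+t. indicator A (t / real N) * uniform_sum_density k t \<partial>lborel)"
      unfolding U_def k by (rule nn_integral_uniform_sum[where f="\<lambda>t. indicator A (t / real (Suc k))"]) measurable
    also have "\<dots> = ennreal (real N) * (\<integral>\<^sup>+x. indicator A x * uniform_sum_density k (real N * x) \<partial>lborel)"
      using N by (subst nn_integral_real_affine[where c="real N" and t=0]) simp_all
    also have "\<dots> = (\<integral>\<^sup>+x. ennreal (real N) * (indicator A x * uniform_sum_density k (real N * x)) \<partial>lborel)"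
      by (rule nn_integral_cmult[symmetric]) measurable
    also have "\<dots> = (\<integral>\<^sup>+x. ennreal (p x) * indicator A x \<partial>lborel)"
      using F0 by (intro nn_integral_cong) (simp add: pN ennreal_mult F mult_ac)
    also have "\<dots> = emeasure (density lborel (\<lambda>x. ennreal (p x))) A"
      by (rule emeasure_density[symmetric]) simp_all
    finally show "emeasure (bates N) A = emeasure (density lborel (\<lambda>x. ennreal (p x))) A" .
  qed (simp add: bates_def)
  interpret even_density p
  proof (rule even_density.intro)
    show "p (- x) = p x" for x
      using uniform_sum_density_even[of k "real N * x"] by (simp add: pN F_def)
    have "prob_space (bates N)"
      unfolding bates_def U_def[symmetric] by (rule prob_space.prob_space_distr[OF prob_space_PiM mean]) (rule U)
    then show "prob_space (density lborel (\<lambda>x. ennreal (p x)))" by (simp only: bates)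
  qed (use F0 in \<open>auto simp: p_def\<close>)
  have p_zero: "p x = 0" if "1 / 2 < x" for x
    unfolding p_def using Feq0[of "real N * (1 / 2 - x)"] that N by (simp add: mult_pos_neg)
  have tail_half: "tail (1 / 2) = 0"
    using tail_le[of "1 / 2" "1 / 2" 0] p_zero tail_nonneg[of "1 / 2"] by simp
  have tail_upper: "tail (1 / 2 - z) \<le> (real N * z) ^ N" if z: "0 \<le> z" for z
  proof -
    have "tail (1 / 2 - z) \<le> (1 / 2 - (1 / 2 - z)) * (real N * (real N * z) ^ k)"
    proof (rule tail_le)
      fix x assume x: "1 / 2 - z < x" "x \<le> 1 / 2"
      have "F (real N / 2 - real N * (1 / 2 - x)) \<le> (real N * (1 / 2 - x)) ^ k" using x N by (intro Fle) simp
      also have "\<dots> \<le> (real N * z) ^ k" using x N by (intro power_mono mult_left_mono) auto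
      finally show "p x \<le> real N * (real N * z) ^ k" unfolding p_def using N by (intro mult_left_mono) auto
    qed (use z p_zero in auto)
    then show ?thesis by (simp add: k mult_ac)
  qed
  have tail_lower: "c * (real N * y / 2) ^ N \<le> tail (1 / 2 - y)" if y: "0 \<le> y" "real N * y \<le> 1" for y
  proof -
    have "((1 / 2 - y / 2) - (1 / 2 - y)) * (real N * (c * (real N * y / 2) ^ k)) \<le> tail (1 / 2 - y)"
    proof (rule tail_ge)
      fix x assume x: "1 / 2 - y < x" "x < 1 / 2 - y / 2"
      define w where "w = real N * (1 / 2 - x)"
      have "real N * (y / 2) \<le> w" "w \<le> real N * y" unfolding w_def using x N by (auto intro!: mult_left_mono)
      moreover have "0 \<le> real N * y" using y N by simp
      ultimately have w: "real N * y / 2 \<le> w" "0 \<le> w" "w \<le> 1" using y by auto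
      have "c * (real N * y / 2) ^ k \<le> c * w ^ k" using w y c N by (intro mult_left_mono power_mono) auto
      also have "\<dots> \<le> F (real N / 2 - w)" using w by (intro Fge) auto
      finally show "real N * (c * (real N * y / 2) ^ k) \<le> p x" unfolding p_def w_def using N by (intro mult_left_mono) auto
    qed (use y c N in auto)
    then show ?thesis by (simp add: k mult_ac)
  qed
  have powN: "(t powr (1 / real N)) ^ N = t" if "0 \<le> t" for t
  proof (cases "t = 0")
    case False
    then have "(t powr (1 / real N)) ^ N = (t powr (1 / real N)) powr real N" by (simp add: powr_realpow)
    also have "\<dots> = t" using False that N by (simp add: powr_powr)
    finally show ?thesis .
  qed (simp add: k)
  have "has_adaptive_rate \<alpha> P (\<lambda>n \<epsilon>. (1 / real n + \<epsilon>) powr (1 / real N))"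
  proof (rule has_adaptive_rateI[where R="\<lambda>\<tau>. \<tau> powr (1 / real N)" and b=1 and ?c0.0=1, OF \<alpha>])
    fix K :: real assume K: "0 < K"
    \<comment> \<open>Makes \<open>c * (N * d / 2) ^ N\<close> equal to \<open>K * \<tau>\<close>.
      Taking \<open>s = 1 / 2 - d\<close> puts \<open>s + d\<close> at the end point, where the tail
      is zero; the range of \<open>\<tau>\<close> gives \<open>N * d \<le> 1\<close>.\<close>
    define C where "C = 2 / real N * (K / c) powr (1 / real N)"
    have C: "0 < C" using N K c by (simp add: C_def)
    have "\<exists>s d. 0 \<le> d \<and> d \<le> C * \<tau> powr (1 / real N) \<and> K * (\<tau> + tail (s + d)) \<le> tail s"
      if \<tau>: "0 < \<tau>" "\<tau> \<le> c / (K * 2 ^ N)" for \<tau>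
    proof -
      define d where "d = C * \<tau> powr (1 / real N)"
      have d0: "0 \<le> d" using C by (simp add: d_def)
      have dN: "real N * d / 2 = (K / c * \<tau>) powr (1 / real N)"
        using N K c \<tau> by (simp add: d_def C_def powr_mult powr_divide)
      have "K / c * \<tau> \<le> (1 / 2) ^ N" using \<tau> K c by (simp add: field_simps power_one_over)
      then have "(K / c * \<tau>) powr (1 / real N) \<le> ((1 / 2) ^ N) powr (1 / real N)"
        using K c \<tau> by (intro powr_mono2) auto
      also have "\<dots> = ((1 / 2) powr real N) powr (1 / real N)" by (simp add: powr_realpow)
      also have "\<dots> = 1 / 2" using N by (simp add: powr_powr)
      finally have "real N * d \<le> 1" using dN by simp
      then have "c * (real N * d / 2) ^ N \<le> tail (1 / 2 - d)" using d0 by (intro tail_lower) auto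
      moreover have "c * (real N * d / 2) ^ N = K * \<tau>"
        unfolding dN using K c \<tau> by (subst powN) auto
      ultimately have "K * (\<tau> + tail ((1 / 2 - d) + d)) \<le> tail (1 / 2 - d)" by (simp add: tail_half)
      then show ?thesis using d0 order_refl[of d] unfolding d_def[symmetric] by blast
    qed
    then have "\<forall>\<tau>. 0 < \<tau> \<longrightarrow> \<tau> \<le> c / (K * 2 ^ N) \<longrightarrow>
        (\<exists>s d. 0 \<le> d \<and> d \<le> C * \<tau> powr (1 / real N) \<and> K * (\<tau> + tail (s + d)) \<le> tail s)"
      by blast
    moreover have "0 < c / (K * 2 ^ N)" using K c by simp
    ultimately show "\<exists>c>0. \<exists>C>0. \<forall>\<tau>. 0 < \<tau> \<longrightarrow> \<tau> \<le> c \<longrightarrow>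
        (\<exists>s d. 0 \<le> d \<and> d \<le> C * \<tau> powr (1 / real N) \<and> K * (\<tau> + tail (s + d)) \<le> tail s)"
      using C by blast
  next
    fix \<delta> :: real assume \<delta>: "0 < \<delta>" "\<delta> < 1"
    define \<rho> where "\<rho> = (1 + \<delta>) powr (1 / real N)"
    have \<rho>1: "1 < \<rho>" using \<delta> N unfolding \<rho>_def by (intro gr_one_powr) auto
    have \<rho>N: "\<rho> ^ N = 1 + \<delta>" unfolding \<rho>_def using \<delta> by (intro powN) auto
    then have \<rho>k: "\<rho> ^ k \<le> 1 + \<delta>" using \<rho>1 power_increasing[of k N \<rho>] by (simp add: k)
    \<comment> \<open>Solves \<open>(N * z) ^ N = \<delta> * \<tau>\<close> for
      \<open>z = r * \<rho> / (\<rho> - 1)\<close>, the distance of \<open>T - r\<close> from the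
      end point.\<close>
    define a where "a = \<delta> powr (1 / real N) * (\<rho> - 1) / (real N * \<rho>)"
    have a: "0 < a" using \<delta> \<rho>1 N by (simp add: a_def)
    have "\<exists>r T. a * \<tau> powr (1 / real N) \<le> r \<and> (\<forall>x\<le>T. p (x - r) \<le> (1 + \<delta>) * p x) \<and> tail (T - r) \<le> \<delta> * \<tau>"
      if \<tau>: "0 < \<tau>" "\<tau> \<le> 1" for \<tau>
    proof -
      define r where "r = a * \<tau> powr (1 / real N)"
      \<comment> \<open>Exactly up to this point does the shift enlarge the distance from the end
        point by a factor of at most \<open>\<rho>\<close>.\<close>
      define T where "T = 1 / 2 - r / (\<rho> - 1)"
      have r: "0 < r" using a \<tau> by (simp add: r_def)
      have ratio: "p (x - r) \<le> (1 + \<delta>) * p x" if x: "x \<le> T" for x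
      proof -
        define w where "w = real N * (1 / 2 - x)"
        have "r / (\<rho> - 1) \<le> 1 / 2 - x" using x by (simp add: T_def)
        then have "r \<le> (1 / 2 - x) * (\<rho> - 1)" using \<rho>1 by (simp add: pos_divide_le_eq)
        then have "real N * r \<le> real N * ((1 / 2 - x) * (\<rho> - 1))" using N by (intro mult_left_mono) auto
        also have "\<dots> = w * (\<rho> - 1)" by (simp only: w_def mult.assoc)
        finally have wr: "w + real N * r \<le> \<rho> * w" by (simp add: algebra_simps)
        have "0 < r / (\<rho> - 1)" using r \<rho>1 by simp
        then have w0: "0 < w" unfolding w_def using x N by (simp add: T_def)
        \<comment> \<open>Scaling the shifted distance by \<open>l\<close> returns \<open>w\<close>;
          \<open>\<rho> * l \<ge> 1\<close> bounds the loss \<open>l ^ k\<close> by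
          \<open>\<rho> ^ k \<le> 1 + \<delta>\<close>.\<close>
        define l where "l = w / (w + real N * r)"
        have v0: "0 < w + real N * r" using w0 r N by (simp add: add_pos_pos)
        have l: "0 < l" "l \<le> 1" "l * (w + real N * r) = w" using w0 v0 r N by (auto simp: l_def)
        have "1 \<le> \<rho> * l" using wr v0 by (simp add: l_def field_simps)
        then have "1 \<le> (\<rho> * l) ^ k" by (rule one_le_power)
        then have "F (real N / 2 - (w + real N * r)) \<le> (\<rho> * l) ^ k * F (real N / 2 - (w + real N * r))"
          using F0 mult_right_mono[of 1] by fastforce
        also have "\<dots> = \<rho> ^ k * (l ^ k * F (real N / 2 - (w + real N * r)))" by (simp add: power_mult_distrib)
        also have "\<dots> \<le> \<rho> ^ k * F (real N / 2 - w)"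
          using Fscale[OF l(1,2), of "w + real N * r"] \<rho>1 unfolding l(3) by (intro mult_left_mono) auto
        also have "\<dots> \<le> (1 + \<delta>) * F (real N / 2 - w)" using \<rho>k F0 by (intro mult_right_mono) auto
        finally have "real N * F (real N / 2 - (w + real N * r)) \<le> real N * ((1 + \<delta>) * F (real N / 2 - w))"
          using N by (intro mult_left_mono) auto
        moreover have "real N * (1 / 2 - (x - r)) = w + real N * r" by (simp add: w_def algebra_simps)
        ultimately show ?thesis unfolding p_def by (simp add: w_def mult_ac)
      qed
      define z where "z = r * \<rho> / (\<rho> - 1)"
      have z: "0 \<le> z" using r \<rho>1 by (simp add: z_def)
      have "T - r = 1 / 2 - z" using \<rho>1 by (simp add: T_def z_def field_simps)
      moreover have "real N * z = (\<delta> * \<tau>) powr (1 / real N)"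
        using \<rho>1 N \<delta> \<tau> by (simp add: z_def r_def a_def powr_mult)
      then have "(real N * z) ^ N = \<delta> * \<tau>" using \<delta> \<tau> by (simp only: powN mult_nonneg_nonneg less_imp_le)
      ultimately have "tail (T - r) \<le> \<delta> * \<tau>" using tail_upper[OF z] by simp
      then show ?thesis using ratio order_refl[of r] unfolding r_def[symmetric] by blast
    qed
    then show "\<exists>c>0. \<forall>\<tau>. 0 < \<tau> \<longrightarrow> \<tau> \<le> 1 \<longrightarrow>
        (\<exists>r T. c * \<tau> powr (1 / real N) \<le> r \<and> (\<forall>x\<le>T. p (x - r) \<le> (1 + \<delta>) * p x) \<and> tail (T - r) \<le> \<delta> * \<tau>)"
      using a by blast
  qed (auto simp: add.commute)
  then show ?thesis by (simp only: bates)
qed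

theorem theorem5:
  fixes \<alpha> :: real
  assumes "0 < \<alpha>" "\<alpha> < 1 / 4"
  shows "(\<forall>\<nu>>0. has_adaptive_rate \<alpha> (t_dist \<nu>) (\<lambda>n \<epsilon>. 1)) \<and>
    (\<forall>\<beta>>0. has_adaptive_rate \<alpha> (generalized_gaussian \<beta>)
       (\<lambda>n \<epsilon>. (1 / ln (real n) + inv_log_inv \<epsilon>) powr (max (\<beta> - 1) 0 / \<beta>))) \<and>
    (\<forall>\<beta>>0. has_adaptive_rate \<alpha> (mollifier \<beta>)
       (\<lambda>n \<epsilon>. (1 / ln (real n) + inv_log_inv \<epsilon>) powr ((\<beta> + 1) / \<beta>))) \<and>
    (\<forall>k\<ge>1. has_adaptive_rate \<alpha> (bates k)
       (\<lambda>n \<epsilon>. (1 / real n + \<epsilon>) powr (1 / real k)))"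
  by (intro conjI allI impI has_adaptive_rate_t_dist has_adaptive_rate_generalized_gaussian
      has_adaptive_rate_mollifier has_adaptive_rate_bates assms)

end
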